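(* Let $M$ be a smooth manifold and let $F=\sqrt{L(\alpha_1^2,\alpha_2^2)}$ be an $(\alpha_1,\alpha_2)$-metric on $M$. If $F$ is a Landsberg metric, then $F$ is a Berwald metric.
   Context: A Minkowski norm on a finite-dimensional real vector space $\mathbf V$ with linear coordinates $(y^i)$ is a continuous function $F:\mathbf V\to\mathbb R$ with $F(y)\ge 0$, equality iff $y=0$; $F(\lambda y)=\lambda F(y)$ for $\lambda>0$; $F$ smooth on $\mathbf V\backslash\{0\}$, with the Hessian matrix $(g_{ij}(y))=(\frac12[F^2]_{y^iy^j}(y))$ positive definite for all $y\ne 0$. $(g^{ij})$ denotes the inverse of $(g_{ij})$; subscripts $y^i$, $x^i$ denote partial derivatives; repeated indices are summed. A Finsler metric on a smooth $n$-manifold $M$ is a continuous function $F$ on $TM$, smooth on the slit tangent bundle $TM\backslash 0$, whose restriction to each tangent space is a Minkowski norm. Local coordinates $x=(x^i)$ on $M$ induce coordinates $(x^i,y^j)$ on $TM$ by $y=y^j\partial_{x^j}$. $(\alpha_1,\alpha_2)$-metrics: Let $\alpha$ be a Riemannian metric on $M$ and $TM=\mathcal V_1\oplus\mathcal V_2$ an $\alpha$-orthogonal decomposition into smooth linear subbundles of ranks $n_1,n_2\ge1$ (rank $1$ is allowed). Regard $\alpha_i=\alpha|_{\mathcal V_i}$ as a function on $TM$: $\alpha_i(y)$ is the $\alpha$-length of the $\alpha$-orthogonal projection of $y$ to $\mathcal V_i$. An $(\alpha_1,\alpha_2)$-metric is a Finsler metric of the form $F=\sqrt{L(\alpha_1^2,\alpha_2^2)}$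 for a real function $L$ of two variables (necessarily positively homogeneous of degree $1$). Geodesic spray coefficients: $G^i=\frac14 g^{il}([F^2]_{x^ky^l}y^k-[F^2]_{x^l})$. $F$ is a Landsberg metric if in every local coordinate system $y^jg_{ij}[G^i]_{y^py^qy^r}=0$ for all $p,q,r$. $F$ is a Berwald metric if in every local coordinate system $[G^i]_{y^py^qy^r}=0$ for all $i,p,q,r$, i.e. the $G^i$ are quadratic in the $y$-coordinates on each tangent space. *)

theory Defs
  imports "HOL-Analysis.Analysis" "HOL-Library.Function_Algebras"
begin

section \<open>Smooth maps and partial derivatives\<close>

text \<open>Intended for open \<open>S\<close> only.\<close>

primrec Ck_on :: "nat \<Rightarrow> 'a::euclidean_space set \<Rightarrow> ('a \<Rightarrow> 'b::real_normed_vector) \<Rightarrow> bool"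
  where
    "Ck_on 0 S f \<longleftrightarrow> continuous_on S f"
  | "Ck_on (Suc k) S f \<longleftrightarrow>
       (\<forall>x\<in>S. f differentiable (at x)) \<and>
       (\<forall>v. Ck_on k S (\<lambda>x. frechet_derivative f (at x) v))"

definition smooth_on :: "'a::euclidean_space set \<Rightarrow> ('a \<Rightarrow> 'b::real_normed_vector) \<Rightarrow> bool"
  where "smooth_on S f \<longleftrightarrow> (\<forall>k. Ck_on k S f)"

definition partial :: "'n::finite \<Rightarrow> (real^'n \<Rightarrow> real) \<Rightarrow> real^'n \<Rightarrow> real"
  where "partial i f z = frechet_derivative f (at z) (axis i 1)"

text \<open>For functions of \<open>(x, y)\<close>, written in curried form: the derivatives with respect
  to \<open>x\<^sup>i\<close> and to \<open>y\<^sup>i\<close>.\<close>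

definition partial_x :: "'n::finite \<Rightarrow> (real^'n \<Rightarrow> real^'n \<Rightarrow> real) \<Rightarrow> real^'n \<Rightarrow> real^'n \<Rightarrow> real"
  where "partial_x i f x y = partial i (\<lambda>x'. f x' y) x"

definition partial_y :: "'n::finite \<Rightarrow> (real^'n \<Rightarrow> real^'n \<Rightarrow> real) \<Rightarrow> real^'n \<Rightarrow> real^'n \<Rightarrow> real"
  where "partial_y i f x y = partial i (f x) y"


section \<open>Smooth manifolds\<close>

text \<open>A chart is a coordinate domain together with a coordinate map; the values of the map
  outside the domain are irrelevant.\<close>

type_synonym ('m, 'n) chart = "'m set \<times> ('m \<Rightarrow> real^'n)"

definition is_chart :: "'m topology \<Rightarrow> ('m, 'n::finite) chart \<Rightarrow> bool"
  where "is_chart X c \<longleftrightarrow>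
    openin X (fst c) \<and> open (snd c ` fst c) \<and>
    homeomorphic_map (subtopology X (fst c)) (top_of_set (snd c ` fst c)) (snd c)"

definition chart_image :: "('m, 'n::finite) chart \<Rightarrow> (real^'n) set"
  where "chart_image c = snd c ` fst c"

definition chart_inv :: "('m, 'n::finite) chart \<Rightarrow> real^'n \<Rightarrow> 'm"
  where "chart_inv c = inv_into (fst c) (snd c)"

definition transition :: "('m, 'n::finite) chart \<Rightarrow> ('m, 'n) chart \<Rightarrow> real^'n \<Rightarrow> real^'n"
  where "transition c d = snd d \<circ> chart_inv c"

definition compatible :: "('m, 'n::finite) chart \<Rightarrow> ('m, 'n) chart \<Rightarrow> bool"
  where "compatible c d \<longleftrightarrow>
    smooth_on (snd c ` (fst c \<inter> fst d)) (transition c d) \<and>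
    smooth_on (snd d ` (fst c \<inter> fst d)) (transition d c)"

text \<open>The atlas is maximal, so its elements are exactly the local coordinate systems of the
  manifold. The dimension is \<open>CARD('n)\<close>.\<close>

definition smooth_manifold :: "'m topology \<Rightarrow> ('m, 'n::finite) chart set \<Rightarrow> bool"
  where "smooth_manifold X A \<longleftrightarrow>
    Hausdorff_space X \<and> second_countable X \<and>
    (\<forall>c\<in>A. is_chart X c) \<and> (\<Union>c\<in>A. fst c) = topspace X \<and>
    (\<forall>c\<in>A. \<forall>d\<in>A. compatible c d) \<and>
    (\<forall>c. is_chart X c \<and> (\<forall>d\<in>A. compatible c d) \<longrightarrow> c \<in> A)"


section \<open>Tangent vectors\<close>

text \<open>A tangent vector at \<open>p\<close> is the family of its component vectors in all charts around \<open>p\<close>,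
  subject to the usual transformation law; by convention it is \<open>0\<close> at all other indices.
  The tangent space is a linear subspace for the pointwise operations.\<close>

instantiation "fun" :: (type, real_vector) real_vector
begin

definition scaleR_fun :: "real \<Rightarrow> ('a \<Rightarrow> 'b) \<Rightarrow> 'a \<Rightarrow> 'b"
  where "scaleR_fun r f = (\<lambda>x. r *\<^sub>R f x)"

instance
  by standard (auto simp: scaleR_fun_def plus_fun_def fun_eq_iff scaleR_add_right scaleR_add_left)

end

type_synonym ('m, 'n) tvec = "('m, 'n) chart \<Rightarrow> real^'n"

definition tangent_space :: "('m, 'n::finite) chart set \<Rightarrow> 'm \<Rightarrow> ('m, 'n) tvec set"
  where "tangent_space A p = {v.
    (\<forall>c\<in>A. \<forall>d\<in>A. p \<in> fst c \<and> p \<in> fst d \<longrightarrow>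
       v d = frechet_derivative (transition c d) (at (snd c p)) (v c)) \<and>
    (\<forall>c. \<not> (c \<in> A \<and> p \<in> fst c) \<longrightarrow> v c = 0)}"

text \<open>The tangent vector \<open>y\<^sup>j \<partial>\<^sub>j\<close> at \<open>p\<close>, that is, the one with components \<open>y\<close> in the chart
  \<open>c\<close> around \<open>p\<close>.\<close>

definition coord_vec :: "('m, 'n::finite) chart set \<Rightarrow> ('m, 'n) chart \<Rightarrow> 'm \<Rightarrow> real^'n \<Rightarrow> ('m, 'n) tvec"
  where "coord_vec A c p = inv_into (tangent_space A p) (\<lambda>v. v c)"

text \<open>A function on the tangent bundle is given in curried form, \<open>F p v\<close> with \<open>v\<close> tangent at \<open>p\<close>
  (values elsewhere are irrelevant). The following is its expression in the induced
  coordinates \<open>(x, y)\<close>. The topology and the smooth structure of the tangent bundle are the ones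
  given by these coordinates.\<close>

definition local_fun ::
    "('m, 'n::finite) chart set \<Rightarrow> ('m, 'n) chart \<Rightarrow> ('m \<Rightarrow> ('m, 'n) tvec \<Rightarrow> real) \<Rightarrow>
      real^'n \<Rightarrow> real^'n \<Rightarrow> real"
  where "local_fun A c F x y = F (chart_inv c x) (coord_vec A c (chart_inv c x) y)"


section \<open>Finsler metrics\<close>

definition half_hessian_sq :: "(real^'n::finite \<Rightarrow> real) \<Rightarrow> real^'n \<Rightarrow> real^'n^'n"
  where "half_hessian_sq f y = (\<chi> i j. 1/2 * partial j (partial i (\<lambda>z. (f z)\<^sup>2)) y)"

definition minkowski_norm :: "(real^'n::finite \<Rightarrow> real) \<Rightarrow> bool"
  where "minkowski_norm f \<longleftrightarrow>
    continuous_on UNIV f \<and>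
    (\<forall>y. f y \<ge> 0 \<and> (f y = 0 \<longleftrightarrow> y = 0)) \<and>
    (\<forall>y. \<forall>r>0. f (r *\<^sub>R y) = r * f y) \<and>
    smooth_on (UNIV - {0}) f \<and>
    (\<forall>y. y \<noteq> 0 \<longrightarrow> (\<forall>w. w \<noteq> 0 \<longrightarrow> w \<bullet> (half_hessian_sq f y *v w) > 0))"

definition finsler_metric :: "('m, 'n::finite) chart set \<Rightarrow> ('m \<Rightarrow> ('m, 'n) tvec \<Rightarrow> real) \<Rightarrow> bool"
  where "finsler_metric A F \<longleftrightarrow> (\<forall>c\<in>A.
    continuous_on (chart_image c \<times> UNIV) (\<lambda>(x, y). local_fun A c F x y) \<and>
    smooth_on (chart_image c \<times> (UNIV - {0})) (\<lambda>(x, y). local_fun A c F x y) \<and>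
    (\<forall>x\<in>chart_image c. minkowski_norm (local_fun A c F x)))"

text \<open>In the following two definitions, \<open>f\<close> is a Finsler metric expressed in local coordinates.\<close>

definition fundamental_tensor ::
    "(real^'n::finite \<Rightarrow> real^'n \<Rightarrow> real) \<Rightarrow> real^'n \<Rightarrow> real^'n \<Rightarrow> real^'n^'n"
  where "fundamental_tensor f x y = half_hessian_sq (f x) y"

definition spray_coeff ::
    "(real^'n::finite \<Rightarrow> real^'n \<Rightarrow> real) \<Rightarrow> 'n \<Rightarrow> real^'n \<Rightarrow> real^'n \<Rightarrow> real"
  where "spray_coeff f i x y =
    1/4 * (\<Sum>l\<in>UNIV. matrix_inv (fundamental_tensor f x y) $ i $ l *
      ((\<Sum>k\<in>UNIV. partial_y l (partial_x k (\<lambda>x y. (f x y)\<^sup>2)) x y * y $ k)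
        - partial_x l (\<lambda>x y. (f x y)\<^sup>2) x y))"

definition landsberg_metric :: "('m, 'n::finite) chart set \<Rightarrow> ('m \<Rightarrow> ('m, 'n) tvec \<Rightarrow> real) \<Rightarrow> bool"
  where "landsberg_metric A F \<longleftrightarrow> finsler_metric A F \<and>
    (\<forall>c\<in>A. \<forall>x\<in>chart_image c. \<forall>y. y \<noteq> 0 \<longrightarrow> (\<forall>p q r.
      (\<Sum>i\<in>UNIV. \<Sum>j\<in>UNIV. y $ j * fundamental_tensor (local_fun A c F) x y $ i $ j *
        partial_y r (partial_y q (partial_y p (spray_coeff (local_fun A c F) i))) x y) = 0))"

definition berwald_metric :: "('m, 'n::finite) chart set \<Rightarrow> ('m \<Rightarrow> ('m, 'n) tvec \<Rightarrow> real) \<Rightarrow> bool"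
  where "berwald_metric A F \<longleftrightarrow> finsler_metric A F \<and>
    (\<forall>c\<in>A. \<forall>x\<in>chart_image c. \<forall>y. y \<noteq> 0 \<longrightarrow> (\<forall>i p q r.
      partial_y r (partial_y q (partial_y p (spray_coeff (local_fun A c F) i))) x y = 0))"


section \<open>Riemannian metrics, subbundles and \<open>(\<alpha>\<^sub>1, \<alpha>\<^sub>2)\<close>-metrics\<close>

definition riemannian_metric ::
    "'m topology \<Rightarrow> ('m, 'n::finite) chart set \<Rightarrow>
      ('m \<Rightarrow> ('m, 'n) tvec \<Rightarrow> ('m, 'n) tvec \<Rightarrow> real) \<Rightarrow> bool"
  where "riemannian_metric X A a \<longleftrightarrow>
    (\<forall>p\<in>topspace X. \<forall>u\<in>tangent_space A p. \<forall>v\<in>tangent_space A p. \<forall>w\<in>tangent_space A p. \<forall>r s.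
      a p (r *\<^sub>R u + s *\<^sub>R v) w = r * a p u w + s * a p v w) \<and>
    (\<forall>p\<in>topspace X. \<forall>u\<in>tangent_space A p. \<forall>v\<in>tangent_space A p. a p u v = a p v u) \<and>
    (\<forall>p\<in>topspace X. \<forall>u\<in>tangent_space A p. u \<noteq> 0 \<longrightarrow> a p u u > 0) \<and>
    (\<forall>c\<in>A. \<forall>i j. smooth_on (chart_image c)
      (\<lambda>x. a (chart_inv c x) (coord_vec A c (chart_inv c x) (axis i 1))
                             (coord_vec A c (chart_inv c x) (axis j 1))))"

definition smooth_vector_field_on ::
    "('m, 'n::finite) chart set \<Rightarrow> 'm set \<Rightarrow> ('m \<Rightarrow> ('m, 'n) tvec) \<Rightarrow> bool"
  where "smooth_vector_field_on A W Y \<longleftrightarrow>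
    (\<forall>p\<in>W. Y p \<in> tangent_space A p) \<and>
    (\<forall>c\<in>A. smooth_on (snd c ` (W \<inter> fst c)) (\<lambda>x. Y (chart_inv c x) c))"

text \<open>Smoothness of a subbundle of rank \<open>k\<close>: it has smooth local frames.\<close>

definition smooth_subbundle ::
    "'m topology \<Rightarrow> ('m, 'n::finite) chart set \<Rightarrow> nat \<Rightarrow> ('m \<Rightarrow> ('m, 'n) tvec set) \<Rightarrow> bool"
  where "smooth_subbundle X A k V \<longleftrightarrow>
    (\<forall>p\<in>topspace X.
      subspace (V p) \<and> V p \<subseteq> tangent_space A p \<and> dim (V p) = k \<and>
      (\<exists>W Y. openin X W \<and> p \<in> W \<and> (\<forall>j<k. smooth_vector_field_on A W (Y j)) \<and>
        (\<forall>q\<in>W. V q = span ((\<lambda>j. Y j q) ` {..<k}))))"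

definition orthogonal_decomposition ::
    "'m topology \<Rightarrow> ('m, 'n::finite) chart set \<Rightarrow>
      ('m \<Rightarrow> ('m, 'n) tvec \<Rightarrow> ('m, 'n) tvec \<Rightarrow> real) \<Rightarrow>
      ('m \<Rightarrow> ('m, 'n) tvec set) \<Rightarrow> ('m \<Rightarrow> ('m, 'n) tvec set) \<Rightarrow> bool"
  where "orthogonal_decomposition X A a V1 V2 \<longleftrightarrow>
    (\<forall>p\<in>topspace X.
      tangent_space A p = {u + v |u v. u \<in> V1 p \<and> v \<in> V2 p} \<and> V1 p \<inter> V2 p = {0} \<and>
      (\<forall>u\<in>V1 p. \<forall>v\<in>V2 p. a p u v = 0))"

definition orth_proj ::
    "('m \<Rightarrow> ('m, 'n::finite) tvec \<Rightarrow> ('m, 'n) tvec \<Rightarrow> real) \<Rightarrow> ('m \<Rightarrow> ('m, 'n) tvec set) \<Rightarrow>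
      'm \<Rightarrow> ('m, 'n) tvec \<Rightarrow> ('m, 'n) tvec"
  where "orth_proj a V p y = (THE w. w \<in> V p \<and> (\<forall>u\<in>V p. a p (y - w) u = 0))"

definition alpha_restr ::
    "('m \<Rightarrow> ('m, 'n::finite) tvec \<Rightarrow> ('m, 'n) tvec \<Rightarrow> real) \<Rightarrow> ('m \<Rightarrow> ('m, 'n) tvec set) \<Rightarrow>
      'm \<Rightarrow> ('m, 'n) tvec \<Rightarrow> real"
  where "alpha_restr a V p y = sqrt (a p (orth_proj a V p y) (orth_proj a V p y))"

definition alpha12_metric ::
    "'m topology \<Rightarrow> ('m, 'n::finite) chart set \<Rightarrow>
      ('m \<Rightarrow> ('m, 'n) tvec \<Rightarrow> ('m, 'n) tvec \<Rightarrow> real) \<Rightarrow> nat \<Rightarrow> nat \<Rightarrow>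
      ('m \<Rightarrow> ('m, 'n) tvec set) \<Rightarrow> ('m \<Rightarrow> ('m, 'n) tvec set) \<Rightarrow>
      (real \<Rightarrow> real \<Rightarrow> real) \<Rightarrow> ('m \<Rightarrow> ('m, 'n) tvec \<Rightarrow> real) \<Rightarrow> bool"
  where "alpha12_metric X A a n1 n2 V1 V2 L F \<longleftrightarrow>
    riemannian_metric X A a \<and>
    n1 \<ge> 1 \<and> n2 \<ge> 1 \<and> smooth_subbundle X A n1 V1 \<and> smooth_subbundle X A n2 V2 \<and>
    orthogonal_decomposition X A a V1 V2 \<and>
    finsler_metric A F \<and>
    (\<forall>p\<in>topspace X. \<forall>y\<in>tangent_space A p.
      F p y = sqrt (L ((alpha_restr a V1 p y)\<^sup>2) ((alpha_restr a V2 p y)\<^sup>2)))"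

end

theory Submission
  imports Defs
begin

text \<open>Fix a point and put \<open>E = F\<^sup>2\<close>. The connection \<open>\<nabla>\<close> that preserves \<open>\<alpha>\<^sub>1\<close> and \<open>\<alpha>\<^sub>2\<close> (with torsion)
  satisfies \<open>E\<^bsub>x\<^esub> = E\<^bsub>y\<^esub> \<Gamma> y\<close>, so the difference \<open>Z\<close> between the spray of \<open>F\<close> and that of \<open>\<nabla>\<close> is determined by the
  Hessian of \<open>E\<close> and the torsion \<open>T\<close>: \<open>E''(Z, \<xi>) = - E' T(\<xi>, y)\<close>. Since the spray of \<open>\<nabla>\<close> is quadratic,
  the Landsberg condition is \<open>E' Z''' = 0\<close> and the goal is that \<open>Z\<close> is quadratic.

  Restrict to the plane spanned by \<open>u \<in> \<V>\<^sub>1\<close> and \<open>v \<in> \<V>\<^sub>2\<close>, and let \<open>\<psi>(x) = E\<^sub>u / E\<^sub>v\<close> at \<open>x u + v\<close>.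
  If the torsion of the plane does not vanish, the equations force the Schwarzian derivative of \<open>\<psi>\<close> to vanish.
  As \<open>\<psi>\<close> is odd and increasing on the whole line, it is linear, and then \<open>F\<close> is Euclidean on the tangent space. Otherwise
  the only nonquadratic part of \<open>Z\<close> is a rotational term with coefficient the ratio of the two partial derivatives of \<open>L\<close>,
  and the Landsberg condition in directions of \<open>\<V>\<^sub>1\<close> or \<open>\<V>\<^sub>2\<close> shows
  that this term vanishes or that the ratio is constant, which is again the Euclidean case.\<close>

subsection \<open>Directional derivatives and smooth functions\<close>

text \<open>Putting \<xi> = y into the equation for Z gives E' Z = 0, since T is alternating. On the
  plane this eliminates one of the two in-plane components of Z, so in the Landsberg condition along
  u the third derivative of the other one cancels and only Leibniz terms with derivatives of \<psi>
  remain. The equation for \<xi> = u is algebraic in the last unknown; differentiating it twice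
  removes the derivatives of that unknown, and a multiple of the Schwarzian is left. In the
  Euclidean case the Hessian of E is constant, so the equation for Z itself makes Z quadratic. The
  obstacle is regularity: no differentiability of L is assumed, and E is smooth only away from 0.
  Instead of the chain rule for L, vectors with equal partial lengths are compared: reflections give
  vanishing and evenness statements, and rescaling the two components of y trades a change of the
  base point for a change of y. Formulas with A(y, y) or B(y, y) in a denominator are proved for
  vectors with two nonzero components and reach the others by continuity along a ray.\<close>

definition dir_deriv :: "'a::euclidean_space \<Rightarrow> ('a \<Rightarrow> 'b::real_normed_vector) \<Rightarrow> 'a \<Rightarrow> 'b"
  where "dir_deriv v f x = frechet_derivative f (at x) v"

lemma dir_deriv_eq: "(f has_derivative D) (at x) \<Longrightarrow> dir_deriv v f x = D v"
  unfolding dir_deriv_def by (metis frechet_derivative_at)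

lemma has_derivative_dir_deriv:
  "f differentiable (at x) \<Longrightarrow> (f has_derivative (\<lambda>v. dir_deriv v f x)) (at x)"
  unfolding dir_deriv_def by (simp add: frechet_derivative_works[symmetric])

lemma dir_deriv_cong:
  assumes "open S" "x \<in> S" "\<And>x. x \<in> S \<Longrightarrow> f x = g x"
  shows "dir_deriv v f x = dir_deriv v g x"
proof -
  have "(f has_derivative D) (at x) \<longleftrightarrow> (g has_derivative D) (at x)" for D
    using has_derivative_transform_within_open[of f D x UNIV S g]
      has_derivative_transform_within_open[of g D x UNIV S f] assms by auto
  then show ?thesis
    by (simp only: dir_deriv_def frechet_derivative_def)
qed

lemma linear_dir_deriv:
  assumes "f differentiable (at x)"
  shows "linear (\<lambda>v. dir_deriv v f x)"
  using linear_frechet_derivative[OF assms] by (simp add: dir_deriv_def[abs_def])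

lemma dir_deriv_bounded_linear:
  assumes "bounded_linear h" "f differentiable (at x)"
  shows "dir_deriv v (\<lambda>x. h (f x)) x = h (dir_deriv v f x)"
  by (rule dir_deriv_eq, rule bounded_linear.has_derivative[OF assms(1)])
    (rule has_derivative_dir_deriv[OF assms(2)])

lemma dir_deriv_line:
  fixes f :: "'a::euclidean_space \<Rightarrow> 'b::real_normed_vector"
  assumes "f differentiable (at (x + t *\<^sub>R v))"
  shows "((\<lambda>t. f (x + t *\<^sub>R v)) has_vector_derivative dir_deriv v f (x + t *\<^sub>R v)) (at t)"
proof -
  have "((\<lambda>t. x + t *\<^sub>R v) has_derivative (\<lambda>t. t *\<^sub>R v)) (at t)"
    by (auto intro!: derivative_eq_intros)
  then have "((\<lambda>t. f (x + t *\<^sub>R v)) has_derivative (\<lambda>s. dir_deriv (s *\<^sub>R v) f (x + t *\<^sub>R v))) (at t)"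
    using has_derivative_compose[where g = f and g' = "\<lambda>s. dir_deriv s f (x + t *\<^sub>R v)"]
      has_derivative_dir_deriv[OF assms] by blast
  moreover have "dir_deriv (s *\<^sub>R v) f (x + t *\<^sub>R v) = s *\<^sub>R dir_deriv v f (x + t *\<^sub>R v)" for s
    using linear_cmul[OF linear_dir_deriv[OF assms]] .
  ultimately show ?thesis
    by (simp add: has_vector_derivative_def)
qed

lemma dir_deriv_even_eq_0:
  fixes f :: "'a::euclidean_space \<Rightarrow> real"
  assumes "f differentiable (at x)" "\<And>t. f (x + t *\<^sub>R v) = f (x + (-t) *\<^sub>R v)"
  shows "dir_deriv v f x = 0"
proof -
  have d: "((\<lambda>t. f (x + t *\<^sub>R v)) has_real_derivative dir_deriv v f x) (at 0)"
    using dir_deriv_line[of f x 0 v] assms(1)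
    by (simp add: has_real_derivative_iff_has_vector_derivative)
  then have "((\<lambda>t. f (x + (-t) *\<^sub>R v)) has_real_derivative dir_deriv v f x * (-1)) (at 0)"
    by (intro DERIV_chain'[where g = "\<lambda>t. f (x + t *\<^sub>R v)" and f = uminus])
      (auto intro!: derivative_eq_intros)
  then have "((\<lambda>t. f (x + t *\<^sub>R v)) has_real_derivative - dir_deriv v f x) (at 0)"
    by (simp only: assms(2)[symmetric] mult_minus_right mult_1_right)
  from DERIV_unique[OF d this] show ?thesis by simp
qed

section \<open>Closure properties of smooth functions\<close>

lemma Ck_on_Suc_dir_deriv:
  "Ck_on (Suc k) S f \<longleftrightarrow> (\<forall>x\<in>S. f differentiable (at x)) \<and> (\<forall>v. Ck_on k S (dir_deriv v f))"
  by (simp add: dir_deriv_def[abs_def])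

declare Ck_on.simps(2) [simp del]

lemma Ck_on_cong:
  assumes "open S" "\<And>x. x \<in> S \<Longrightarrow> f x = g x"
  shows "Ck_on k S f \<longleftrightarrow> Ck_on k S g"
  using assms(2)
proof (induction k arbitrary: f g)
  case 0
  then show ?case by (auto cong: continuous_on_cong)
next
  case (Suc k)
  have "f differentiable (at x) \<longleftrightarrow> g differentiable (at x)" if "x \<in> S" for x
    using has_derivative_transform_within_open[of f _ x UNIV S g]
      has_derivative_transform_within_open[of g _ x UNIV S f] Suc.prems assms(1) that
    unfolding differentiable_def by auto
  moreover have "Ck_on k S (dir_deriv v f) \<longleftrightarrow> Ck_on k S (dir_deriv v g)" for v
    by (rule Suc.IH) (use dir_deriv_cong[OF assms(1)] Suc.prems in blast)
  ultimately show ?case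
    unfolding Ck_on_Suc_dir_deriv by blast
qed

lemma Ck_on_subset: "Ck_on k S f \<Longrightarrow> T \<subseteq> S \<Longrightarrow> Ck_on k T f"
proof (induction k arbitrary: f)
  case (Suc k)
  then show ?case unfolding Ck_on_Suc_dir_deriv by blast
qed (auto intro: continuous_on_subset)

lemma Ck_on_Suc_imp: "Ck_on (Suc k) S f \<Longrightarrow> Ck_on k S f"
proof (induction k arbitrary: f)
  case 0
  then have "f differentiable_on S"
    using differentiable_at_withinI unfolding differentiable_on_def Ck_on_Suc_dir_deriv by blast
  then show ?case by (simp add: differentiable_imp_continuous_on)
next
  case (Suc k)
  then show ?case unfolding Ck_on_Suc_dir_deriv[of "Suc k"] Ck_on_Suc_dir_deriv[of k] by blast
qed

lemma Ck_on_const: "Ck_on k S (\<lambda>_. c)"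
  by (induction k arbitrary: c) (auto simp: Ck_on_Suc_dir_deriv dir_deriv_def[abs_def])

lemma Ck_on_bounded_linear_comp:
  assumes "open S" "bounded_linear h" "Ck_on k S f"
  shows "Ck_on k S (\<lambda>x. h (f x))"
  using assms(3)
proof (induction k arbitrary: f)
  case 0
  then show ?case using assms(2) by (auto intro: bounded_linear.continuous_on)
next
  case (Suc k)
  then have d: "\<forall>x\<in>S. f differentiable (at x)" by (simp add: Ck_on_Suc_dir_deriv)
  have "Ck_on k S (dir_deriv v (\<lambda>x. h (f x)))" for v
  proof (subst Ck_on_cong[OF assms(1)])
    show "dir_deriv v (\<lambda>x. h (f x)) x = h (dir_deriv v f x)" if "x \<in> S" for x
      using dir_deriv_bounded_linear[OF assms(2)] d that by blast
    show "Ck_on k S (\<lambda>x. h (dir_deriv v f x))"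
      using Suc by (auto simp: Ck_on_Suc_dir_deriv)
  qed
  moreover have "(\<lambda>x. h (f x)) differentiable (at x)" if "x \<in> S" for x
    using d that assms(2) bounded_linear.has_derivative unfolding differentiable_def by blast
  ultimately show ?case by (simp add: Ck_on_Suc_dir_deriv)
qed

lemma Ck_on_ident: "Ck_on k S (\<lambda>x. x)"
proof (cases k)
  case (Suc k)
  have "dir_deriv v (\<lambda>x. x) = (\<lambda>_. v)" for v :: 'a by (simp add: dir_deriv_def[abs_def])
  with Suc show ?thesis by (simp add: Ck_on_Suc_dir_deriv Ck_on_const)
qed auto

lemma Ck_on_add:
  assumes "open S" "Ck_on k S f" "Ck_on k S g"
  shows "Ck_on k S (\<lambda>x. f x + g x)"
  using assms(2,3)
proof (induction k arbitrary: f g)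
  case 0
  then show ?case by (auto intro: continuous_on_add)
next
  case (Suc k)
  then have d: "f differentiable (at x)" "g differentiable (at x)" if "x \<in> S" for x
    using that by (auto simp: Ck_on_Suc_dir_deriv)
  have "Ck_on k S (dir_deriv v (\<lambda>x. f x + g x))" for v
  proof (subst Ck_on_cong[OF assms(1)])
    show "dir_deriv v (\<lambda>x. f x + g x) x = dir_deriv v f x + dir_deriv v g x" if "x \<in> S" for x
      using d[OF that] by (intro dir_deriv_eq) (auto intro!: derivative_eq_intros has_derivative_dir_deriv)
    show "Ck_on k S (\<lambda>x. dir_deriv v f x + dir_deriv v g x)"
      using Suc by (auto simp: Ck_on_Suc_dir_deriv)
  qed
  then show ?case using d by (auto simp: Ck_on_Suc_dir_deriv)
qed

lemma Ck_on_sum: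
  assumes "open S" "\<And>i. i \<in> I \<Longrightarrow> Ck_on k S (f i)"
  shows "Ck_on k S (\<lambda>x. \<Sum>i\<in>I. f i x)"
  using assms(2)
proof (induction I rule: infinite_finite_induct)
  case (insert i I)
  then show ?case using Ck_on_add[OF assms(1), of k "f i"] by simp
qed (simp_all add: Ck_on_const)

lemma Ck_on_mult:
  fixes f g :: "'a::euclidean_space \<Rightarrow> real"
  assumes "open S" "Ck_on k S f" "Ck_on k S g"
  shows "Ck_on k S (\<lambda>x. f x * g x)"
  using assms(2,3)
proof (induction k arbitrary: f g)
  case 0
  then show ?case by (auto intro: continuous_on_mult)
next
  case (Suc k)
  then have d: "f differentiable (at x)" "g differentiable (at x)" if "x \<in> S" for x
    using that by (auto simp: Ck_on_Suc_dir_deriv)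
  have "Ck_on k S (dir_deriv v (\<lambda>x. f x * g x))" for v
  proof (subst Ck_on_cong[OF assms(1)])
    show "dir_deriv v (\<lambda>x. f x * g x) x = f x * dir_deriv v g x + dir_deriv v f x * g x" if "x \<in> S" for x
      using d[OF that] by (intro dir_deriv_eq) (auto intro!: derivative_eq_intros has_derivative_dir_deriv)
    have "Ck_on k S f" "Ck_on k S g" using Suc.prems by (auto intro: Ck_on_Suc_imp)
    then show "Ck_on k S (\<lambda>x. f x * dir_deriv v g x + dir_deriv v f x * g x)"
      using Suc.prems Suc.IH by (intro Ck_on_add assms(1)) (auto simp: Ck_on_Suc_dir_deriv)
  qed
  then show ?case using d by (auto simp: Ck_on_Suc_dir_deriv)
qed

lemma Ck_on_prod:
  fixes f :: "'i \<Rightarrow> 'a::euclidean_space \<Rightarrow> real"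
  assumes "open S" "\<And>i. i \<in> I \<Longrightarrow> Ck_on k S (f i)"
  shows "Ck_on k S (\<lambda>x. \<Prod>i\<in>I. f i x)"
  using assms(2)
proof (induction I rule: infinite_finite_induct)
  case (insert i I)
  then show ?case using Ck_on_mult[OF assms(1), of k "f i"] by simp
qed (simp_all add: Ck_on_const)

lemma Ck_on_inverse:
  fixes f :: "'a::euclidean_space \<Rightarrow> real"
  assumes "open S" "\<And>x. x \<in> S \<Longrightarrow> f x \<noteq> 0" "Ck_on k S f"
  shows "Ck_on k S (\<lambda>x. inverse (f x))"
  using assms(3)
proof (induction k)
  case 0
  then show ?case using assms(2) by (auto intro: continuous_on_inverse)
next
  case (Suc k)
  then have d: "f differentiable (at x)" if "x \<in> S" for x
    using that by (auto simp: Ck_on_Suc_dir_deriv)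
  have D: "((\<lambda>x. inverse (f x)) has_derivative
      (\<lambda>v. - (inverse (f x) * dir_deriv v f x * inverse (f x)))) (at x)" if "x \<in> S" for x
    using d[OF that] assms(2)[OF that]
    by (auto intro!: derivative_eq_intros has_derivative_dir_deriv)
  have "Ck_on k S (dir_deriv v (\<lambda>x. inverse (f x)))" for v
  proof (subst Ck_on_cong[OF assms(1)])
    show "dir_deriv v (\<lambda>x. inverse (f x)) x = (-1) * (inverse (f x) * dir_deriv v f x * inverse (f x))"
      if "x \<in> S" for x
      using dir_deriv_eq[OF D[OF that]] by simp
    have "Ck_on k S (\<lambda>x. inverse (f x))" using Suc by (auto intro: Ck_on_Suc_imp)
    then show "Ck_on k S (\<lambda>x. (-1) * (inverse (f x) * dir_deriv v f x * inverse (f x)))"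
      using Suc.prems by (intro Ck_on_mult Ck_on_const assms(1)) (auto simp: Ck_on_Suc_dir_deriv)
  qed
  then show ?case using D by (auto simp: Ck_on_Suc_dir_deriv differentiable_def)
qed

lemma smooth_on_const: "smooth_on S (\<lambda>_. c)"
  by (simp add: smooth_on_def Ck_on_const)

lemma smooth_on_bounded_linear_comp:
  "open S \<Longrightarrow> bounded_linear h \<Longrightarrow> smooth_on S f \<Longrightarrow> smooth_on S (\<lambda>x. h (f x))"
  by (simp add: smooth_on_def Ck_on_bounded_linear_comp)

lemma smooth_on_bounded_linear: "open S \<Longrightarrow> bounded_linear h \<Longrightarrow> smooth_on S h"
  using smooth_on_bounded_linear_comp[of S h "\<lambda>x. x"] by (simp add: smooth_on_def Ck_on_ident)

lemma smooth_on_add: "open S \<Longrightarrow> smooth_on S f \<Longrightarrow> smooth_on S g \<Longrightarrow> smooth_on S (\<lambda>x. f x + g x)"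
  by (simp add: smooth_on_def Ck_on_add)

lemma smooth_on_sum:
  "open S \<Longrightarrow> (\<And>i. i \<in> I \<Longrightarrow> smooth_on S (f i)) \<Longrightarrow> smooth_on S (\<lambda>x. \<Sum>i\<in>I. f i x)"
  by (simp add: smooth_on_def Ck_on_sum)

lemma smooth_on_mult:
  fixes f g :: "'a::euclidean_space \<Rightarrow> real"
  shows "open S \<Longrightarrow> smooth_on S f \<Longrightarrow> smooth_on S g \<Longrightarrow> smooth_on S (\<lambda>x. f x * g x)"
  by (simp add: smooth_on_def Ck_on_mult)

lemma smooth_on_diff:
  assumes "open S" "smooth_on S f" "smooth_on S g"
  shows "smooth_on S (\<lambda>x. f x - g x)"
  using smooth_on_add[OF assms(1,2) smooth_on_bounded_linear_comp[OF assms(1) _ assms(3), of uminus]]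
  by (simp add: bounded_linear_minus bounded_linear_ident)

lemma smooth_on_power2:
  fixes f :: "'a::euclidean_space \<Rightarrow> real"
  shows "open S \<Longrightarrow> smooth_on S f \<Longrightarrow> smooth_on S (\<lambda>x. (f x)\<^sup>2)"
  by (simp add: power2_eq_square smooth_on_mult)

lemma smooth_on_prod:
  fixes f :: "'i \<Rightarrow> 'a::euclidean_space \<Rightarrow> real"
  shows "open S \<Longrightarrow> (\<And>i. i \<in> I \<Longrightarrow> smooth_on S (f i)) \<Longrightarrow> smooth_on S (\<lambda>x. \<Prod>i\<in>I. f i x)"
  by (simp add: smooth_on_def Ck_on_prod)

lemma smooth_on_divide:
  fixes f g :: "'a::euclidean_space \<Rightarrow> real"
  assumes "open S" "\<And>x. x \<in> S \<Longrightarrow> g x \<noteq> 0" "smooth_on S f" "smooth_on S g"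
  shows "smooth_on S (\<lambda>x. f x / g x)"
  using assms by (simp add: smooth_on_def divide_inverse Ck_on_mult Ck_on_inverse)

lemma smooth_on_cong:
  "open S \<Longrightarrow> (\<And>x. x \<in> S \<Longrightarrow> f x = g x) \<Longrightarrow> smooth_on S f \<longleftrightarrow> smooth_on S g"
  unfolding smooth_on_def by (simp add: Ck_on_cong[of S f g])

lemma smooth_on_subset: "smooth_on S f \<Longrightarrow> T \<subseteq> S \<Longrightarrow> smooth_on T f"
  using Ck_on_subset unfolding smooth_on_def by blast

lemma smooth_on_dir_deriv: "smooth_on S f \<Longrightarrow> smooth_on S (dir_deriv v f)"
  unfolding smooth_on_def using Ck_on_Suc_dir_deriv by blast

lemma smooth_on_imp_differentiable: "smooth_on S f \<Longrightarrow> x \<in> S \<Longrightarrow> f differentiable (at x)"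
  unfolding smooth_on_def using Ck_on_Suc_dir_deriv by blast

lemma smooth_on_imp_continuous_on: "smooth_on S f \<Longrightarrow> continuous_on S f"
  unfolding smooth_on_def by (metis Ck_on.simps(1))

lemma smooth_on_vec_lambda:
  fixes f :: "'i::finite \<Rightarrow> 'a::euclidean_space \<Rightarrow> real"
  assumes "open S" "\<And>i. smooth_on S (f i)"
  shows "smooth_on S (\<lambda>x. \<chi> i. f i x)"
proof -
  have "(\<lambda>x. \<chi> i. f i x) = (\<lambda>x. \<Sum>i\<in>UNIV. f i x *\<^sub>R axis i 1)"
    by (auto simp: vec_eq_iff axis_def if_distrib sum.delta fun_eq_iff cong: if_cong)
  moreover have "smooth_on S \<dots>"
    by (intro smooth_on_sum assms(1) smooth_on_bounded_linear_comp[where h = "\<lambda>r. r *\<^sub>R axis _ 1"]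
        bounded_linear_scaleR_left assms(2))
  ultimately show ?thesis by simp
qed

lemma smooth_on_vec_nth:
  assumes "open S" "smooth_on S f"
  shows "smooth_on S (\<lambda>x. f x $ i)"
  by (rule smooth_on_bounded_linear_comp[OF assms(1) bounded_linear_vec_nth assms(2)])

section \<open>Determinants and inverses of smooth matrix functions\<close>

lemma matrix_inv_mult_eq_1:
  fixes M :: "real^'n^'n"
  assumes "det M \<noteq> 0"
  shows "M ** matrix_inv M = mat 1" "matrix_inv M ** M = mat 1"
proof -
  have "\<exists>N. M ** N = mat 1 \<and> N ** M = mat 1"
    using assms unfolding invertible_det_nz[symmetric] invertible_def .
  then have "M ** matrix_inv M = mat 1 \<and> matrix_inv M ** M = mat 1"
    unfolding matrix_inv_def by (rule someI_ex)
  then show "M ** matrix_inv M = mat 1" "matrix_inv M ** M = mat 1" by auto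
qed

lemma smooth_on_det:
  assumes "open S" "\<And>i j. smooth_on S (\<lambda>x. M x $ i $ j)"
  shows "smooth_on S (\<lambda>x. det (M x :: real^'n^'n))"
  unfolding det_def
  by (intro smooth_on_sum smooth_on_mult smooth_on_prod smooth_on_const assms)

text \<open>By Cramer's rule an entry of the inverse is a quotient of two determinants, which are
  polynomials in the entries.\<close>

lemma smooth_on_matrix_inv:
  fixes M :: "'a::euclidean_space \<Rightarrow> real^'n^'n"
  assumes S: "open S" and M: "\<And>i j. smooth_on S (\<lambda>x. M x $ i $ j)"
    and nz: "\<And>x. x \<in> S \<Longrightarrow> det (M x) \<noteq> 0"
  shows "smooth_on S (\<lambda>x. matrix_inv (M x) $ i $ j)"
proof -
  have eq: "matrix_inv (M x) $ i $ j
      = det (\<chi> k l. if l = i then axis j 1 $ k else M x $ k $ l) / det (M x)" if "x \<in> S" for x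
  proof -
    have "M x *v (matrix_inv (M x) *v axis j 1) = axis j 1"
      using matrix_inv_mult_eq_1[OF nz[OF that]] by (simp add: matrix_vector_mul_assoc)
    then have "matrix_inv (M x) *v axis j 1
      = (\<chi> i. det (\<chi> k l. if l = i then axis j 1 $ k else M x $ k $ l) / det (M x))"
      using cramer[OF nz[OF that]] by blast
    moreover have "(matrix_inv (M x) *v axis j 1) $ i = matrix_inv (M x) $ i $ j"
      by (simp add: matrix_vector_mult_basis column_def)
    ultimately show ?thesis by (metis (no_types, lifting) vec_lambda_beta)
  qed
  have "smooth_on S (\<lambda>x. det (\<chi> k l. if l = i then axis j 1 $ k else M x $ k $ l) / det (M x))"
  proof (intro smooth_on_divide smooth_on_det S nz M)
    fix k l
    show "smooth_on S (\<lambda>x. (\<chi> k l. if l = i then axis j 1 $ k else M x $ k $ l) $ k $ l)"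
      using M by (cases "l = i") (auto simp: smooth_on_const)
  qed
  then show ?thesis using smooth_on_cong[OF S, of "\<lambda>x. matrix_inv (M x) $ i $ j", OF eq] by simp
qed

section \<open>Symmetry of second derivatives\<close>

lemma second_difference_mvt:
  fixes E :: "'a::euclidean_space \<Rightarrow> real"
  assumes E: "smooth_on U E" and h: "h > 0"
    and U: "\<And>s t. 0 \<le> s \<Longrightarrow> s \<le> h \<Longrightarrow> 0 \<le> t \<Longrightarrow> t \<le> h \<Longrightarrow> y + s *\<^sub>R v + t *\<^sub>R w \<in> U"
  obtains s t where "0 \<le> s" "s \<le> h" "0 \<le> t" "t \<le> h"
    "E (y + h *\<^sub>R v + h *\<^sub>R w) - E (y + h *\<^sub>R v) - E (y + h *\<^sub>R w) + E y
      = h\<^sup>2 * dir_deriv w (dir_deriv v E) (y + s *\<^sub>R v + t *\<^sub>R w)"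
proof -
  have diff: "f differentiable (at (y + s *\<^sub>R v + t *\<^sub>R w))"
    if "smooth_on U f" "0 \<le> s" "s \<le> h" "0 \<le> t" "t \<le> h" for f :: "'a \<Rightarrow> real" and s t
    using that U smooth_on_imp_differentiable by blast
  have "\<exists>s>0. s < h \<and> (E (y + h *\<^sub>R v + h *\<^sub>R w) - E (y + h *\<^sub>R v)) - (E (y + 0 *\<^sub>R v + h *\<^sub>R w) - E (y + 0 *\<^sub>R v))
      = (h - 0) * (dir_deriv v E (y + s *\<^sub>R v + h *\<^sub>R w) - dir_deriv v E (y + s *\<^sub>R v))"
  proof (rule MVT2[OF h])
    fix s assume s: "0 \<le> s" "s \<le> h"
    have 1: "((\<lambda>s. E (y + h *\<^sub>R w + s *\<^sub>R v)) has_real_derivative dir_deriv v E (y + h *\<^sub>R w + s *\<^sub>R v)) (at s)"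
      unfolding has_real_derivative_iff_has_vector_derivative
      by (rule dir_deriv_line) (use diff[OF E, of s h] s h in \<open>simp add: algebra_simps\<close>)
    have 2: "((\<lambda>s. E (y + s *\<^sub>R v)) has_real_derivative dir_deriv v E (y + s *\<^sub>R v)) (at s)"
      unfolding has_real_derivative_iff_has_vector_derivative
      by (rule dir_deriv_line) (use diff[OF E, of s 0] s h in \<open>simp add: algebra_simps\<close>)
    show "((\<lambda>s. E (y + s *\<^sub>R v + h *\<^sub>R w) - E (y + s *\<^sub>R v)) has_real_derivative
      dir_deriv v E (y + s *\<^sub>R v + h *\<^sub>R w) - dir_deriv v E (y + s *\<^sub>R v)) (at s)"
      using DERIV_diff[OF 1 2] by (simp add: algebra_simps)
  qed
  then obtain s where s: "s > 0" "s < h" and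
    eq: "E (y + h *\<^sub>R v + h *\<^sub>R w) - E (y + h *\<^sub>R v) - E (y + h *\<^sub>R w) + E y
      = h * (dir_deriv v E (y + s *\<^sub>R v + h *\<^sub>R w) - dir_deriv v E (y + s *\<^sub>R v))"
    by auto
  have "\<exists>t>0. t < h \<and> dir_deriv v E (y + s *\<^sub>R v + h *\<^sub>R w) - dir_deriv v E (y + s *\<^sub>R v + 0 *\<^sub>R w)
      = (h - 0) * dir_deriv w (dir_deriv v E) (y + s *\<^sub>R v + t *\<^sub>R w)"
  proof (rule MVT2[OF h])
    fix t assume t: "0 \<le> t" "t \<le> h"
    show "((\<lambda>t. dir_deriv v E (y + s *\<^sub>R v + t *\<^sub>R w)) has_real_derivative
        dir_deriv w (dir_deriv v E) (y + s *\<^sub>R v + t *\<^sub>R w)) (at t)"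
      unfolding has_real_derivative_iff_has_vector_derivative
      by (rule dir_deriv_line, rule diff[OF smooth_on_dir_deriv[OF E]]) (use s t in auto)
  qed
  then obtain t where "t > 0" "t < h" "dir_deriv v E (y + s *\<^sub>R v + h *\<^sub>R w) - dir_deriv v E (y + s *\<^sub>R v)
      = h * dir_deriv w (dir_deriv v E) (y + s *\<^sub>R v + t *\<^sub>R w)"
    by auto
  with s eq that[of s t] show ?thesis by (simp add: power2_eq_square)
qed

text \<open>The mixed second difference over a small parallelogram is symmetric in \<open>v\<close>
  and \<open>w\<close>, and \<open>second_difference_mvt\<close> writes it as
  \<open>h\<^sup>2\<close> times a value of either mixed derivative near \<open>y\<close>. If the
  two derivatives differed at \<open>y\<close>, continuity would keep these values apart.\<close>

lemma dir_deriv_commute: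
  fixes E :: "'a::euclidean_space \<Rightarrow> real"
  assumes U: "open U" and E: "smooth_on U E" and y: "y \<in> U"
  shows "dir_deriv w (dir_deriv v E) y = dir_deriv v (dir_deriv w E) y"
proof (rule ccontr)
  define f where "f = dir_deriv w (dir_deriv v E)"
  define g where "g = dir_deriv v (dir_deriv w E)"
  assume "\<not> ?thesis"
  then have pos: "\<bar>f y - g y\<bar> / 2 > 0" by (simp add: f_def g_def)
  have "continuous_on U f" "continuous_on U g"
    unfolding f_def g_def by (intro smooth_on_imp_continuous_on smooth_on_dir_deriv E)+
  then have "isCont f y" "isCont g y"
    using U y by (simp_all add: continuous_on_eq_continuous_at)
  then obtain d1 d2 where d: "d1 > 0" "d2 > 0"
    "\<And>p. dist p y < d1 \<Longrightarrow> dist (f p) (f y) < \<bar>f y - g y\<bar> / 2"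
    "\<And>p. dist p y < d2 \<Longrightarrow> dist (g p) (g y) < \<bar>f y - g y\<bar> / 2"
    using pos unfolding continuous_at_eps_delta by metis
  obtain r where r: "r > 0" "ball y r \<subseteq> U" using U y openE by blast
  define m where "m = min (min d1 d2) r"
  \<comment> \<open>This size keeps the whole parallelogram with sides \<open>h *\<^sub>R v\<close>
    and \<open>h *\<^sub>R w\<close> within distance \<open>m\<close> of \<open>y\<close>.\<close>
  define h where "h = m / (1 + norm v + norm w)"
  have m: "m > 0" using d r by (simp add: m_def)
  have nz: "1 + norm v + norm w > 0" by (simp add: add_pos_nonneg)
  then have h: "h > 0" using m by (simp add: h_def)
  have small: "dist (y + s *\<^sub>R v + t *\<^sub>R w) y < m" if "0 \<le> s" "s \<le> h" "0 \<le> t" "t \<le> h" for s t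
  proof -
    have "dist (y + s *\<^sub>R v + t *\<^sub>R w) y = norm (s *\<^sub>R v + t *\<^sub>R w)" by (simp add: dist_norm)
    also have "\<dots> \<le> s * norm v + t * norm w"
      using norm_triangle_ineq[of "s *\<^sub>R v" "t *\<^sub>R w"] that by simp
    also have "\<dots> \<le> h * norm v + h * norm w" using that by (intro add_mono mult_right_mono) auto
    also have "\<dots> < h * (1 + norm v + norm w)" using h by (simp add: algebra_simps)
    also have "\<dots> = m" using nz by (simp add: h_def)
    finally show ?thesis .
  qed
  have inU: "y + s *\<^sub>R v + t *\<^sub>R w \<in> U" if "0 \<le> s" "s \<le> h" "0 \<le> t" "t \<le> h" for s t
    using small[OF that] r by (auto simp: m_def dist_commute)
  obtain s t where 1: "0 \<le> s" "s \<le> h" "0 \<le> t" "t \<le> h"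
    "E (y + h *\<^sub>R v + h *\<^sub>R w) - E (y + h *\<^sub>R v) - E (y + h *\<^sub>R w) + E y = h\<^sup>2 * f (y + s *\<^sub>R v + t *\<^sub>R w)"
    using second_difference_mvt[OF E h inU] unfolding f_def by blast
  have inU': "y + s *\<^sub>R w + t *\<^sub>R v \<in> U" if "0 \<le> s" "s \<le> h" "0 \<le> t" "t \<le> h" for s t
    using inU[OF that(3,4,1,2)] by (simp add: algebra_simps)
  obtain s' t' where 2: "0 \<le> s'" "s' \<le> h" "0 \<le> t'" "t' \<le> h"
    "E (y + h *\<^sub>R w + h *\<^sub>R v) - E (y + h *\<^sub>R w) - E (y + h *\<^sub>R v) + E y = h\<^sup>2 * g (y + s' *\<^sub>R w + t' *\<^sub>R v)"
    using second_difference_mvt[OF E h inU'] unfolding g_def by blast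
  have "h\<^sup>2 * f (y + s *\<^sub>R v + t *\<^sub>R w) = h\<^sup>2 * g (y + s' *\<^sub>R w + t' *\<^sub>R v)"
    using 1(5) 2(5) by (simp add: algebra_simps)
  then have "f (y + s *\<^sub>R v + t *\<^sub>R w) = g (y + s' *\<^sub>R w + t' *\<^sub>R v)" using h by simp
  moreover have "dist (f (y + s *\<^sub>R v + t *\<^sub>R w)) (f y) < \<bar>f y - g y\<bar> / 2"
    using small[OF 1(1-4)] d by (simp add: m_def)
  moreover have "dist (g (y + s' *\<^sub>R w + t' *\<^sub>R v)) (g y) < \<bar>f y - g y\<bar> / 2"
    using small[OF 2(3,4,1,2)] d by (simp add: m_def algebra_simps)
  ultimately show False by (simp add: dist_real_def abs_if split: if_splits)
qed

subsection \<open>The equations on a plane\<close>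

text \<open>Solved for \<open>e1\<close>, the slope condition reads
  \<open>e1 x * (1 + f * x\<^sup>2) = 2 * f * x * e0 x\<close>, so the quotient of \<open>e0\<close>
  and \<open>1 + f * x\<^sup>2\<close> has derivative 0. The condition itself says that \<psi> is
  the linear function \<open>f * x\<close>.\<close>

lemma quadratic_of_linear_slope:
  fixes e0 e1 :: "real \<Rightarrow> real"
  assumes e: "\<And>x. (e0 has_real_derivative e1 x) (at x)"
    and f: "f > 0" and slope: "\<And>x. e1 x = f * x * (2 * e0 x - x * e1 x)"
  shows "e0 x = e0 0 * (1 + f * x\<^sup>2)"
proof -
  have pos: "1 + f * x\<^sup>2 > 0" for x using f by (simp add: add_pos_nonneg)
  have "((\<lambda>x. e0 x / (1 + f * x\<^sup>2)) has_real_derivative 0) (at x)" for x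
  proof -
    have "((\<lambda>x. e0 x / (1 + f * x\<^sup>2)) has_real_derivative
        (e1 x * (1 + f * x\<^sup>2) - e0 x * (f * (2 * x))) / (1 + f * x\<^sup>2)\<^sup>2) (at x)"
      using pos[of x] by (auto intro!: derivative_eq_intros e simp: power2_eq_square)
    moreover have "e1 x * (1 + f * x\<^sup>2) - e0 x * (f * (2 * x)) = 0"
      using slope[of x] by (simp add: algebra_simps power2_eq_square)
    ultimately show ?thesis by simp
  qed
  then have "e0 x / (1 + f * x\<^sup>2) = e0 0 / (1 + f * 0\<^sup>2)"
    using DERIV_isconst_all by blast
  with pos[of x] show ?thesis by (simp add: field_simps)
qed

text \<open>The hypothesis on third derivatives says that the Schwarzian derivative of \<open>p0\<close> vanishes
  wherever \<open>s * p0 + t\<close> does not.\<close>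

lemma odd_schwarzian_zero_linear:
  fixes p0 p1 p2 p3 :: "real \<Rightarrow> real"
  assumes p0: "\<And>x. (p0 has_real_derivative p1 x) (at x)"
    and p1: "\<And>x. (p1 has_real_derivative p2 x) (at x)"
    and p2: "\<And>x. (p2 has_real_derivative p3 x) (at x)"
    and pos: "\<And>x. p1 x > 0" and odd: "\<And>x. p0 (- x) = - p0 x"
    and schwarz: "\<And>x. s * p0 x + t \<noteq> 0 \<Longrightarrow> 2 * p3 x * p1 x = 3 * (p2 x)\<^sup>2"
    and st: "s \<noteq> 0 \<or> t \<noteq> 0"
  shows "p0 x = p1 0 * x"
proof -
  \<comment> \<open>Up to the factor 4 this is the square of the derivative of
    \<open>1 / sqrt (p1 x)\<close>, a function that is affine where the Schwarzian vanishes.\<close>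
  define q where "q x = (p2 x)\<^sup>2 / (p1 x)^3" for x
  have strict: "p0 x < p0 y" if "x < y" for x y
    using that pos p0 by (meson DERIV_pos_imp_increasing)
  have "\<exists>a. \<forall>x. x \<noteq> a \<longrightarrow> s * p0 x + t \<noteq> 0"
  proof (cases "\<exists>a. s * p0 a + t = 0")
    case True
    then obtain a where a: "s * p0 a + t = 0" ..
    have "s * p0 x + t \<noteq> 0" if "x \<noteq> a" for x
    proof
      assume "s * p0 x + t = 0"
      with a have "s * (p0 x - p0 a) = 0" by algebra
      moreover have "p0 x \<noteq> p0 a" using strict[of x a] strict[of a x] that by force
      ultimately have "s = 0" by simp
      with a st show False by simp
    qed
    then show ?thesis by blast
  qed blast
  then obtain a where a: "\<And>x. x \<noteq> a \<Longrightarrow> s * p0 x + t \<noteq> 0" by blast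
  have dq: "(q has_real_derivative p2 x * (2 * p3 x * p1 x - 3 * (p2 x)\<^sup>2) / (p1 x)^4) (at x)" for x
    unfolding q_def using pos[of x]
    by (auto intro!: derivative_eq_intros p1 p2 simp: field_simps power2_eq_square power3_eq_cube power4_eq_xxxx)
  have dq0: "(q has_real_derivative 0) (at x)" if "x \<noteq> a" for x
    using dq[of x] schwarz[OF a[OF that]] by simp
  \<comment> \<open>As \<open>p0\<close> is strictly increasing, \<open>s * p0 + t\<close> vanishes
    at one point at most; continuity carries the constancy of \<open>q\<close> across it.\<close>
  have cq: "continuous_on S q" for S
    using dq DERIV_isCont continuous_at_imp_continuous_on by blast
  have qa: "q x = q a" for x
  proof (cases x a rule: linorder_cases)
    case less
    then show ?thesis using DERIV_isconst_end[of x a q] cq dq0 by force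
  next
    case greater
    then show ?thesis using DERIV_isconst_end[of a x q] cq dq0 by force
  qed simp
  have even: "p1 (- x) = p1 x" for x
  proof -
    have "((\<lambda>x. - p0 (- x)) has_real_derivative p1 (- x)) (at x)"
      using DERIV_minus[OF DERIV_mirror[THEN iffD1, OF p0]] by simp
    then show ?thesis using DERIV_unique[OF p0[of x]] odd by simp
  qed
  \<comment> \<open>Oddness of \<open>p0\<close> makes \<open>p1\<close> even, so \<open>p2\<close>
    and hence \<open>q\<close> vanish at 0. This excludes every Moebius map that is not
    affine.\<close>
  have "((\<lambda>x. p1 (- x)) has_real_derivative - p2 0) (at 0)"
    using p1[of 0] DERIV_mirror[of p1 "p2 0" 0] by simp
  then have "p2 0 = 0" using DERIV_unique[OF p1[of 0], of "- p2 0"] even by simp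
  then have "q x = 0" for x using qa[of x] qa[of 0] by (simp add: q_def)
  then have "p2 x = 0" for x using pos[of x] by (metis q_def divide_eq_0_iff less_irrefl power_eq_0_iff)
  then have p1c: "p1 x = p1 0" for x using DERIV_isconst_all[of p1] p1 by metis
  have "((\<lambda>x. p0 x - p1 0 * x) has_real_derivative 0) (at x)" for x
    by (auto intro!: derivative_eq_intros p0 simp: p1c[of x])
  then have "p0 x - p1 0 * x = p0 0 - p1 0 * 0" using DERIV_isconst_all by blast
  moreover have "p0 0 = 0" using odd[of 0] by simp
  ultimately show ?thesis by simp
qed

text \<open>Here \<open>e0 x\<close> stands for the value of E at \<open>v + x *\<^sub>R u\<close>,
  and \<open>z0\<close>, \<open>y0\<close> for the components of Z along \<open>u\<close> and
  \<open>v\<close>; the higher indices are their derivatives. By Euler's identity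
  \<open>2 * e0 x - x * e1 x\<close> is the derivative of E along \<open>v\<close>, so
  \<open>p0\<close> below is \<psi>. \<open>eq1\<close> is E' Z = 0, \<open>eq2\<close> is the
  equation for Z with \<xi> = u, where \<open>s\<close> and \<open>t\<close> are the components of
  the torsion, and \<open>eq3\<close> is the Landsberg condition along \<open>u\<close>.\<close>

lemma plane_equations:
  fixes e0 e1 e2 e3 e4 z0 z1 z2 z3 y0 y1 y2 y3 :: "real \<Rightarrow> real"
  assumes e: "\<And>x. (e0 has_real_derivative e1 x) (at x)" "\<And>x. (e1 has_real_derivative e2 x) (at x)"
      "\<And>x. (e2 has_real_derivative e3 x) (at x)" "\<And>x. (e3 has_real_derivative e4 x) (at x)"
    and z: "\<And>x. (z0 has_real_derivative z1 x) (at x)" "\<And>x. (z1 has_real_derivative z2 x) (at x)"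
      "\<And>x. (z2 has_real_derivative z3 x) (at x)"
    and y: "\<And>x. (y0 has_real_derivative y1 x) (at x)" "\<And>x. (y1 has_real_derivative y2 x) (at x)"
      "\<And>x. (y2 has_real_derivative y3 x) (at x)"
    and even: "\<And>x. e0 (- x) = e0 x"
    and dpos: "\<And>x. 2 * e0 x - x * e1 x > 0"
    and npos: "\<And>x. 2 * e0 x * e2 x - (e1 x)\<^sup>2 > 0"
    and eq1: "\<And>x. e1 x * z0 x + (2 * e0 x - x * e1 x) * y0 x = 0"
    and eq2: "\<And>x. z0 x * e2 x + y0 x * (e1 x - x * e2 x) = - (s * e1 x + t * (2 * e0 x - x * e1 x))"
    and eq3: "\<And>x. e1 x * z3 x + (2 * e0 x - x * e1 x) * y3 x = 0"
    and st: "s \<noteq> 0 \<or> t \<noteq> 0"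
  shows "\<exists>f>0. \<forall>x. e0 x = e0 0 * (1 + f * x\<^sup>2)"
proof -
  define d where "d x = 2 * e0 x - x * e1 x" for x
  define d1 where "d1 x = e1 x - x * e2 x" for x
  define n where "n x = 2 * e0 x * e2 x - (e1 x)\<^sup>2" for x
  define n1 where "n1 x = 2 * e0 x * e3 x" for x
  define p0 where "p0 x = e1 x / d x" for x
  define p1 where "p1 x = n x / (d x)\<^sup>2" for x
  define p2 where "p2 x = (n1 x * d x - 2 * n x * d1 x) / (d x)^3" for x
  define p3 where "p3 x = deriv p2 x" for x
  have d: "d x > 0" "d x \<noteq> 0" for x using dpos[of x] by (simp_all add: d_def)
  have dd: "(d has_real_derivative d1 x) (at x)" for x
    unfolding d_def d1_def by (auto intro!: derivative_eq_intros e)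
  have dn: "(n has_real_derivative n1 x) (at x)" for x
    unfolding n_def n1_def by (auto intro!: derivative_eq_intros e simp: power2_eq_square)
  have p0: "(p0 has_real_derivative p1 x) (at x)" for x
  proof -
    have "(p0 has_real_derivative (e2 x * d x - e1 x * d1 x) / (d x * d x)) (at x)"
      unfolding p0_def using d by (auto intro!: derivative_eq_intros e dd)
    moreover have "e2 x * d x - e1 x * d1 x = n x"
      by (simp add: d_def d1_def n_def algebra_simps power2_eq_square)
    ultimately show ?thesis by (simp add: p1_def power2_eq_square)
  qed
  have p1: "(p1 has_real_derivative p2 x) (at x)" for x
    unfolding p1_def p2_def using d[of x]
    by (auto intro!: derivative_eq_intros dn dd simp: field_simps power2_eq_square power3_eq_cube)
  have dd1: "(d1 has_real_derivative - (x * e3 x)) (at x)" for x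
    unfolding d1_def by (auto intro!: derivative_eq_intros e)
  have dn1: "(n1 has_real_derivative 2 * e1 x * e3 x + 2 * e0 x * e4 x) (at x)" for x
    unfolding n1_def by (auto intro!: derivative_eq_intros e)
  have "(p2 has_real_derivative
      (((2 * e1 x * e3 x + 2 * e0 x * e4 x) * d x + n1 x * d1 x - (2 * n1 x * d1 x + 2 * n x * - (x * e3 x)))
        * (d x)^3 - (n1 x * d x - 2 * n x * d1 x) * (3 * (d x)\<^sup>2 * d1 x)) / ((d x)^3 * (d x)^3)) (at x)" for x
    unfolding p2_def using d[of x] by (auto intro!: derivative_eq_intros dn dd dn1 dd1)
  then have p2: "(p2 has_real_derivative p3 x) (at x)" for x
    unfolding p3_def using DERIV_imp_deriv by metis
  have pos: "p1 x > 0" for x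
    using npos[of x] d[of x] by (simp add: p1_def n_def)
  have odd: "p0 (- x) = - p0 x" for x
  proof -
    have "((\<lambda>x. e0 (- x)) has_real_derivative - e1 (- x)) (at x)"
      using DERIV_mirror[of e0 "e1 (- x)" x] e(1)[of "- x"] by simp
    then have "e1 (- x) = - e1 x" using DERIV_unique[OF e(1)[of x]] even by simp
    then show ?thesis using even by (simp add: p0_def d_def)
  qed
  have y0: "y0 x = - (p0 x * z0 x)" for x
    using eq1[of x] d[of x] unfolding d_def[symmetric] by (simp add: p0_def field_simps eq_neg_iff_add_eq_0)
  have y1: "y1 x = - (p1 x * z0 x + p0 x * z1 x)" for x
  proof (rule DERIV_unique[OF y(1)])
    show "(y0 has_real_derivative - (p1 x * z0 x + p0 x * z1 x)) (at x)"
      unfolding y0[abs_def] by (auto intro!: derivative_eq_intros p0 z)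
  qed
  have y2: "y2 x = - (p2 x * z0 x + 2 * p1 x * z1 x + p0 x * z2 x)" for x
  proof (rule DERIV_unique[OF y(2)])
    show "(y1 has_real_derivative - (p2 x * z0 x + 2 * p1 x * z1 x + p0 x * z2 x)) (at x)"
      unfolding y1[abs_def] by (auto intro!: derivative_eq_intros p0 p1 z simp: algebra_simps)
  qed
  have y3: "y3 x = - (p3 x * z0 x + 3 * p2 x * z1 x + 3 * p1 x * z2 x + p0 x * z3 x)" for x
  proof (rule DERIV_unique[OF y(3)])
    show "(y2 has_real_derivative - (p3 x * z0 x + 3 * p2 x * z1 x + 3 * p1 x * z2 x + p0 x * z3 x)) (at x)"
      unfolding y2[abs_def] by (auto intro!: derivative_eq_intros p0 p1 p2 z simp: algebra_simps)
  qed
  \<comment> \<open>Inserting \<open>y0\<close> into \<open>eq2\<close> leaves one equation for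
    \<open>z0\<close>, whose coefficient is a positive multiple of the derivative of \<psi>.\<close>
  have A0: "p1 x * z0 x = - (s * p0 x + t)" for x
  proof -
    have "z0 x * (e2 x * d x - e1 x * d1 x) = - (s * e1 x + t * d x) * d x"
    proof -
      have "z0 x * (e2 x * d x - e1 x * d1 x) = (z0 x * e2 x + y0 x * d1 x) * d x"
        using d[of x] by (simp add: y0 p0_def field_simps)
      then show ?thesis using eq2[of x] by (simp add: d_def d1_def)
    qed
    moreover have "e2 x * d x - e1 x * d1 x = n x"
      by (simp add: d_def d1_def n_def algebra_simps power2_eq_square)
    ultimately have eq: "n x * z0 x = - (s * e1 x + t * d x) * d x" by (simp add: mult.commute)
    have "p1 x * z0 x = n x * z0 x / (d x)\<^sup>2" by (simp add: p1_def)
    also have "\<dots> = - (s * p0 x + t)"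
      unfolding eq using d[of x] by (simp add: p0_def field_simps power2_eq_square)
    finally show ?thesis .
  qed
  have A1: "p2 x * z0 x + p1 x * z1 x = - s * p1 x" for x
  proof (rule DERIV_unique)
    show "((\<lambda>x. p1 x * z0 x) has_real_derivative p2 x * z0 x + p1 x * z1 x) (at x)"
      by (auto intro!: derivative_eq_intros p1 z)
    show "((\<lambda>x. p1 x * z0 x) has_real_derivative - s * p1 x) (at x)"
      unfolding A0 by (auto intro!: derivative_eq_intros p0)
  qed
  have A2: "p3 x * z0 x + 2 * p2 x * z1 x + p1 x * z2 x = - s * p2 x" for x
  proof (rule DERIV_unique)
    show "((\<lambda>x. p2 x * z0 x + p1 x * z1 x) has_real_derivative
        p3 x * z0 x + 2 * p2 x * z1 x + p1 x * z2 x) (at x)"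
      by (auto intro!: derivative_eq_intros p1 p2 z simp: algebra_simps)
    show "((\<lambda>x. p2 x * z0 x + p1 x * z1 x) has_real_derivative - s * p2 x) (at x)"
      unfolding A1 by (auto intro!: derivative_eq_intros p1)
  qed
  \<comment> \<open>After division by \<open>d x\<close> the terms \<open>p0 x * z3 x\<close> in
    \<open>eq3\<close> cancel.\<close>
  have A3: "p3 x * z0 x + 3 * p2 x * z1 x + 3 * p1 x * z2 x = 0" for x
  proof -
    have "d x * (p0 x * z3 x + y3 x) = e1 x * z3 x + d x * y3 x"
      using d[of x] by (simp add: p0_def distrib_left)
    then have "d x * (p0 x * z3 x + y3 x) = 0" using eq3[of x] by (simp add: d_def)
    then show ?thesis using d[of x] y3[of x] by simp
  qed
  have schwarz: "2 * p3 x * p1 x = 3 * (p2 x)\<^sup>2" if "s * p0 x + t \<noteq> 0" for x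
  proof -
    \<comment> \<open>Three times \<open>A2\<close> minus \<open>A3\<close> eliminates
      \<open>z2\<close>; after multiplication by \<open>p1 x\<close>, inserting \<open>A1\<close>
      for \<open>- s * p1 x\<close> eliminates \<open>z1\<close> as well.\<close>
    have "z0 x * (2 * p3 x * p1 x - 3 * (p2 x)\<^sup>2) = 0"
      using A1[of x] A2[of x] A3[of x] by algebra
    moreover have "z0 x \<noteq> 0" using A0[of x] that by auto
    ultimately show ?thesis by simp
  qed
  have lin: "p0 x = p1 0 * x" for x
    by (rule odd_schwarzian_zero_linear[OF p0 p1 p2 pos odd schwarz st])
  have "e1 x = p1 0 * x * d x" for x
    using lin[of x] d[of x] by (simp add: p0_def divide_eq_eq)
  then have "e1 x = p1 0 * x * (2 * e0 x - x * e1 x)" for x by (simp add: d_def)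
  then show ?thesis using quadratic_of_linear_slope[OF e(1) pos[of 0]] pos[of 0] by blast
qed

text \<open>This extends identities from vectors with two nonzero components to all nonzero vectors:
  a suitable ray leaves any given vector through such generic ones.\<close>

lemma line_ext_eq:
  fixes f g :: "real \<Rightarrow> real"
  assumes "isCont f 0" "isCont g 0" "\<And>t. t > 0 \<Longrightarrow> f t = g t"
  shows "f 0 = g 0"
proof -
  have "(f \<longlongrightarrow> f 0) (at_right 0)" "(g \<longlongrightarrow> g 0) (at_right 0)"
    using assms(1,2) by (auto simp: isCont_def intro: tendsto_mono at_le)
  moreover have "\<forall>\<^sub>F t in at_right 0. f t = g t"
    using assms(3) eventually_at_right_less[of 0] by (rule eventually_mono[rotated])
  ultimately have "(g \<longlongrightarrow> f 0) (at_right 0)" using tendsto_cong[of f g] by blast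
  then show ?thesis using \<open>(g \<longlongrightarrow> g 0) (at_right 0)\<close> by (meson tendsto_unique trivial_limit_at_right_real)
qed

text \<open>Euler's identity, from comparing \<open>f (y + t *\<^sub>R y)\<close> with
  \<open>(1 + t) ^ k * f y\<close> near \<open>t = 0\<close>. It is applied to E with
  \<open>k = 2\<close> and to its first derivatives with \<open>k = 1\<close>.\<close>

lemma dir_deriv_homogeneous:
  fixes f :: "'a::euclidean_space \<Rightarrow> real"
  assumes "f differentiable (at y)" "\<And>r. r > 0 \<Longrightarrow> f (r *\<^sub>R y) = r ^ k * f y"
  shows "dir_deriv y f y = k * f y"
proof (rule DERIV_unique)
  show "((\<lambda>t. f (y + t *\<^sub>R y)) has_real_derivative dir_deriv y f y) (at 0)"
    using dir_deriv_line[of f y 0 y] assms(1) by (simp add: has_real_derivative_iff_has_vector_derivative)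
  have "((\<lambda>t. (1 + t) ^ k * f y) has_real_derivative real k * f y) (at 0)"
    by (auto intro!: derivative_eq_intros)
  then show "((\<lambda>t. f (y + t *\<^sub>R y)) has_real_derivative real k * f y) (at 0)"
  proof (rule has_field_derivative_transform_within_open)
    show "open {-1::real<..}" "0 \<in> {-1::real<..}" by auto
    show "(1 + t) ^ k * f y = f (y + t *\<^sub>R y)" if "t \<in> {-1::real<..}" for t
      using assms(2)[of "1 + t"] that by (simp add: scaleR_add_left)
  qed
qed

text \<open>The linear map \<open>\<lambda>\<zeta>. H \<zeta> \<xi>\<close> commutes with
  differentiation, and third derivatives of a quadratic form vanish. For definite \<open>H\<close>,
  choosing \<xi> to be the third derivative itself will show that it is 0.\<close>

lemma third_dir_deriv_quadratic:
  fixes Z :: "'a::euclidean_space \<Rightarrow> 'a"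
  assumes Z: "smooth_on (- {0}) Z" and H: "bilinear H" and R: "bilinear R"
    and eq: "\<And>y. y \<noteq> 0 \<Longrightarrow> H (Z y) \<xi> = R y y" and y: "y \<noteq> 0"
  shows "H (dir_deriv r (dir_deriv q (dir_deriv p Z)) y) \<xi> = (0::real)"
proof -
  have op: "open (- {0::'a})" by auto
  have bl: "bounded_linear (\<lambda>\<zeta>. H \<zeta> \<xi>)"
    using H by (simp add: bilinear_def linear_conv_bounded_linear)
  have step: "H (dir_deriv v W y) \<xi> = dir_deriv v (\<lambda>y. H (W y) \<xi>) y" if "smooth_on (- {0}) W" "y \<noteq> 0" for W v y
    using dir_deriv_bounded_linear[OF bl, of W y v] smooth_on_imp_differentiable[OF that(1)] that(2) by simp
  have bR: "bounded_bilinear R" using R bilinear_conv_bounded_bilinear by blast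
  have d1: "dir_deriv p (\<lambda>y. R y y) y = R p y + R y p" for p y
  proof (rule dir_deriv_eq)
    show "((\<lambda>y. R y y) has_derivative (\<lambda>p. R p y + R y p)) (at y)"
      using bounded_bilinear.FDERIV[OF bR has_derivative_ident has_derivative_ident, of y UNIV]
      by (simp add: add.commute)
  qed
  have d2: "dir_deriv q (\<lambda>y. R p y + R y p) y = R p q + R q p" for p q y
  proof (rule dir_deriv_eq)
    have "bounded_linear (\<lambda>y. R p y + R y p)"
      using R by (simp add: bilinear_def linear_conv_bounded_linear bounded_linear_add)
    then show "((\<lambda>y. R p y + R y p) has_derivative (\<lambda>q. R p q + R q p)) (at y)"
      by (rule bounded_linear_imp_has_derivative)
  qed
  have 1: "H (dir_deriv p Z y) \<xi> = R p y + R y p" if "y \<noteq> 0" for y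
    using step[OF Z that] dir_deriv_cong[OF op, of y "\<lambda>y. H (Z y) \<xi>" "\<lambda>y. R y y" p] eq that d1 by simp
  have 2: "H (dir_deriv q (dir_deriv p Z) y) \<xi> = R p q + R q p" if "y \<noteq> 0" for y
    using step[OF smooth_on_dir_deriv[OF Z] that, of q p]
      dir_deriv_cong[OF op, of y "\<lambda>y. H (dir_deriv p Z y) \<xi>" "\<lambda>y. R p y + R y p" q] 1 that d2 by simp
  have "dir_deriv r (\<lambda>y. H (dir_deriv q (dir_deriv p Z) y) \<xi>) y = dir_deriv r (\<lambda>_. R p q + R q p) y"
    by (rule dir_deriv_cong[OF op]) (use 2 y in auto)
  also have "\<dots> = 0" by (simp add: dir_deriv_def)
  finally show ?thesis
    using step[OF smooth_on_dir_deriv[OF smooth_on_dir_deriv[OF Z]] y] by simp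
qed

subsection \<open>The equations on a tangent space\<close>

text \<open>\<open>E\<close> is the square of the norm, \<open>A\<close> and \<open>B\<close> are the squares of \<open>\<alpha>\<^sub>1\<close> and \<open>\<alpha>\<^sub>2\<close>, and \<open>P\<close> is
  the projection to \<open>\<V>\<^sub>1\<close> along \<open>\<V>\<^sub>2\<close>.\<close>

locale alpha12_norm =
  fixes E :: "'a::euclidean_space \<Rightarrow> real"
    and A B :: "'a \<Rightarrow> 'a \<Rightarrow> real" and P :: "'a \<Rightarrow> 'a"
  assumes E_smooth: "smooth_on (- {0}) E"
    and E_pos: "\<And>y. y \<noteq> 0 \<Longrightarrow> E y > 0"
    and E_hom: "\<And>r y. r > 0 \<Longrightarrow> E (r *\<^sub>R y) = r\<^sup>2 * E y"
    and E_convex: "\<And>y w. y \<noteq> 0 \<Longrightarrow> w \<noteq> 0 \<Longrightarrow> dir_deriv w (dir_deriv w E) y > 0"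
    and E_dep: "\<And>y z. A y y = A z z \<Longrightarrow> B y y = B z z \<Longrightarrow> E y = E z"
    and bil_A: "bilinear A" and bil_B: "bilinear B"
    and sym_A: "\<And>y z. A y z = A z y" and sym_B: "\<And>y z. B y z = B z y"
    and lin_P: "linear P" and P_idem: "\<And>y. P (P y) = P y"
    and A_P: "\<And>y z. A (P y) z = A y z" and B_P: "\<And>y z. B (P y) z = 0"
    and A_pos: "\<And>y. P y \<noteq> 0 \<Longrightarrow> A y y > 0" and B_pos: "\<And>y. P y \<noteq> y \<Longrightarrow> B y y > 0"
    and P_nontriv: "\<exists>y. P y \<noteq> 0" "\<exists>y. P y \<noteq> y"
begin

lemmas A_simps = bilinear_ladd[OF bil_A] bilinear_radd[OF bil_A] bilinear_lmul[OF bil_A]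
  bilinear_rmul[OF bil_A] bilinear_lsub[OF bil_A] bilinear_rsub[OF bil_A] bilinear_lneg[OF bil_A]
  bilinear_rneg[OF bil_A] bilinear_lzero[OF bil_A] bilinear_rzero[OF bil_A]
lemmas B_simps = bilinear_ladd[OF bil_B] bilinear_radd[OF bil_B] bilinear_lmul[OF bil_B]
  bilinear_rmul[OF bil_B] bilinear_lsub[OF bil_B] bilinear_rsub[OF bil_B] bilinear_lneg[OF bil_B]
  bilinear_rneg[OF bil_B] bilinear_lzero[OF bil_B] bilinear_rzero[OF bil_B]
lemmas P_simps = linear_add[OF lin_P] linear_diff[OF lin_P] linear_cmul[OF lin_P] linear_0[OF lin_P]

lemma A_P': "A z (P y) = A z y" and B_P': "B z (P y) = 0"
  using A_P B_P sym_A sym_B by metis+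

lemma A_kernel: assumes "P v = 0" shows "A v z = 0" "A z v = 0"
  using A_P[of v] A_P'[of _ v] assms by (simp_all add: A_simps)

lemma B_range: assumes "P u = u" shows "B u z = 0" "B z u = 0"
  using B_P[of u] B_P'[of _ u] assms by simp_all

lemma A_pos_range: "P u = u \<Longrightarrow> u \<noteq> 0 \<Longrightarrow> A u u > 0"
  using A_pos by metis

lemma B_pos_kernel: "P v = 0 \<Longrightarrow> v \<noteq> 0 \<Longrightarrow> B v v > 0"
  using B_pos by metis

lemma A_nonneg: "A y y \<ge> 0"
proof (cases "P y = 0")
  case True
  then show ?thesis by (simp add: A_kernel)
next
  case False
  then show ?thesis using A_pos less_imp_le by blast
qed

text \<open>The setting is symmetric in the two subbundles. Results about the range of
  \<open>P\<close> are transferred to its kernel through this lemma.\<close>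

lemma swap_norm: "alpha12_norm E B A (\<lambda>y. y - P y)"
proof (rule alpha12_norm.intro)
  show "\<And>y z. B y y = B z z \<Longrightarrow> A y y = A z z \<Longrightarrow> E y = E z" by (rule E_dep)
  show "linear (\<lambda>y. y - P y)" by (rule linear_compose_sub[OF linear_ident lin_P])
  show "y - P y - P (y - P y) = y - P y" for y by (simp add: P_simps P_idem)
  show "B (y - P y) z = B y z" for y z by (simp add: B_simps B_P)
  show "A (y - P y) z = 0" for y z by (simp add: A_simps A_P)
  show "B y y > 0" if "y - P y \<noteq> 0" for y using B_pos[of y] that by auto
  show "A y y > 0" if "y - P y \<noteq> y" for y using A_pos[of y] that by auto
  show "\<exists>y. y - P y \<noteq> 0" using P_nontriv(2) by (metis eq_iff_diff_eq_0)
  show "\<exists>y. y - P y \<noteq> y" using P_nontriv(1) by auto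
qed (fact E_smooth E_pos E_hom E_convex bil_A bil_B sym_A sym_B)+

lemma open_dom: "open (- {0::'a})" by auto

lemma E_diff: "y \<noteq> 0 \<Longrightarrow> E differentiable (at y)"
  using smooth_on_imp_differentiable[OF E_smooth] by simp

lemma dE_smooth: "smooth_on (- {0}) (dir_deriv \<xi> E)"
  by (rule smooth_on_dir_deriv[OF E_smooth])

lemma dE_diff: "y \<noteq> 0 \<Longrightarrow> dir_deriv \<xi> E differentiable (at y)"
  using smooth_on_imp_differentiable[OF dE_smooth] by simp

lemmas dE_lin = linear_add[OF linear_dir_deriv[OF E_diff]] linear_diff[OF linear_dir_deriv[OF E_diff]]
  linear_cmul[OF linear_dir_deriv[OF E_diff]] linear_0[OF linear_dir_deriv[OF E_diff]]

lemmas ddE_lin = linear_add[OF linear_dir_deriv[OF dE_diff]] linear_diff[OF linear_dir_deriv[OF dE_diff]]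
  linear_cmul[OF linear_dir_deriv[OF dE_diff]] linear_0[OF linear_dir_deriv[OF dE_diff]]

lemma ddE_commute: "y \<noteq> 0 \<Longrightarrow> dir_deriv w (dir_deriv v E) y = dir_deriv v (dir_deriv w E) y"
  using dir_deriv_commute[OF open_dom E_smooth] by simp

lemma E_line:
  assumes "y + t *\<^sub>R v \<noteq> 0"
  shows "((\<lambda>t. E (y + t *\<^sub>R v)) has_real_derivative dir_deriv v E (y + t *\<^sub>R v)) (at t)"
  using dir_deriv_line[OF E_diff[OF assms]] by (simp add: has_real_derivative_iff_has_vector_derivative)

lemma dE_line:
  assumes "y + t *\<^sub>R v \<noteq> 0"
  shows "((\<lambda>t. dir_deriv \<xi> E (y + t *\<^sub>R v)) has_real_derivative dir_deriv v (dir_deriv \<xi> E) (y + t *\<^sub>R v)) (at t)"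
  using dir_deriv_line[OF dE_diff[OF assms]] by (simp add: has_real_derivative_iff_has_vector_derivative)

lemma euler: "y \<noteq> 0 \<Longrightarrow> dir_deriv y E y = 2 * E y"
  using dir_deriv_homogeneous[OF E_diff, of y 2] E_hom by simp

lemma dE_hom:
  assumes "y \<noteq> 0" "r > 0"
  shows "dir_deriv \<xi> E (r *\<^sub>R y) = r * dir_deriv \<xi> E y"
proof -
  have "((\<lambda>t. E (r *\<^sub>R y + t *\<^sub>R (r *\<^sub>R \<xi>))) has_real_derivative r * dir_deriv \<xi> E (r *\<^sub>R y)) (at 0)"
    using E_line[of "r *\<^sub>R y" 0 "r *\<^sub>R \<xi>"] assms dE_lin(3)[of "r *\<^sub>R y" r \<xi>] by simp
  moreover have "E (r *\<^sub>R y + t *\<^sub>R (r *\<^sub>R \<xi>)) = r\<^sup>2 * E (y + t *\<^sub>R \<xi>)" for t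
    using E_hom[OF assms(2), of "y + t *\<^sub>R \<xi>"] by (simp add: algebra_simps)
  moreover have "((\<lambda>t. r\<^sup>2 * E (y + t *\<^sub>R \<xi>)) has_real_derivative r\<^sup>2 * dir_deriv \<xi> E y) (at 0)"
    using DERIV_cmult[OF E_line[of y 0 \<xi>]] assms by simp
  ultimately have "r * dir_deriv \<xi> E (r *\<^sub>R y) = r\<^sup>2 * dir_deriv \<xi> E y"
    using DERIV_unique by (metis (no_types, lifting) ext)
  then show ?thesis using assms(2) by (simp add: power2_eq_square)
qed

lemma euler_dE: "y \<noteq> 0 \<Longrightarrow> dir_deriv y (dir_deriv \<xi> E) y = dir_deriv \<xi> E y"
  using dir_deriv_homogeneous[OF dE_diff, of y \<xi> 1] dE_hom by simp

lemma perp_nonzero: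
  assumes "y \<noteq> 0" "A y w = 0" "B y w = 0"
  shows "y + t *\<^sub>R w \<noteq> 0"
proof
  assume "y + t *\<^sub>R w = 0"
  then have "y = (- t) *\<^sub>R w" by (simp add: eq_neg_iff_add_eq_0)
  then have "A y y = - t * A y w" "B y y = - t * B y w"
    by (metis A_simps(4) real_scaleR_def) (metis B_simps(4) real_scaleR_def \<open>y = (- t) *\<^sub>R w\<close>)
  then show False using assms A_pos[of y] B_pos[of y] by force
qed

lemma reflect:
  assumes "A y w = 0" "B y w = 0"
  shows "A (y + t *\<^sub>R w) (y + t *\<^sub>R w) = A y y + t\<^sup>2 * A w w"
    "B (y + t *\<^sub>R w) (y + t *\<^sub>R w) = B y y + t\<^sup>2 * B w w"
  using assms sym_A[of w y] sym_B[of w y] by (simp_all add: A_simps B_simps power2_eq_square)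

text \<open>The reflection that reverses \<open>w\<close> preserves both partial lengths, so E is
  even in \<open>t\<close> along \<open>y + t *\<^sub>R w\<close>.\<close>

lemma dE_perp:
  assumes "y \<noteq> 0" "A y w = 0" "B y w = 0"
  shows "dir_deriv w E y = 0"
  by (rule dir_deriv_even_eq_0[OF E_diff[OF assms(1)]], rule E_dep)
    (use reflect[OF assms(2,3)] in \<open>simp_all only: power2_minus\<close>)

text \<open>The same reflection also fixes \<open>u\<close>, so the derivative of E along
  \<open>u\<close> is even along \<open>y + t *\<^sub>R w\<close>.\<close>

lemma ddE_perp:
  assumes y: "y \<noteq> 0" and w: "A y w = 0" "B y w = 0" "A u w = 0" "B u w = 0"
  shows "dir_deriv w (dir_deriv u E) y = 0"
proof (rule dir_deriv_even_eq_0[OF dE_diff[OF y]])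
  fix t :: real
  have w': "A w y = 0" "A w u = 0" "B w y = 0" "B w u = 0"
    using w sym_A[of w y] sym_A[of w u] sym_B[of w y] sym_B[of w u] by simp_all
  have eq: "E (y + t *\<^sub>R w + s *\<^sub>R u) = E (y + (- t) *\<^sub>R w + s *\<^sub>R u)" for s
    by (rule E_dep) (simp_all add: A_simps B_simps w w')
  have "((\<lambda>s. E (y + t *\<^sub>R w + s *\<^sub>R u)) has_real_derivative dir_deriv u E (y + t *\<^sub>R w)) (at 0)"
    using E_line[of "y + t *\<^sub>R w" 0 u] perp_nonzero[OF y w(1,2)] by simp
  moreover have "((\<lambda>s. E (y + t *\<^sub>R w + s *\<^sub>R u)) has_real_derivative dir_deriv u E (y + (- t) *\<^sub>R w)) (at 0)"
    unfolding eq using E_line[of "y + (- t) *\<^sub>R w" 0 u] perp_nonzero[OF y w(1,2), of "- t"] by simp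
  ultimately show "dir_deriv u E (y + t *\<^sub>R w) = dir_deriv u E (y + (- t) *\<^sub>R w)"
    by (rule DERIV_unique)
qed

text \<open>In directions of the range of \<open>P\<close> the differential only sees the component
  along \<open>P y\<close>, because the rest is orthogonal to \<open>y\<close> for both forms.
  Without division the identity also covers \<open>P y = 0\<close>, where both sides are 0.\<close>

lemma dE_range:
  assumes "y \<noteq> 0" "P \<xi> = \<xi>"
  shows "dir_deriv \<xi> E y * A y y = dir_deriv (P y) E y * A y \<xi>"
proof -
  have "dir_deriv (A y y *\<^sub>R \<xi> - A y \<xi> *\<^sub>R P y) E y = 0"
    by (rule dE_perp[OF assms(1)]) (simp_all add: A_simps B_simps A_P' B_P' B_range[OF assms(2)])
  then show ?thesis by (simp add: dE_lin assms(1) mult.commute)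
qed

text \<open>Along \<open>u + t *\<^sub>R v\<close> the function E is strictly convex and has its
  critical point at \<open>t = 0\<close> by reflection, so its derivative at \<open>t = 1\<close> is
  positive. For \<open>u = 0\<close> Euler's identity replaces this argument.\<close>

lemma dE_kernel_pos:
  assumes "P u = u" "P v = 0" "v \<noteq> 0"
  shows "dir_deriv v E (u + v) > 0"
proof (cases "u = 0")
  case True
  then show ?thesis using euler[OF assms(3)] E_pos[OF assms(3)] by simp
next
  case False
  have nz: "u + t *\<^sub>R v \<noteq> 0" for t
    using perp_nonzero[OF False, of v t] A_kernel[OF assms(2)] B_range[OF assms(1)] by simp
  have "\<exists>t>0. t < 1 \<and> dir_deriv v E (u + 1 *\<^sub>R v) - dir_deriv v E (u + 0 *\<^sub>R v)
      = (1 - 0) * dir_deriv v (dir_deriv v E) (u + t *\<^sub>R v)"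
    by (rule MVT2) (use dE_line[OF nz] in auto)
  moreover have "dir_deriv v E u = 0"
    using dE_perp[OF False] A_kernel[OF assms(2)] B_range[OF assms(1)] by simp
  ultimately show ?thesis using E_convex[OF nz assms(3)] by force
qed

section \<open>The Euclidean case\<close>

definition quad :: bool
  where "quad \<longleftrightarrow> (\<exists>c d. \<forall>y. y \<noteq> 0 \<longrightarrow> E y = c * A y y + d * B y y)"

text \<open>One line determines E: every vector with a nonzero component in the kernel of
  \<open>P\<close> has the partial lengths of some \<open>r *\<^sub>R (v + x *\<^sub>R u)\<close>,
  and the vectors in the range of \<open>P\<close> are limits of such vectors.\<close>

lemma quadI:
  assumes u: "P u = u" "u \<noteq> 0" and v: "P v = 0" "v \<noteq> 0" and f: "f > 0"
    and e: "\<And>x. E (v + x *\<^sub>R u) = c * (1 + f * x\<^sup>2)"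
  shows quad
  unfolding quad_def
proof (intro exI allI impI)
  let ?q = "\<lambda>y. c * f / A u u * A y y + c / B v v * B y y"
  have pos: "A u u > 0" "B v v > 0" using A_pos_range u B_pos_kernel v by auto
  have gen: "E y = ?q y" if "P y \<noteq> y" for y
  proof -
    define r where "r = sqrt (B y y / B v v)"
    have r: "r > 0" "r\<^sup>2 = B y y / B v v"
      using B_pos[OF that] pos by (simp_all add: r_def)
    define x where "x = sqrt (A y y / (r\<^sup>2 * A u u))"
    have x: "x\<^sup>2 = A y y / (r\<^sup>2 * A u u)" using A_nonneg[of y] pos by (simp add: x_def)
    have rx: "r\<^sup>2 * x\<^sup>2 = A y y / A u u"
    proof -
      have "r\<^sup>2 > 0" using r(1) by simp
      then show ?thesis unfolding x by (simp add: field_simps)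
    qed
    have "E y = E (r *\<^sub>R (v + x *\<^sub>R u))"
    proof (rule E_dep)
      have "A (r *\<^sub>R (v + x *\<^sub>R u)) (r *\<^sub>R (v + x *\<^sub>R u)) = r\<^sup>2 * x\<^sup>2 * A u u"
        by (simp add: A_simps A_kernel[OF v(1)] power2_eq_square)
      then show "A y y = A (r *\<^sub>R (v + x *\<^sub>R u)) (r *\<^sub>R (v + x *\<^sub>R u))"
        using pos rx by simp
      have "B (r *\<^sub>R (v + x *\<^sub>R u)) (r *\<^sub>R (v + x *\<^sub>R u)) = r\<^sup>2 * B v v"
        by (simp add: B_simps B_range[OF u(1)] power2_eq_square)
      then show "B y y = B (r *\<^sub>R (v + x *\<^sub>R u)) (r *\<^sub>R (v + x *\<^sub>R u))"
        using pos r by simp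
    qed
    also have "\<dots> = r\<^sup>2 * c + c * f * (r\<^sup>2 * x\<^sup>2)" unfolding E_hom[OF r(1)] e by (simp add: algebra_simps)
    also note rx
    finally show ?thesis using r(2) by simp
  qed
  fix y :: 'a
  assume y: "y \<noteq> 0"
  show "E y = ?q y"
  proof (cases "P y = y")
    case True
    have "E (y + 0 *\<^sub>R v) = ?q (y + 0 *\<^sub>R v)"
    proof (rule line_ext_eq[of "\<lambda>t. E (y + t *\<^sub>R v)" "\<lambda>t. ?q (y + t *\<^sub>R v)"])
      show "isCont (\<lambda>t. E (y + t *\<^sub>R v)) 0" using E_line[of y 0 v] y DERIV_isCont by simp
      have "(\<lambda>t. ?q (y + t *\<^sub>R v)) = (\<lambda>t. c * f / A u u * A y y + c / B v v * (t\<^sup>2 * B v v))"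
        by (simp add: A_simps B_simps A_kernel[OF v(1)] B_range[OF True] power2_eq_square)
      moreover have "isCont (\<lambda>t. c * f / A u u * A y y + c / B v v * (t\<^sup>2 * B v v)) 0"
        by (intro continuous_intros)
      ultimately show "isCont (\<lambda>t. ?q (y + t *\<^sub>R v)) 0" by (simp only:)
      show "E (y + t *\<^sub>R v) = ?q (y + t *\<^sub>R v)" if "t > 0" for t
        by (rule gen) (use True v that in \<open>simp add: P_simps\<close>)
    qed
    then show ?thesis by simp
  qed (rule gen)
qed

end

lemma DERIV_even_eq_0:
  fixes m :: "real \<Rightarrow> real"
  assumes "(m has_real_derivative D) (at 0)" "\<And>t. m (- t) = m t"
  shows "D = 0"
proof -
  have "((\<lambda>t. m (- t)) has_real_derivative - D) (at 0)"
    using assms(1) DERIV_mirror[of m D 0] by simp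
  then have "(m has_real_derivative - D) (at 0)" by (simp only: assms(2))
  from DERIV_unique[OF assms(1) this] show ?thesis by simp
qed

context alpha12_norm
begin

section \<open>The plane spanned by one vector of each subbundle\<close>

context
  fixes u v :: 'a
  assumes u: "P u = u" "u \<noteq> 0" and v: "P v = 0" "v \<noteq> 0"
begin

lemma plane_nonzero: "v + x *\<^sub>R u \<noteq> 0"
  using perp_nonzero[OF v(2)] A_kernel[OF v(1)] B_range[OF u(1)] by simp

lemma plane_E_v: "dir_deriv v E (v + x *\<^sub>R u) = 2 * E (v + x *\<^sub>R u) - x * dir_deriv u E (v + x *\<^sub>R u)"
  using euler[OF plane_nonzero, of x] by (simp add: dE_lin plane_nonzero)

lemma plane_E_v_pos: "dir_deriv v E (v + x *\<^sub>R u) > 0"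
  using dE_kernel_pos[of "x *\<^sub>R u" v] u v by (simp add: P_simps add.commute)

text \<open>The part \<open>w\<close> of \<zeta> outside the plane is orthogonal to it for both
  forms and so is invisible to the derivatives of E that occur. This closes the equations on the
  plane although Z need not be tangent to it.\<close>

lemma plane_decomp:
  fixes \<zeta> x
  defines "y \<equiv> v + x *\<^sub>R u"
  shows "dir_deriv \<zeta> E y = A \<zeta> u / A u u * dir_deriv u E y + B \<zeta> v / B v v * dir_deriv v E y"
    and "dir_deriv \<zeta> (dir_deriv u E) y = A \<zeta> u / A u u * dir_deriv u (dir_deriv u E) y
      + B \<zeta> v / B v v * dir_deriv v (dir_deriv u E) y"
proof -
  define w where "w = \<zeta> - (A \<zeta> u / A u u) *\<^sub>R u - (B \<zeta> v / B v v) *\<^sub>R v"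
  have y: "y \<noteq> 0" unfolding y_def by (rule plane_nonzero)
  have pos: "A u u > 0" "B v v > 0" using A_pos_range u B_pos_kernel v by auto
  have Au: "A u w = 0" using pos by (simp add: w_def A_simps A_kernel[OF v(1)] sym_A[of \<zeta>])
  have Bv: "B v w = 0" using pos by (simp add: w_def B_simps B_range[OF u(1)] sym_B[of \<zeta>])
  have "A y w = 0" "B y w = 0"
    by (simp_all add: y_def A_simps B_simps Au Bv A_kernel[OF v(1)] B_range[OF u(1)])
  then have "dir_deriv w E y = 0" "dir_deriv w (dir_deriv u E) y = 0"
    using dE_perp[OF y] ddE_perp[OF y, of w u] Au B_range[OF u(1)] by auto
  then show "dir_deriv \<zeta> E y = A \<zeta> u / A u u * dir_deriv u E y + B \<zeta> v / B v v * dir_deriv v E y"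
    "dir_deriv \<zeta> (dir_deriv u E) y = A \<zeta> u / A u u * dir_deriv u (dir_deriv u E) y
      + B \<zeta> v / B v v * dir_deriv v (dir_deriv u E) y"
    by (simp_all add: w_def dE_lin[OF y] ddE_lin[OF y])
qed

text \<open>The vector \<open>K\<close> is the part of \<open>u\<close> that is annihilated by the
  differential of E at \<open>y\<close>. The Hessian at \<open>K\<close> is the claimed expression
  divided by \<open>2 * E y\<close>. This expression is the numerator of the derivative of
  \<psi>.\<close>

lemma plane_convex:
  fixes x
  defines "y \<equiv> v + x *\<^sub>R u"
  shows "2 * E y * dir_deriv u (dir_deriv u E) y - (dir_deriv u E y)\<^sup>2 > 0"
proof -
  define c where "c = dir_deriv u E y / (2 * E y)"
  define K where "K = u - c *\<^sub>R y"
  have y: "y \<noteq> 0" unfolding y_def by (rule plane_nonzero)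
  have E: "E y > 0" by (rule E_pos[OF y])
  have "K \<noteq> 0"
  proof
    assume K: "K = 0"
    then have "P u - c *\<^sub>R P y = 0" by (metis K_def P_simps(2-4))
    then have "u = (c * x) *\<^sub>R u" by (simp add: y_def P_simps u v)
    moreover have "(u - P u) - c *\<^sub>R (y - P y) = 0" using K \<open>P u - c *\<^sub>R P y = 0\<close>
      by (simp add: K_def algebra_simps)
    then have "c *\<^sub>R v = 0" by (simp add: y_def P_simps u v)
    ultimately show False using u v by auto
  qed
  have lin: "dir_deriv K E z = dir_deriv u E z - c * dir_deriv y E z" if "z \<noteq> 0" for z
    by (simp add: K_def dE_lin[OF that])
  have "dir_deriv K (dir_deriv K E) y = dir_deriv u (dir_deriv K E) y - c * dir_deriv y (dir_deriv K E) y"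
    by (simp add: K_def ddE_lin[OF y])
  also have "dir_deriv u (dir_deriv K E) y = dir_deriv K (dir_deriv u E) y" by (rule ddE_commute[OF y])
  also have "\<dots> = dir_deriv u (dir_deriv u E) y - c * dir_deriv u E y"
    by (simp add: K_def ddE_lin[OF y] euler_dE[OF y])
  also have "dir_deriv y (dir_deriv K E) y = 0"
    unfolding euler_dE[OF y] lin[OF y] using euler[OF y] E by (simp add: c_def)
  finally have "dir_deriv u (dir_deriv u E) y - c * dir_deriv u E y > 0"
    using E_convex[OF y \<open>K \<noteq> 0\<close>] by simp
  then have "2 * E y * (dir_deriv u (dir_deriv u E) y - c * dir_deriv u E y) > 0" using E by simp
  also have "2 * E y * (dir_deriv u (dir_deriv u E) y - c * dir_deriv u E y)
      = 2 * E y * dir_deriv u (dir_deriv u E) y - (dir_deriv u E y)\<^sup>2"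
    using E by (simp add: c_def field_simps power2_eq_square)
  finally show ?thesis .
qed

end

lemma swap_quad: "alpha12_norm.quad E B A \<longleftrightarrow> quad"
  unfolding alpha12_norm.quad_def[OF swap_norm] quad_def by (metis add.commute)

text \<open>For differentiable L these would be twice its two partial derivatives. They are read off
  from the radial derivatives of E, so that only the smoothness of E enters.\<close>

definition kA :: "'a \<Rightarrow> real" where "kA y = dir_deriv (P y) E y / A y y"
definition kB :: "'a \<Rightarrow> real" where "kB y = dir_deriv (y - P y) E y / B y y"

lemma kA_pos: assumes "P y \<noteq> 0" shows "kA y > 0"
proof -
  interpret S: alpha12_norm E B A "\<lambda>y. y - P y" by (rule swap_norm)
  have "dir_deriv (P y) E ((y - P y) + P y) > 0"
    by (rule S.dE_kernel_pos) (use assms in \<open>simp_all add: P_simps P_idem\<close>)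
  then show ?thesis using A_pos[OF assms] by (simp add: kA_def)
qed

lemma kB_pos: assumes "P y \<noteq> y" shows "kB y > 0"
proof -
  have "dir_deriv (y - P y) E (P y + (y - P y)) > 0"
    by (rule dE_kernel_pos) (use assms in \<open>simp_all add: P_simps P_idem\<close>)
  then show ?thesis using B_pos[OF assms] by (simp add: kB_def)
qed

lemma dE_eq:
  assumes "P y \<noteq> 0" "P y \<noteq> y"
  shows "dir_deriv \<zeta> E y = kA y * A y \<zeta> + kB y * B y \<zeta>"
proof -
  interpret S: alpha12_norm E B A "\<lambda>y. y - P y" by (rule swap_norm)
  have y: "y \<noteq> 0" using assms P_simps(4) by metis
  have pos: "A y y > 0" "B y y > 0" using A_pos B_pos assms by auto
  have "dir_deriv \<zeta> E y = dir_deriv (P \<zeta> + (\<zeta> - P \<zeta>)) E y" by simp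
  also have "\<dots> = dir_deriv (P \<zeta>) E y + dir_deriv (\<zeta> - P \<zeta>) E y" by (rule dE_lin(1)[OF y])
  also have "dir_deriv (P \<zeta>) E y = kA y * A y \<zeta>"
    using dE_range[OF y P_idem, of \<zeta>] pos by (simp add: kA_def A_P' field_simps)
  also have "dir_deriv (\<zeta> - P \<zeta>) E y = kB y * B y \<zeta>"
    using S.dE_range[OF y, of "\<zeta> - P \<zeta>"] pos by (simp add: kB_def B_simps B_P' P_simps P_idem field_simps)
  finally show ?thesis .
qed

text \<open>Passing from \<open>y\<close> to \<open>y + t *\<^sub>R P y\<close> rescales only the
  first partial length, so E along this line depends on the partial lengths of \<open>y\<close>
  alone.\<close>

lemma radial:
  assumes "y \<noteq> 0" "z \<noteq> 0" and eq: "A y y = A z z" "B y y = B z z"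
  shows "dir_deriv (P y) E y = dir_deriv (P z) E z"
proof -
  have "E (y + t *\<^sub>R P y) = E (z + t *\<^sub>R P z)" for t
    by (rule E_dep) (simp_all add: A_simps B_simps A_P A_P' B_P B_P' eq)
  then have fe: "(\<lambda>t. E (y + t *\<^sub>R P y)) = (\<lambda>t. E (z + t *\<^sub>R P z))" by blast
  show ?thesis
    using DERIV_unique[of "\<lambda>t. E (y + t *\<^sub>R P y)" "dir_deriv (P y) E y" 0 "dir_deriv (P z) E z"]
      E_line[of y 0 "P y"] E_line[of z 0 "P z", folded fe] assms(1,2) by simp
qed

lemma kA_cong:
  assumes "y \<noteq> 0" "z \<noteq> 0" "A y y = A z z" "B y y = B z z"
  shows "kA y = kA z" "kB y = kB z"
  using radial[OF assms] alpha12_norm.radial[OF swap_norm assms(1,2,4,3)] assms(3,4)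
  by (simp_all add: kA_def kB_def)

text \<open>Differentiate \<open>dE_range\<close> along \<open>y + t *\<^sub>R \<zeta>\<close> at
  \<open>t = 0\<close>. The radial derivative \<open>m\<close> and the square of the first partial
  length are both even in \<open>t\<close>, so the only contribution comes from the inner product
  with \<xi>.\<close>

lemma ddE_range:
  assumes y: "y \<noteq> 0" and \<zeta>: "A y \<zeta> = 0" "B y \<zeta> = 0" and \<xi>: "P \<xi> = \<xi>"
  shows "dir_deriv \<zeta> (dir_deriv \<xi> E) y * A y y = dir_deriv (P y) E y * A \<zeta> \<xi>"
proof -
  define m where "m t = dir_deriv (P (y + t *\<^sub>R \<zeta>)) E (y + t *\<^sub>R \<zeta>)" for t
  have nz: "y + t *\<^sub>R \<zeta> \<noteq> 0" for t by (rule perp_nonzero[OF y \<zeta>])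
  have m: "m t = dir_deriv (P y) E (y + t *\<^sub>R \<zeta>) + t * dir_deriv (P \<zeta>) E (y + t *\<^sub>R \<zeta>)" for t
    unfolding m_def P_simps by (simp add: dE_lin[OF nz])
  have "\<exists>D. (m has_real_derivative D) (at 0)"
    unfolding m[abs_def]
    by (intro exI) (rule DERIV_add DERIV_mult dE_line nz DERIV_ident)+
  then obtain D where D: "(m has_real_derivative D) (at 0)" ..
  have "m (- t) = m t" for t
    unfolding m_def by (rule radial[OF nz nz]) (simp_all only: reflect[OF \<zeta>] power2_minus)
  then have D0: "(m has_real_derivative 0) (at 0)" using DERIV_even_eq_0[OF D] D by simp
  have "((\<lambda>t. dir_deriv \<xi> E (y + t *\<^sub>R \<zeta>) * (A y y + t\<^sup>2 * A \<zeta> \<zeta>)) has_real_derivative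
      dir_deriv \<zeta> (dir_deriv \<xi> E) y * A y y) (at 0)"
    using dE_line[OF nz, of \<xi> 0] by (auto intro!: derivative_eq_intros)
  moreover have "dir_deriv \<xi> E (y + t *\<^sub>R \<zeta>) * (A y y + t\<^sup>2 * A \<zeta> \<zeta>) = m t * (A y \<xi> + t * A \<zeta> \<xi>)" for t
    using dE_range[OF nz \<xi>, of t] unfolding reflect[OF \<zeta>] m_def[symmetric] by (simp add: A_simps)
  moreover have "((\<lambda>t. m t * (A y \<xi> + t * A \<zeta> \<xi>)) has_real_derivative m 0 * A \<zeta> \<xi>) (at 0)"
    using D0 by (auto intro!: derivative_eq_intros)
  ultimately have "dir_deriv \<zeta> (dir_deriv \<xi> E) y * A y y = m 0 * A \<zeta> \<xi>"
    by (simp add: DERIV_unique)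
  then show ?thesis by (simp add: m_def)
qed

text \<open>Such directions supply the rays for \<open>line_ext_eq\<close>. Each component of
  \<open>w\<close> is that of \<open>y\<close>, or a fixed nonzero vector where \<open>y\<close> has
  none, so nothing can cancel for \<open>t > 0\<close>.\<close>

lemma generic_direction:
  obtains w where "\<And>t. t > 0 \<Longrightarrow> P (y + t *\<^sub>R w) \<noteq> 0" "\<And>t. t > 0 \<Longrightarrow> P (y + t *\<^sub>R w) \<noteq> y + t *\<^sub>R w"
proof -
  obtain u0 v0 where uv: "P u0 \<noteq> 0" "P v0 \<noteq> v0" using P_nontriv by blast
  define u v where "u = (if P y = 0 then P u0 else P y)" and "v = (if P y = y then v0 - P v0 else y - P y)"
  define w where "w = u + v"
  have uv': "P u = u" "P v = 0" by (simp_all add: u_def v_def P_simps P_idem)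
  have P1: "P (y + t *\<^sub>R w) \<noteq> 0" if "t > 0" for t
  proof -
    have "P (y + t *\<^sub>R w) = P y + t *\<^sub>R u" by (simp add: w_def P_simps uv')
    also have "\<dots> = (if P y = 0 then t *\<^sub>R P u0 else (1 + t) *\<^sub>R P y)"
      by (simp add: u_def scaleR_add_left)
    also have "\<dots> \<noteq> 0" using uv that by simp
    finally show ?thesis .
  qed
  have P2: "P (y + t *\<^sub>R w) \<noteq> y + t *\<^sub>R w" if "t > 0" for t
  proof -
    have "(y + t *\<^sub>R w) - P (y + t *\<^sub>R w) = (y - P y) + t *\<^sub>R v"
      by (simp add: w_def P_simps uv' algebra_simps)
    also have "\<dots> = (if P y = y then t *\<^sub>R (v0 - P v0) else (1 + t) *\<^sub>R (y - P y))"
      by (simp add: v_def scaleR_add_left)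
    also have "\<dots> \<noteq> 0" using uv that by simp
    finally show ?thesis by (metis right_minus_eq)
  qed
  show thesis by (rule that[OF P1 P2])
qed

end

text \<open>\<open>Z\<close> is the difference of the spray and the spray of a linear connection that preserves \<open>A\<close> and \<open>B\<close>,
  and \<open>T\<close> is half the torsion of that connection.\<close>

locale alpha12_fiber = alpha12_norm E A B P
  for E :: "'a::euclidean_space \<Rightarrow> real" and A B P +
  fixes T :: "'a \<Rightarrow> 'a \<Rightarrow> 'a" and Z :: "'a \<Rightarrow> 'a"
  assumes bil_T: "bilinear T" and T_alt: "\<And>y. T y y = 0"
    and Z_smooth: "smooth_on (- {0}) Z"
    and Z_eq: "\<And>y \<xi>. y \<noteq> 0 \<Longrightarrow> dir_deriv (Z y) (dir_deriv \<xi> E) y = - dir_deriv (T \<xi> y) E y"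
    and Z_landsberg: "\<And>y w. y \<noteq> 0 \<Longrightarrow>
      dir_deriv (dir_deriv w (dir_deriv w (dir_deriv w Z)) y) E y = 0"
begin

lemmas T_simps = bilinear_ladd[OF bil_T] bilinear_radd[OF bil_T] bilinear_lmul[OF bil_T]
  bilinear_rmul[OF bil_T] bilinear_lsub[OF bil_T] bilinear_rsub[OF bil_T] bilinear_lneg[OF bil_T]
  bilinear_rneg[OF bil_T] bilinear_lzero[OF bil_T] bilinear_rzero[OF bil_T]

lemma swap: "alpha12_fiber E B A (\<lambda>y. y - P y) T Z"
  by (intro alpha12_fiber.intro alpha12_fiber_axioms.intro swap_norm)
    (fact bil_T T_alt Z_smooth Z_eq Z_landsberg)+

text \<open>Take \<xi> = y in \<open>Z_eq\<close>: the torsion term vanishes, and by Euler's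
  identity and symmetry the Hessian term is the differential of E applied to
  \<open>Z y\<close>.\<close>

lemma dE_Z: "y \<noteq> 0 \<Longrightarrow> dir_deriv (Z y) E y = 0"
  using Z_eq[of y y] ddE_commute[of y "Z y" y] euler_dE[of y "Z y"] dE_lin(4)[of y] by (simp add: T_alt)

lemma Z_line:
  assumes "y + x *\<^sub>R w \<noteq> 0" "bounded_linear h"
  shows "((\<lambda>x. h ((dir_deriv w ^^ k) Z (y + x *\<^sub>R w))) has_real_derivative
    h ((dir_deriv w ^^ Suc k) Z (y + x *\<^sub>R w))) (at x)"
proof -
  have "smooth_on (- {0}) ((dir_deriv w ^^ k) Z)"
    by (induction k) (simp_all add: Z_smooth smooth_on_dir_deriv)
  then have "(dir_deriv w ^^ k) Z differentiable (at (y + x *\<^sub>R w))"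
    using smooth_on_imp_differentiable assms(1) by auto
  from bounded_linear.has_vector_derivative[OF assms(2) dir_deriv_line[OF this]] show ?thesis
    by (simp add: has_real_derivative_iff_has_vector_derivative)
qed

context
  fixes u v :: 'a
  assumes u: "P u = u" "u \<noteq> 0" and v: "P v = 0" "v \<noteq> 0"
begin

text \<open>These are \<open>dE_Z\<close> and \<open>Z_eq\<close> with \<xi> = u, expressed in the
  basis \<open>u\<close>, \<open>v\<close>. Alternation replaces \<open>T u y\<close> by
  \<open>T u v\<close>, which does not depend on \<open>x\<close>.\<close>

lemma plane_eqs:
  fixes x
  defines "y \<equiv> v + x *\<^sub>R u"
  defines "z \<equiv> A (Z y) u / A u u" and "z' \<equiv> B (Z y) v / B v v"
  shows "dir_deriv u E y * z + (2 * E y - x * dir_deriv u E y) * z' = 0"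
    and "z * dir_deriv u (dir_deriv u E) y + z' * (dir_deriv u E y - x * dir_deriv u (dir_deriv u E) y)
      = - (A (T u v) u / A u u * dir_deriv u E y + B (T u v) v / B v v * (2 * E y - x * dir_deriv u E y))"
proof -
  have y: "y \<noteq> 0" unfolding y_def by (rule plane_nonzero[OF u v])
  note dv = plane_E_v[OF u v, of x, folded y_def]
  show "dir_deriv u E y * z + (2 * E y - x * dir_deriv u E y) * z' = 0"
    using dE_Z[OF y] plane_decomp(1)[OF u v, of "Z y" x, folded y_def] dv by (simp add: z_def z'_def mult.commute)
  have Tu: "T u y = T u v" by (simp add: y_def T_simps T_alt)
  have "dir_deriv v (dir_deriv u E) y = dir_deriv u E y - x * dir_deriv u (dir_deriv u E) y"
  proof -
    have "dir_deriv (v + x *\<^sub>R u) (dir_deriv u E) y = dir_deriv u E y"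
      using euler_dE[OF y, of u] by (simp only: y_def)
    then show ?thesis by (simp add: ddE_lin[OF y])
  qed
  then show "z * dir_deriv u (dir_deriv u E) y + z' * (dir_deriv u E y - x * dir_deriv u (dir_deriv u E) y)
      = - (A (T u v) u / A u u * dir_deriv u E y + B (T u v) v / B v v * (2 * E y - x * dir_deriv u E y))"
    using Z_eq[OF y, of u] plane_decomp[OF u v, of "T u v" x, folded y_def] plane_decomp[OF u v, of "Z y" x, folded y_def] dv
    by (simp add: z_def z'_def Tu)
qed

text \<open>If the torsion components \<open>s\<close> and \<open>t\<close> are not both 0,
  \<open>plane_equations\<close> makes E quadratic on a line, hence everywhere by
  \<open>quadI\<close>. Once they vanish, the in-plane part of Z must vanish too.\<close>

lemma plane_torsion:
  assumes "\<not> quad"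
  shows "A (T u v) u = 0" "B (T u v) v = 0"
    and "A (Z (v + x *\<^sub>R u)) u = 0" "B (Z (v + x *\<^sub>R u)) v = 0"
proof -
  have pos: "A u u > 0" "B v v > 0" using A_pos_range u B_pos_kernel v by auto
  define s where "s = A (T u v) u / A u u"
  define t where "t = B (T u v) v / B v v"
  define hA where "hA \<zeta> = A \<zeta> u / A u u" for \<zeta>
  define hB where "hB \<zeta> = B \<zeta> v / B v v" for \<zeta>
  have "bounded_linear (\<lambda>\<zeta>. A \<zeta> u)" "bounded_linear (\<lambda>\<zeta>. B \<zeta> v)"
    using bil_A bil_B by (simp_all add: bilinear_def linear_conv_bounded_linear)
  then have hA: "bounded_linear hA" and hB: "bounded_linear hB"
    unfolding hA_def[abs_def] hB_def[abs_def] divide_inverse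
    by (simp_all add: bounded_linear_mult_const)
  have dE: "((\<lambda>x. (dir_deriv u ^^ k) E (v + x *\<^sub>R u)) has_real_derivative
      (dir_deriv u ^^ Suc k) E (v + x *\<^sub>R u)) (at x)" for k x
  proof -
    have "smooth_on (- {0}) ((dir_deriv u ^^ k) E)"
      by (induction k) (simp_all add: E_smooth smooth_on_dir_deriv)
    then have "(dir_deriv u ^^ k) E differentiable (at (v + x *\<^sub>R u))"
      using smooth_on_imp_differentiable plane_nonzero[OF u v] by auto
    from dir_deriv_line[OF this] show ?thesis by (simp add: has_real_derivative_iff_has_vector_derivative)
  qed
  have "s = 0 \<and> t = 0"
  proof (rule ccontr)
    assume "\<not> (s = 0 \<and> t = 0)"
    then have st: "s \<noteq> 0 \<or> t \<noteq> 0" by blast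
    let ?e = "\<lambda>k x. (dir_deriv u ^^ k) E (v + x *\<^sub>R u)"
    let ?z = "\<lambda>k x. (dir_deriv u ^^ k) Z (v + x *\<^sub>R u)"
    have "\<exists>f>0. \<forall>x. ?e 0 x = ?e 0 0 * (1 + f * x\<^sup>2)"
    proof (rule plane_equations[where ?e1.0 = "?e 1" and ?e2.0 = "?e 2" and ?e3.0 = "?e 3" and ?e4.0 = "?e 4"
          and ?z0.0 = "\<lambda>x. hA (?z 0 x)" and ?z1.0 = "\<lambda>x. hA (?z 1 x)" and ?z2.0 = "\<lambda>x. hA (?z 2 x)"
          and ?z3.0 = "\<lambda>x. hA (?z 3 x)"
          and ?y0.0 = "\<lambda>x. hB (?z 0 x)" and ?y1.0 = "\<lambda>x. hB (?z 1 x)" and ?y2.0 = "\<lambda>x. hB (?z 2 x)"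
          and ?y3.0 = "\<lambda>x. hB (?z 3 x)" and s = s and t = t])
      fix x
      show "(?e 0 has_real_derivative ?e 1 x) (at x)" "(?e 1 has_real_derivative ?e 2 x) (at x)"
        "(?e 2 has_real_derivative ?e 3 x) (at x)" "(?e 3 has_real_derivative ?e 4 x) (at x)"
        using dE[of 0] dE[of 1] dE[of 2] dE[of 3] by (simp_all add: eval_nat_numeral)
      show "((\<lambda>x. hA (?z 0 x)) has_real_derivative hA (?z 1 x)) (at x)"
        "((\<lambda>x. hA (?z 1 x)) has_real_derivative hA (?z 2 x)) (at x)"
        "((\<lambda>x. hA (?z 2 x)) has_real_derivative hA (?z 3 x)) (at x)"
        using Z_line[OF plane_nonzero[OF u v] hA, where k = 0] Z_line[OF plane_nonzero[OF u v] hA, where k = 1]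
          Z_line[OF plane_nonzero[OF u v] hA, where k = 2] by (simp_all add: eval_nat_numeral)
      show "((\<lambda>x. hB (?z 0 x)) has_real_derivative hB (?z 1 x)) (at x)"
        "((\<lambda>x. hB (?z 1 x)) has_real_derivative hB (?z 2 x)) (at x)"
        "((\<lambda>x. hB (?z 2 x)) has_real_derivative hB (?z 3 x)) (at x)"
        using Z_line[OF plane_nonzero[OF u v] hB, where k = 0] Z_line[OF plane_nonzero[OF u v] hB, where k = 1]
          Z_line[OF plane_nonzero[OF u v] hB, where k = 2] by (simp_all add: eval_nat_numeral)
      have "E (v + (- x) *\<^sub>R u) = E (v + x *\<^sub>R u)"
        by (rule E_dep) (simp_all add: A_simps B_simps A_kernel[OF v(1)] B_range[OF u(1)])
      then show "?e 0 (- x) = ?e 0 x" by simp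
      show "2 * ?e 0 x - x * ?e 1 x > 0" using plane_E_v_pos[OF u v, of x] by (simp add: plane_E_v[OF u v])
      show "2 * ?e 0 x * ?e 2 x - (?e 1 x)\<^sup>2 > 0" using plane_convex[OF u v, of x] by (simp add: eval_nat_numeral)
      show "?e 1 x * hA (?z 0 x) + (2 * ?e 0 x - x * ?e 1 x) * hB (?z 0 x) = 0"
        using plane_eqs(1)[of x] by (simp add: hA_def hB_def)
      show "hA (?z 0 x) * ?e 2 x + hB (?z 0 x) * (?e 1 x - x * ?e 2 x)
          = - (s * ?e 1 x + t * (2 * ?e 0 x - x * ?e 1 x))"
        using plane_eqs(2)[of x] by (simp add: hA_def hB_def s_def t_def eval_nat_numeral)
      show "?e 1 x * hA (?z 3 x) + (2 * ?e 0 x - x * ?e 1 x) * hB (?z 3 x) = 0"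
        using Z_landsberg[OF plane_nonzero[OF u v, of x], of u] plane_decomp(1)[OF u v, of "?z 3 x" x] plane_E_v[OF u v, of x]
        by (simp add: hA_def hB_def eval_nat_numeral mult.commute)
    qed (use st in auto)
    then obtain f where "f > 0" "\<And>x. E (v + x *\<^sub>R u) = E v * (1 + f * x\<^sup>2)" by auto
    with quadI[OF u v] assms show False by blast
  qed
  then have st: "s = 0" "t = 0" by auto
  then show "A (T u v) u = 0" "B (T u v) v = 0" using pos by (auto simp: s_def t_def)
  let ?y = "v + x *\<^sub>R u"
  \<comment> \<open>Without torsion the two equations are homogeneous in the in-plane components of
    Z, and up to sign their determinant is the positive quantity of
    \<open>plane_convex\<close>.\<close>
  have eq1: "dir_deriv u E ?y * hA (Z ?y) + (2 * E ?y - x * dir_deriv u E ?y) * hB (Z ?y) = 0"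
    using plane_eqs(1)[of x] by (simp add: hA_def hB_def)
  have eq2: "hA (Z ?y) * dir_deriv u (dir_deriv u E) ?y
      + hB (Z ?y) * (dir_deriv u E ?y - x * dir_deriv u (dir_deriv u E) ?y) = 0"
    using plane_eqs(2)[of x] unfolding hA_def hB_def s_def[symmetric] t_def[symmetric] st by simp
  have "hA (Z ?y) * (2 * E ?y * dir_deriv u (dir_deriv u E) ?y - (dir_deriv u E ?y)\<^sup>2) = 0"
    using eq1 eq2 by algebra
  then have "hA (Z ?y) = 0" using plane_convex[OF u v, of x] by simp
  moreover from this have "hB (Z ?y) = 0" using eq1 plane_E_v[OF u v, of x] plane_E_v_pos[OF u v, of x] by simp
  ultimately show "A (Z ?y) u = 0" "B (Z ?y) v = 0" using pos by (auto simp: hA_def hB_def)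
qed

end

section \<open>The rotational part of Z\<close>

lemma Z_perp:
  assumes nq: "\<not> quad" and y: "P y \<noteq> 0" "P y \<noteq> y"
  shows "A (Z y) y = 0" "B (Z y) y = 0"
  using plane_torsion(3,4)[OF P_idem y(1) _ _ nq, of "y - P y" 1] y(2)
  by (simp_all add: P_simps P_idem A_P' B_simps B_P')

lemma torsion_kernel:
  assumes nq: "\<not> quad" and "P u = u" "P v = 0"
  shows "A (T u v) u = 0" "B (T u v) v = 0"
proof -
  have "A (T u v) u = 0 \<and> B (T u v) v = 0"
  proof (cases "u = 0 \<or> v = 0")
    case True
    then show ?thesis by (auto simp: A_simps B_simps T_simps)
  qed (use plane_torsion[OF assms(2) _ assms(3) _ nq] in blast)
  then show "A (T u v) u = 0" "B (T u v) v = 0" by auto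
qed

text \<open>By \<open>Z_perp\<close>, \<open>ddE_range\<close> applies to the direction
  \<open>Z y\<close> and turns the Hessian term into a multiple of \<open>A (Z y) \<xi>\<close>.
  After division by \<open>kA y\<close> the only term that may fail to be quadratic is
  \<open>kB y / kA y\<close> times the torsion between \<xi> and \<open>P y\<close>.\<close>

lemma Z_range:
  assumes nq: "\<not> quad" and y: "P y \<noteq> 0" "P y \<noteq> y" and \<xi>: "P \<xi> = \<xi>"
  shows "kA y * A (Z y) \<xi> = - (kA y * A (T \<xi> y) y + kB y * B (T \<xi> (P y)) y)"
proof -
  have y0: "y \<noteq> 0" using y P_simps(4) by metis
  have pos: "A y y > 0" using A_pos y by auto
  have "A y (Z y) = 0" "B y (Z y) = 0" using Z_perp[OF nq y] sym_A sym_B by metis+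
  from ddE_range[OF y0 this \<xi>] have "kA y * A (Z y) \<xi> = dir_deriv (Z y) (dir_deriv \<xi> E) y"
    using pos by (simp add: kA_def field_simps)
  also have "\<dots> = - (kA y * A y (T \<xi> y) + kB y * B y (T \<xi> y))"
    unfolding Z_eq[OF y0] dE_eq[OF y] ..
  also have "B y (T \<xi> y) = B (T \<xi> (P y + (y - P y))) y" using sym_B by simp
  also have "\<dots> = B (T \<xi> (P y)) y + B (T \<xi> (y - P y)) y" by (simp only: T_simps(2) B_simps(1))
  also have "B (T \<xi> (y - P y)) y = B (T \<xi> (y - P y)) (y - P y)" by (simp only: B_simps(6) B_P' diff_zero)
  also have "\<dots> = 0" by (rule torsion_kernel(2)[OF nq \<xi>]) (simp add: P_simps P_idem)
  finally show ?thesis using sym_A by simp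
qed

text \<open>The Landsberg condition makes the \<open>w\<close>-component of Z affine in
  \<open>t\<close>. By \<open>Z_range\<close> the ratio is then affine as well, because its
  coefficient is a nonzero constant along the line. The ratio depends on the partial lengths only,
  hence is even in \<open>t\<close>, and so it is constant.\<close>

lemma ratio_const_on_line:
  assumes nq: "\<not> quad" and y: "P y \<noteq> 0" "P y \<noteq> y" and w: "P w = w" "A y w = 0"
    and \<beta>: "B (T w (P y)) y \<noteq> 0"
  shows "kB (y + t *\<^sub>R w) / kA (y + t *\<^sub>R w) = kB y / kA y"
proof -
  have y0: "y \<noteq> 0" using y P_simps(4) by metis
  have Bw: "B y w = 0" by (rule B_range[OF w(1)])
  have nz: "y + t *\<^sub>R w \<noteq> 0" for t by (rule perp_nonzero[OF y0 w(2) Bw])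
  have Pt: "P (y + t *\<^sub>R w) = P y + t *\<^sub>R w" for t by (simp add: P_simps w)
  have yt: "P (y + t *\<^sub>R w) \<noteq> 0" "P (y + t *\<^sub>R w) \<noteq> y + t *\<^sub>R w" for t
  proof -
    have "A (P (y + t *\<^sub>R w)) y = A y y" using w(2) sym_A[of w y] by (simp add: Pt A_simps A_P)
    then show "P (y + t *\<^sub>R w) \<noteq> 0" using A_pos[OF y(1)] by (metis A_simps(9) less_irrefl)
    show "P (y + t *\<^sub>R w) \<noteq> y + t *\<^sub>R w" using y(2) by (simp add: Pt)
  qed
  define Y where "Y k t = (dir_deriv w ^^ k) Z (y + t *\<^sub>R w)" for k t
  have blA: "bounded_linear (\<lambda>\<zeta>. A \<zeta> z)" and blB: "bounded_linear (\<lambda>\<zeta>. B \<zeta> z)" for z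
    using bil_A bil_B by (simp_all add: bilinear_def linear_conv_bounded_linear)
  have dA: "((\<lambda>t. A (Y k t) z) has_real_derivative A (Y (Suc k) t) z) (at t)" for k t z
    unfolding Y_def by (rule Z_line[OF nz blA])
  have dB: "((\<lambda>t. B (Y k t) z) has_real_derivative B (Y (Suc k) t) z) (at t)" for k t z
    unfolding Y_def by (rule Z_line[OF nz blB])
  have b: "B (Y k t) y = 0" for k t
  proof (induction k arbitrary: t)
    case 0
    then show ?case using Z_perp(2)[OF nq yt] by (simp add: Y_def B_simps B_range[OF w(1)])
  next
    case (Suc k)
    show ?case by (rule DERIV_unique[OF dB]) (simp add: Suc)
  qed
  \<comment> \<open>This is the \<open>k\<close>-th derivative of
    \<open>A (Z (y + t *\<^sub>R w)) (y + t *\<^sub>R w) = 0\<close>. For \<open>k = 0\<close> the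
    truncated index \<open>k - 1\<close> is multiplied by 0.\<close>
  have a: "A (Y k t) y = - (real k * A (Y (k - 1) t) w + t * A (Y k t) w)" for k t
  proof (induction k arbitrary: t)
    case 0
    then show ?case using Z_perp(1)[OF nq yt, of t] by (simp add: Y_def A_simps)
  next
    case (Suc k)
    show ?case
    proof (rule DERIV_unique[OF dA])
      have "((\<lambda>t. real k * A (Y (k - 1) t) w) has_real_derivative real k * A (Y k t) w) (at t)"
      proof (cases k)
        case (Suc j)
        then show ?thesis using DERIV_cmult[OF dA[of j w t], of "real k"] by simp
      qed simp
      then have "((\<lambda>t. - (real k * A (Y (k - 1) t) w + t * A (Y k t) w)) has_real_derivative
          - (real (Suc k) * A (Y k t) w + t * A (Y (Suc k) t) w)) (at t)"
        using DERIV_minus[OF DERIV_add[OF _ DERIV_mult[OF DERIV_ident dA[of k w t]]]]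
        by (fastforce simp: algebra_simps)
      then show "((\<lambda>t. A (Y k t) y) has_real_derivative
          - (real (Suc k) * A (Y (Suc k - 1) t) w + t * A (Y (Suc k) t) w)) (at t)"
        unfolding Suc.IH by simp
    qed
  qed
  \<comment> \<open>The Landsberg condition says that \<open>Y 3 t\<close> is orthogonal to
    \<open>y + t *\<^sub>R w\<close>; compared with \<open>a\<close> for \<open>k = 3\<close>, only
    \<open>3 * A (Y 2 t) w\<close> is left.\<close>
  have q2: "A (Y 2 t) w = 0" for t
  proof -
    have "dir_deriv (Y 3 t) E (y + t *\<^sub>R w) = 0"
      using Z_landsberg[OF nz[of t], of w] by (simp add: Y_def eval_nat_numeral)
    then have "kA (y + t *\<^sub>R w) * A (y + t *\<^sub>R w) (Y 3 t) + kB (y + t *\<^sub>R w) * B (y + t *\<^sub>R w) (Y 3 t) = 0"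
      by (simp only: dE_eq[OF yt])
    moreover have "B (y + t *\<^sub>R w) (Y 3 t) = 0"
      using b[of 3 t] sym_B by (simp add: B_simps B_range[OF w(1)])
    ultimately have "A (Y 3 t) (y + t *\<^sub>R w) = 0"
      using kA_pos[OF yt(1), of t] sym_A by simp
    then show ?thesis using a[of 3 t] by (simp add: A_simps)
  qed
  have q1: "A (Y 1 t) w = A (Y 1 0) w" for t
    using DERIV_isconst_all[of "\<lambda>t. A (Y 1 t) w" t 0] dA[of 1 w] q2 by (simp add: numeral_2_eq_2)
  have q0: "A (Y 0 t) w = A (Y 0 0) w + t * A (Y 1 0) w" for t
  proof -
    have "((\<lambda>t. A (Y 0 t) w - t * A (Y 1 0) w) has_real_derivative 0) (at t)" for t
      using dA[of 0 w t] q1[of t] by (auto intro!: derivative_eq_intros)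
    from DERIV_isconst_all[OF allI[OF this], of t 0] show ?thesis by simp
  qed
  define k where "k t = kB (y + t *\<^sub>R w) / kA (y + t *\<^sub>R w)" for t
  define c0 where "c0 = - A (T w y) y - A (Y 0 0) w"
  define c1 where "c1 = - A (T w y) w - A (Y 1 0) w"
  \<comment> \<open>The factor of \<open>k t\<close> is the same at all points of the line because
    \<open>T w w = 0\<close>.\<close>
  have kt: "k t * B (T w (P y)) y = c0 + t * c1" for t
  proof -
    have "kA (y + t *\<^sub>R w) * A (Z (y + t *\<^sub>R w)) w
      = - (kA (y + t *\<^sub>R w) * (A (T w y) y + t * A (T w y) w) + kB (y + t *\<^sub>R w) * B (T w (P y)) y)"
      using Z_range[OF nq yt w(1), of t] by (simp add: Pt T_simps T_alt A_simps B_simps B_range[OF w(1)])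
    then have "kB (y + t *\<^sub>R w) * B (T w (P y)) y
        = kA (y + t *\<^sub>R w) * (- A (Z (y + t *\<^sub>R w)) w - A (T w y) y - t * A (T w y) w)"
      by (simp add: algebra_simps)
    then have "k t * B (T w (P y)) y = - A (Z (y + t *\<^sub>R w)) w - A (T w y) y - t * A (T w y) w"
      using kA_pos[OF yt(1), of t] by (simp add: k_def field_simps)
    then show ?thesis using q0[of t] by (simp add: c0_def c1_def Y_def algebra_simps)
  qed
  have "k (-1) = k 1"
    unfolding k_def
    using kA_cong[OF nz[of "-1"] nz[of 1]] reflect[OF w(2) Bw, of "-1"] reflect[OF w(2) Bw, of 1] by simp
  then have "c1 = 0" using kt[of 1] kt[of "-1"] by simp
  then have "k t * B (T w (P y)) y = k 0 * B (T w (P y)) y" using kt by simp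
  then have "k t = k 0" using \<beta> by simp
  then show ?thesis by (simp add: k_def)
qed

text \<open>Moving orthogonally along \<open>w\<close> increases the first partial length as moving
  outwards along \<open>u\<close> does. Thus constancy of the ratio on the lines in direction
  \<open>w\<close> becomes constancy along the ray in direction \<open>u\<close>, and a constant
  ratio makes \<psi> linear, which is the excluded Euclidean case.\<close>

lemma torsion_range_perp:
  assumes nq: "\<not> quad" and u: "P u = u" and w: "P w = w" and v: "P v = 0" and perp: "A u w = 0"
  shows "B (T w u) v = 0"
proof (rule ccontr)
  assume nz: "B (T w u) v \<noteq> 0"
  then have u0: "u \<noteq> 0" and w0: "w \<noteq> 0" and v0: "v \<noteq> 0" by (auto simp: T_simps B_simps)
  have pos: "A u u > 0" "A w w > 0" "B v v > 0" using A_pos_range B_pos_kernel u w v u0 w0 v0 by auto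
  define y where "y x = v + x *\<^sub>R u" for x
  have Py: "P (y x) = x *\<^sub>R u" for x by (simp add: y_def P_simps u v)
  have yx: "P (y x) \<noteq> 0" "P (y x) \<noteq> y x" "y x \<noteq> 0" if "x > 0" for x
    unfolding Py using that u0 v0 plane_nonzero[OF u u0 v v0] by (auto simp: y_def)
  have Ay: "A (y x) (y x) = x\<^sup>2 * A u u" and By: "B (y x) (y x) = B v v" for x
    by (simp_all add: y_def A_simps B_simps A_kernel[OF v] B_range[OF u] power2_eq_square)
  have Aw: "A (y x) w = 0" for x by (simp add: y_def A_simps A_kernel[OF v] perp)
  have \<beta>: "B (T w (P (y x))) (y x) \<noteq> 0" if "x > 0" for x
    using nz that unfolding Py by (simp add: y_def T_simps B_simps B_range[OF u])
  have mono: "kB (y x') / kA (y x') = kB (y x) / kA (y x)" if "0 < x" "x \<le> x'" for x x'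
  proof -
    \<comment> \<open>Chosen so that \<open>y x + t *\<^sub>R w\<close> has the partial lengths of
      \<open>y x'\<close>.\<close>
    define t where "t = sqrt ((x'\<^sup>2 - x\<^sup>2) * A u u / A w w)"
    have "x\<^sup>2 \<le> x'\<^sup>2" using that by (simp add: power_mono)
    then have t: "t\<^sup>2 * A w w = (x'\<^sup>2 - x\<^sup>2) * A u u" using pos by (simp add: t_def)
    let ?z = "y x + t *\<^sub>R w"
    have "A ?z ?z = A (y x') (y x')" "B ?z ?z = B (y x') (y x')"
      using reflect[OF Aw B_range(2)[OF w], of x t] t B_range[OF w]
      by (simp_all add: Ay By algebra_simps)
    moreover have "?z \<noteq> 0" by (rule perp_nonzero[OF yx(3)[OF that(1)] Aw B_range(2)[OF w]])
    ultimately have "kA ?z = kA (y x')" "kB ?z = kB (y x')"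
      using kA_cong[of ?z "y x'"] yx(3)[of x'] that by auto
    then show ?thesis
      using ratio_const_on_line[OF nq yx(1,2)[OF that(1)] w Aw \<beta>[OF that(1)], of t] by simp
  qed
  define K where "K = kB (y 1) / kA (y 1)"
  have kK: "kB (y x) = K * kA (y x)" if "x > 0" for x
  proof -
    have "kB (y x) / kA (y x) = K"
    proof (cases "x \<le> 1")
      case True
      from mono[OF that True] show ?thesis by (simp only: K_def)
    next
      case False
      then show ?thesis using mono[of 1 x] by (simp only: K_def)
    qed
    then show ?thesis using kA_pos[OF yx(1)[OF that]] by (simp add: field_simps)
  qed
  have K: "K > 0" using kA_pos[OF yx(1)] kB_pos[OF yx(2)] by (simp add: K_def)
  \<comment> \<open>For a constant ratio \<open>K\<close>, \<psi> at \<open>x\<close> is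
    \<open>x * A u u / (K * B v v)\<close>.\<close>
  define f where "f = A u u / (K * B v v)"
  have f: "f > 0" using pos K by (simp add: f_def)
  have de: "((\<lambda>x. E (y x)) has_real_derivative dir_deriv u E (y x)) (at x)" for x
    unfolding y_def by (rule E_line[OF plane_nonzero[OF u u0 v v0]])
  have dv: "dir_deriv v E (y x) = 2 * E (y x) - x * dir_deriv u E (y x)" for x
    unfolding y_def by (rule plane_E_v[OF u u0 v v0])
  have slope_pos: "dir_deriv u E (y x) = f * x * (2 * E (y x) - x * dir_deriv u E (y x))" if "x > 0" for x
  proof -
    have "dir_deriv u E (y x) = kA (y x) * (x * A u u)"
      using dE_eq[OF yx(1,2)[OF that], of u] by (simp add: y_def A_simps A_kernel[OF v] B_range[OF u])
    moreover have "dir_deriv v E (y x) = K * kA (y x) * B v v"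
      using dE_eq[OF yx(1,2)[OF that], of v] kK[OF that]
      by (simp add: y_def B_simps A_kernel[OF v] B_range[OF u])
    ultimately show ?thesis unfolding dv[symmetric] using pos K by (simp add: f_def)
  qed
  have Ey: "E (y (- x)) = E (y x)" for x by (rule E_dep) (simp_all add: Ay By)
  have odd: "dir_deriv u E (y (- x)) = - dir_deriv u E (y x)" for x
  proof -
    have "((\<lambda>x. E (y (- x))) has_real_derivative - dir_deriv u E (y (- x))) (at x)"
      using DERIV_mirror[of "\<lambda>x. E (y x)" "dir_deriv u E (y (- x))" x] de[of "- x"] by simp
    then have "((\<lambda>x. E (y x)) has_real_derivative - dir_deriv u E (y (- x))) (at x)" by (simp only: Ey)
    from DERIV_unique[OF de this] show ?thesis by simp
  qed
  have "dir_deriv u E (y x) = f * x * (2 * E (y x) - x * dir_deriv u E (y x))" for x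
  proof (cases x "0 :: real" rule: linorder_cases)
    case less
    then show ?thesis using slope_pos[of "- x"] odd[of x] Ey[of x] by simp
  next
    case equal
    then show ?thesis using odd[of 0] by simp
  qed (rule slope_pos)
  from quadratic_of_linear_slope[OF de f this] have "E (y x) = E (y 0) * (1 + f * x\<^sup>2)" for x .
  then show False using quadI[OF u u0 v v0 f, of "E (y 0)"] nq by (simp add: y_def)
qed

text \<open>Subtracting from \<open>w\<close> its component along \<open>u\<close> does not change
  \<open>T w u\<close>, as T is alternating. In rank one the difference is 0, so this case needs no
  separate argument.\<close>

lemma torsion_range:
  assumes nq: "\<not> quad" and u: "P u = u" and w: "P w = w" and v: "P v = 0"
  shows "B (T w u) v = 0"
proof (cases "u = 0")
  case True
  then show ?thesis by (simp add: T_simps B_simps)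
next
  case False
  define c where "c = A u w / A u u"
  have "A u u > 0" by (rule A_pos_range[OF u False])
  then have "A u (w - c *\<^sub>R u) = 0" by (simp add: A_simps c_def)
  moreover have "P (w - c *\<^sub>R u) = w - c *\<^sub>R u" by (simp add: P_simps u w)
  ultimately have "B (T (w - c *\<^sub>R u) u) v = 0" by (rule torsion_range_perp[OF nq u _ v, rotated])
  then show ?thesis by (simp add: T_simps T_alt)
qed

section \<open>Quadraticity of Z\<close>

lemma Z_range_quadratic:
  assumes nq: "\<not> quad" and y: "P y \<noteq> 0" "P y \<noteq> y"
  shows "A (Z y) \<xi> = - A (T (P \<xi>) y) y"
proof -
  have "B (T (P \<xi>) (P y)) y = B (T (P \<xi>) (P y)) (y - P y)" by (simp add: B_simps B_P')
  also have "\<dots> = 0" by (rule torsion_range[OF nq P_idem P_idem]) (simp add: P_simps P_idem)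
  finally have "kA y * (A (Z y) \<xi> + A (T (P \<xi>) y) y) = 0"
    using Z_range[OF nq y P_idem, of \<xi>] by (simp add: A_P' distrib_left)
  then show ?thesis using kA_pos[OF y(1)] by (simp add: eq_neg_iff_add_eq_0)
qed

text \<open>It suffices to find a positive definite \<open>H\<close> for which
  \<open>H (Z y) \<xi>\<close> is quadratic in \<open>y\<close> for every \<xi>: a third derivative
  \<open>D\<close> of Z then satisfies \<open>H D D = 0\<close>. If E is quadratic, its polar form
  serves; otherwise \<open>A + B\<close> does, by \<open>Z_range_quadratic\<close> for both
  subbundles.\<close>

theorem third_dir_deriv_Z:
  assumes y: "y \<noteq> 0"
  shows "dir_deriv r (dir_deriv q (dir_deriv p Z)) y = 0"
proof -
  let ?D = "dir_deriv r (dir_deriv q (dir_deriv p Z)) y"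
  have "\<exists>H. bilinear H \<and> (\<forall>\<eta>. \<eta> \<noteq> 0 \<longrightarrow> H \<eta> \<eta> > 0) \<and>
    (\<forall>\<xi>. \<exists>R. bilinear R \<and> (\<forall>y. y \<noteq> 0 \<longrightarrow> H (Z y) \<xi> = (R y y :: real)))"
  proof (cases quad)
    case True
    then obtain c d where E: "\<And>y. y \<noteq> 0 \<Longrightarrow> E y = c * A y y + d * B y y" unfolding quad_def by blast
    define H where "H \<eta> \<xi> = c * A \<eta> \<xi> + d * B \<eta> \<xi>" for \<eta> \<xi>
    have H: "bilinear H"
      unfolding bilinear_def H_def by (auto intro!: linearI simp: A_simps B_simps algebra_simps)
    have sym_H: "H \<eta> \<xi> = H \<xi> \<eta>" for \<eta> \<xi> using sym_A[of \<eta> \<xi>] sym_B[of \<eta> \<xi>] by (simp add: H_def)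
    have bH: "bounded_bilinear H" using H bilinear_conv_bounded_bilinear by blast
    have dE: "dir_deriv \<xi> E z = 2 * H z \<xi>" if "z \<noteq> 0" for \<xi> z
    proof -
      have "dir_deriv \<xi> E z = dir_deriv \<xi> (\<lambda>z. H z z) z"
        by (rule dir_deriv_cong[OF open_dom]) (use E that in \<open>auto simp: H_def\<close>)
      also have "\<dots> = H z \<xi> + H \<xi> z"
        by (rule dir_deriv_eq[OF bounded_bilinear.FDERIV[OF bH has_derivative_ident has_derivative_ident]])
      finally show ?thesis using sym_H[of \<xi> z] by simp
    qed
    have ddE: "dir_deriv \<zeta> (dir_deriv \<xi> E) z = 2 * H \<zeta> \<xi>" if "z \<noteq> 0" for \<zeta> \<xi> z
    proof -
      have "dir_deriv \<zeta> (dir_deriv \<xi> E) z = dir_deriv \<zeta> (\<lambda>z. 2 * H z \<xi>) z"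
        by (rule dir_deriv_cong[OF open_dom]) (use dE that in auto)
      also have "\<dots> = 2 * H \<zeta> \<xi>"
        using bounded_bilinear.bounded_linear_left[OF bH]
        by (intro dir_deriv_eq bounded_linear_imp_has_derivative bounded_linear_const_mult)
      finally show ?thesis .
    qed
    have "H (Z z) \<xi> = - H (T \<xi> z) z" if "z \<noteq> 0" for z \<xi>
      using Z_eq[OF that, of \<xi>] dE[OF that] ddE[OF that] sym_H[of z] by simp
    moreover have "bilinear (\<lambda>z z'. - H (T \<xi> z) z')" for \<xi>
      unfolding bilinear_def
      by (auto intro!: linearI simp: T_simps bilinear_ladd[OF H] bilinear_radd[OF H] bilinear_lmul[OF H] bilinear_rmul[OF H])
    moreover have "H \<eta> \<eta> > 0" if "\<eta> \<noteq> 0" for \<eta> using E_pos[OF that] E[OF that] by (simp add: H_def)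
    ultimately show ?thesis using H by blast
  next
    case nq: False
    interpret S: alpha12_fiber E B A "\<lambda>y. y - P y" T Z by (rule swap)
    have Snq: "\<not> S.quad" using nq swap_quad by blast
    define H where "H \<eta> \<xi> = A \<eta> \<xi> + B \<eta> \<xi>" for \<eta> \<xi>
    define R where "R \<xi> z z' = - A (T (P \<xi>) z) z' - B (T (\<xi> - P \<xi>) z) z'" for \<xi> z z'
    have H: "bilinear H"
      unfolding bilinear_def H_def by (auto intro!: linearI simp: A_simps B_simps algebra_simps)
    have R: "bilinear (R \<xi>)" for \<xi>
      unfolding bilinear_def R_def by (auto intro!: linearI simp: A_simps B_simps T_simps algebra_simps)
    have pos: "H \<eta> \<eta> > 0" if "\<eta> \<noteq> 0" for \<eta>
    proof (cases "P \<eta> = 0")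
      case True
      then show ?thesis using B_pos[of \<eta>] that by (simp add: H_def A_kernel)
    next
      case False
      then show ?thesis using A_pos[of \<eta>] S.A_nonneg[of \<eta>] by (simp add: H_def)
    qed
    have gen: "H (Z y) \<xi> = R \<xi> y y" if "P y \<noteq> 0" "P y \<noteq> y" for y \<xi>
      using Z_range_quadratic[OF nq that, of \<xi>] S.Z_range_quadratic[OF Snq, of y \<xi>] that
      by (simp add: H_def R_def)
    have "H (Z y) \<xi> = R \<xi> y y" if "y \<noteq> 0" for y \<xi>
    proof -
      obtain w where P1: "\<And>t. t > 0 \<Longrightarrow> P (y + t *\<^sub>R w) \<noteq> 0"
        and P2: "\<And>t. t > 0 \<Longrightarrow> P (y + t *\<^sub>R w) \<noteq> y + t *\<^sub>R w"
        using generic_direction by blast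
      have "H (Z (y + 0 *\<^sub>R w)) \<xi> = R \<xi> (y + 0 *\<^sub>R w) (y + 0 *\<^sub>R w)"
      proof (rule line_ext_eq[of "\<lambda>t. H (Z (y + t *\<^sub>R w)) \<xi>" "\<lambda>t. R \<xi> (y + t *\<^sub>R w) (y + t *\<^sub>R w)"])
        have "bounded_linear (\<lambda>\<zeta>. H \<zeta> \<xi>)" using H by (simp add: bilinear_def linear_conv_bounded_linear)
        from Z_line[OF _ this, of y 0 w 0] that show "isCont (\<lambda>t. H (Z (y + t *\<^sub>R w)) \<xi>) 0"
          by (auto intro: DERIV_isCont)
        have "(\<lambda>t. R \<xi> (y + t *\<^sub>R w) (y + t *\<^sub>R w)) = (\<lambda>t. R \<xi> y y + t * (R \<xi> y w + R \<xi> w y) + t\<^sup>2 * R \<xi> w w)"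
          by (simp add: bilinear_ladd[OF R] bilinear_radd[OF R] bilinear_lmul[OF R] bilinear_rmul[OF R]
              algebra_simps power2_eq_square)
        moreover have "isCont (\<lambda>t. R \<xi> y y + t * (R \<xi> y w + R \<xi> w y) + t\<^sup>2 * R \<xi> w w) 0"
          by (intro continuous_intros)
        ultimately show "isCont (\<lambda>t. R \<xi> (y + t *\<^sub>R w) (y + t *\<^sub>R w)) 0" by (simp only:)
      qed (use gen P1 P2 in blast)
      then show ?thesis by simp
    qed
    then show ?thesis using H R pos by blast
  qed
  then obtain H where H: "bilinear H" "\<And>\<eta>. \<eta> \<noteq> 0 \<Longrightarrow> H \<eta> \<eta> > (0::real)"
    and "\<exists>R. bilinear R \<and> (\<forall>y. y \<noteq> 0 \<longrightarrow> H (Z y) ?D = R y y)" by blast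
  then have "H ?D ?D = 0" using third_dir_deriv_quadratic[OF Z_smooth H(1) _ _ y] by blast
  then show ?thesis using H(2)[of ?D] by force
qed

end

subsection \<open>The spray in local coordinates\<close>

lemma dir_deriv_add:
  "f differentiable (at x) \<Longrightarrow> g differentiable (at x) \<Longrightarrow>
    dir_deriv v (\<lambda>x. f x + g x) x = dir_deriv v f x + dir_deriv v g x"
  by (rule dir_deriv_eq, rule has_derivative_add; rule has_derivative_dir_deriv)

lemma dir_deriv_diff:
  "f differentiable (at x) \<Longrightarrow> g differentiable (at x) \<Longrightarrow>
    dir_deriv v (\<lambda>x. f x - g x) x = dir_deriv v f x - dir_deriv v g x"
  by (rule dir_deriv_eq, rule has_derivative_diff; rule has_derivative_dir_deriv)

text \<open>Coordinates only provide identities for basis directions; linearity in the inner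
  direction extends them to all directions.\<close>

lemma linear_second_dir_deriv:
  assumes U: "open U" "y \<in> U" and W: "smooth_on U W"
  shows "linear (\<lambda>q. dir_deriv r (dir_deriv q W) y)"
proof (rule linearI)
  have d: "dir_deriv q W differentiable (at z)" if "z \<in> U" for q z
    using smooth_on_imp_differentiable[OF smooth_on_dir_deriv[OF W] that] .
  fix p q c
  have "dir_deriv r (dir_deriv (p + q) W) y = dir_deriv r (\<lambda>z. dir_deriv p W z + dir_deriv q W z) y"
    by (rule dir_deriv_cong[OF U], rule linear_add[OF linear_dir_deriv])
      (rule smooth_on_imp_differentiable[OF W])
  then show "dir_deriv r (dir_deriv (p + q) W) y = dir_deriv r (dir_deriv p W) y + dir_deriv r (dir_deriv q W) y"
    by (simp add: dir_deriv_add d U)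
  have "dir_deriv r (dir_deriv (c *\<^sub>R p) W) y = dir_deriv r (\<lambda>z. c *\<^sub>R dir_deriv p W z) y"
    by (rule dir_deriv_cong[OF U], rule linear_cmul[OF linear_dir_deriv])
      (rule smooth_on_imp_differentiable[OF W])
  then show "dir_deriv r (dir_deriv (c *\<^sub>R p) W) y = c *\<^sub>R dir_deriv r (dir_deriv p W) y"
    by (simp add: dir_deriv_bounded_linear[OF bounded_linear_scaleR_right] d U)
qed

lemma linear_third_dir_deriv:
  assumes U: "open U" "y \<in> U" and W: "smooth_on U W"
  shows "linear (\<lambda>p. dir_deriv r (dir_deriv q (dir_deriv p W)) y)"
proof (rule linearI)
  have d: "dir_deriv q (dir_deriv p W) differentiable (at y)" for p q
    using smooth_on_imp_differentiable[OF smooth_on_dir_deriv[OF smooth_on_dir_deriv[OF W]] U(2)] .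
  fix p p' c
  have "dir_deriv r (dir_deriv q (dir_deriv (p + p') W)) y
      = dir_deriv r (\<lambda>z. dir_deriv q (dir_deriv p W) z + dir_deriv q (dir_deriv p' W) z) y"
    by (rule dir_deriv_cong[OF U], rule linear_add[OF linear_second_dir_deriv[OF U(1) _ W]])
  then show "dir_deriv r (dir_deriv q (dir_deriv (p + p') W)) y
      = dir_deriv r (dir_deriv q (dir_deriv p W)) y + dir_deriv r (dir_deriv q (dir_deriv p' W)) y"
    by (simp add: dir_deriv_add d)
  have "dir_deriv r (dir_deriv q (dir_deriv (c *\<^sub>R p) W)) y
      = dir_deriv r (\<lambda>z. c *\<^sub>R dir_deriv q (dir_deriv p W) z) y"
    by (rule dir_deriv_cong[OF U], rule linear_cmul[OF linear_second_dir_deriv[OF U(1) _ W]])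
  then show "dir_deriv r (dir_deriv q (dir_deriv (c *\<^sub>R p) W)) y
      = c *\<^sub>R dir_deriv r (dir_deriv q (dir_deriv p W)) y"
    by (simp add: dir_deriv_bounded_linear[OF bounded_linear_scaleR_right] d)
qed

lemma linear_eq_0_stdbasis:
  fixes h :: "'a::euclidean_space \<Rightarrow> real"
  assumes "linear h" "\<And>b. b \<in> Basis \<Longrightarrow> h b = 0"
  shows "h x = 0"
  using linear_eq_stdbasis[OF assms(1) linear_zero] assms(2) by (metis)

text \<open>This permits replacing the spray coefficients by Z, which differs from them by the
  quadratic spray of the connection.\<close>

lemma third_dir_deriv_diff_quadratic:
  fixes G :: "'a::euclidean_space \<Rightarrow> 'b::euclidean_space"
  assumes G: "smooth_on (- {0}) G" and R: "bilinear R" and y: "y \<noteq> 0"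
  shows "dir_deriv r (dir_deriv q (dir_deriv p (\<lambda>y. G y - R y y))) y = dir_deriv r (dir_deriv q (dir_deriv p G)) y"
proof -
  have op: "open (- {0::'a})" by auto
  have dG: "G differentiable (at z)" "dir_deriv p G differentiable (at z)"
    "dir_deriv q (dir_deriv p G) differentiable (at z)" if "z \<noteq> 0" for p q z
    using smooth_on_imp_differentiable[of "- {0}"] G smooth_on_dir_deriv that by blast+
  have bR: "bounded_bilinear R" using R bilinear_conv_bounded_bilinear by blast
  have D1: "((\<lambda>y. R y y) has_derivative (\<lambda>p. R z p + R p z)) (at z)" for z
    using bounded_bilinear.FDERIV[OF bR has_derivative_ident has_derivative_ident] .
  have "bounded_linear (\<lambda>z. R z p + R p z)" for p
    using R by (simp add: bilinear_def linear_conv_bounded_linear bounded_linear_add)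
  then have D2: "((\<lambda>z. R z p + R p z) has_derivative (\<lambda>q. R q p + R p q)) (at z)" for p z
    by (rule bounded_linear_imp_has_derivative)
  have 1: "dir_deriv p (\<lambda>y. G y - R y y) z = dir_deriv p G z - (R z p + R p z)" if "z \<noteq> 0" for z
    using dir_deriv_diff[OF dG(1)[OF that] differentiableI[OF D1]] dir_deriv_eq[OF D1] by simp
  have 2: "dir_deriv q (dir_deriv p (\<lambda>y. G y - R y y)) z = dir_deriv q (dir_deriv p G) z - (R q p + R p q)"
    if "z \<noteq> 0" for z
  proof -
    have "dir_deriv q (dir_deriv p (\<lambda>y. G y - R y y)) z = dir_deriv q (\<lambda>z. dir_deriv p G z - (R z p + R p z)) z"
      by (rule dir_deriv_cong[OF op]) (use 1 that in auto)
    then show ?thesis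
      using dir_deriv_diff[OF dG(2)[OF that] differentiableI[OF D2]] dir_deriv_eq[OF D2] by simp
  qed
  have "dir_deriv r (dir_deriv q (dir_deriv p (\<lambda>y. G y - R y y))) y
      = dir_deriv r (\<lambda>z. dir_deriv q (dir_deriv p G) z - (R q p + R p q)) y"
    by (rule dir_deriv_cong[OF op]) (use 2 y in auto)
  also have "\<dots> = dir_deriv r (dir_deriv q (dir_deriv p G)) y"
    by (rule dir_deriv_eq) (use has_derivative_dir_deriv[OF dG(3)[OF y]] in \<open>auto intro!: derivative_eq_intros\<close>)
  finally show ?thesis .
qed

context alpha12_norm
begin

lemma dE_basis:
  assumes "y \<noteq> 0"
  shows "dir_deriv \<xi> E y = (\<Sum>i\<in>Basis. (\<xi> \<bullet> i) * dir_deriv i E y)"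
proof -
  have "dir_deriv (\<Sum>i\<in>Basis. (\<xi> \<bullet> i) *\<^sub>R i) E y = (\<Sum>i\<in>Basis. (\<xi> \<bullet> i) * dir_deriv i E y)"
    by (simp add: linear_sum[OF linear_dir_deriv[OF E_diff[OF assms]]] dE_lin[OF assms] o_def)
  then show ?thesis by (simp add: euclidean_representation)
qed

lemma smooth_on_dE_linear:
  assumes "linear \<phi>"
  shows "smooth_on (- {0}) (\<lambda>y. dir_deriv (\<phi> y) E y)"
proof -
  have "smooth_on (- {0}) (\<lambda>y. \<Sum>i\<in>Basis. (\<phi> y \<bullet> i) * dir_deriv i E y)"
    using assms
    by (intro smooth_on_sum smooth_on_mult open_dom dE_smooth smooth_on_bounded_linear
        bounded_linear_inner_left_comp) (simp add: linear_conv_bounded_linear)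
  then show ?thesis by (rule smooth_on_cong[OF open_dom, THEN iffD2, rotated]) (simp add: dE_basis)
qed

text \<open>The product rule when the direction varies linearly with the base point. With the
  connection as \<phi> it yields the mixed derivatives of the squared norm in x and y.\<close>

lemma dir_deriv_dE_linear:
  assumes \<phi>: "linear \<phi>" and y: "y \<noteq> 0"
  shows "dir_deriv l (\<lambda>y. dir_deriv (\<phi> y) E y) y = dir_deriv l (dir_deriv (\<phi> y) E) y + dir_deriv (\<phi> l) E y"
proof -
  let ?h = "\<lambda>y. dir_deriv (\<phi> y) E y"
  have "?h differentiable (at y)"
    using smooth_on_imp_differentiable[OF smooth_on_dE_linear[OF \<phi>]] y by simp
  then have 1: "((\<lambda>t. ?h (y + t *\<^sub>R l)) has_real_derivative dir_deriv l ?h y) (at 0)"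
    using dir_deriv_line[of ?h y 0 l] by (simp add: has_real_derivative_iff_has_vector_derivative)
  have "open ((\<lambda>t. y + t *\<^sub>R l) -` (- {0}))"
    by (intro open_vimage open_dom continuous_intros)
  moreover have "?h (y + t *\<^sub>R l) = dir_deriv (\<phi> y) E (y + t *\<^sub>R l) + t * dir_deriv (\<phi> l) E (y + t *\<^sub>R l)"
    if "t \<in> (\<lambda>t. y + t *\<^sub>R l) -` (- {0})" for t
    using that by (simp add: linear_add[OF \<phi>] linear_cmul[OF \<phi>] dE_lin)
  ultimately have 2: "((\<lambda>t. dir_deriv (\<phi> y) E (y + t *\<^sub>R l) + t * dir_deriv (\<phi> l) E (y + t *\<^sub>R l))
      has_real_derivative dir_deriv l ?h y) (at 0)"
    using y by (intro has_field_derivative_transform_within_open[OF 1]) auto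
  have "((\<lambda>t. dir_deriv (\<phi> y) E (y + t *\<^sub>R l) + t * dir_deriv (\<phi> l) E (y + t *\<^sub>R l))
      has_real_derivative dir_deriv l (dir_deriv (\<phi> y) E) y + dir_deriv (\<phi> l) E y) (at 0)"
    using DERIV_add[OF dE_line[of y 0 l "\<phi> y"] DERIV_mult[OF DERIV_ident dE_line[of y 0 l "\<phi> l"]]] y
    by (simp add: add.commute)
  with 2 show ?thesis by (rule DERIV_unique)
qed

end

text \<open>\<open>A x\<close> and \<open>B x\<close> are the Gram matrices of the two partial metrics, and \<open>P\<close> is the matrix of the
  projection at the single point \<open>x\<close>.\<close>

locale alpha12_local =
  fixes f :: "real^'n::finite \<Rightarrow> real^'n \<Rightarrow> real" and S :: "(real^'n) set" and x :: "real^'n"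
    and A B :: "real^'n \<Rightarrow> real^'n^'n" and P :: "real^'n^'n"
  assumes open_S: "open S" and x: "x \<in> S"
    and f_smooth: "smooth_on (S \<times> (- {0})) (\<lambda>(x, y). f x y)"
    and f_norm: "minkowski_norm (f x)"
    and f_dep: "\<And>x' x'' y z. x' \<in> S \<Longrightarrow> x'' \<in> S \<Longrightarrow> y \<bullet> (A x' *v y) = z \<bullet> (A x'' *v z) \<Longrightarrow>
      y \<bullet> (B x' *v y) = z \<bullet> (B x'' *v z) \<Longrightarrow> f x' y = f x'' z"
    and A_sym: "\<And>x' y z. x' \<in> S \<Longrightarrow> y \<bullet> (A x' *v z) = z \<bullet> (A x' *v y)"
    and B_sym: "\<And>x' y z. x' \<in> S \<Longrightarrow> y \<bullet> (B x' *v z) = z \<bullet> (B x' *v y)"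
    and A_psd: "\<And>x' y. x' \<in> S \<Longrightarrow> y \<bullet> (A x' *v y) \<ge> 0"
    and B_psd: "\<And>x' y. x' \<in> S \<Longrightarrow> y \<bullet> (B x' *v y) \<ge> 0"
    and A_diff: "A differentiable (at x)" and B_diff: "B differentiable (at x)"
    and P_idem: "\<And>y. P *v (P *v y) = P *v y"
    and A_P: "\<And>y. A x *v (P *v y) = A x *v y" and B_P: "\<And>y. B x *v (P *v y) = 0"
    and A_pos: "\<And>y. P *v y \<noteq> 0 \<Longrightarrow> y \<bullet> (A x *v y) > 0"
    and B_pos: "\<And>y. P *v y \<noteq> y \<Longrightarrow> y \<bullet> (B x *v y) > 0"
    and P_nontriv: "\<exists>y. P *v y \<noteq> 0" "\<exists>y. P *v y \<noteq> y"
begin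

definition E :: "real^'n \<Rightarrow> real" where "E y = (f x y)\<^sup>2"

lemma E_smooth: "smooth_on (- {0}) E"
  using f_norm unfolding E_def[abs_def] minkowski_norm_def Compl_eq_Diff_UNIV[symmetric]
  by (intro smooth_on_power2) auto

lemma half_hessian_inner:
  assumes "y \<noteq> 0"
  shows "w \<bullet> (half_hessian_sq (f x) y *v z) = dir_deriv z (dir_deriv w E) y / 2"
proof -
  have d: "dir_deriv i E differentiable (at y)" for i
    using smooth_on_imp_differentiable[OF smooth_on_dir_deriv[OF E_smooth]] assms by simp
  have lin2: "linear (\<lambda>w. dir_deriv z (dir_deriv w E) y)" for z
    using linear_second_dir_deriv[OF _ _ E_smooth] assms by auto
  have 1: "dir_deriv z (dir_deriv (axis i 1) E) y
      = (\<Sum>j\<in>UNIV. z $ j * dir_deriv (axis j 1) (dir_deriv (axis i 1) E) y)" for i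
  proof -
    have "dir_deriv z (dir_deriv (axis i 1) E) y
        = dir_deriv (\<Sum>j\<in>UNIV. z $ j *\<^sub>R axis j 1) (dir_deriv (axis i 1) E) y"
      by (simp add: basis_expansion[of z, unfolded scalar_mult_eq_scaleR])
    then show ?thesis
      by (simp add: linear_sum[OF linear_dir_deriv[OF d]] linear_cmul[OF linear_dir_deriv[OF d]] o_def)
  qed
  have "dir_deriv z (dir_deriv w E) y = dir_deriv z (dir_deriv (\<Sum>i\<in>UNIV. w $ i *\<^sub>R axis i 1) E) y"
    by (simp add: basis_expansion[of w, unfolded scalar_mult_eq_scaleR])
  also have "\<dots> = (\<Sum>i\<in>UNIV. w $ i * dir_deriv z (dir_deriv (axis i 1) E) y)"
    by (simp add: linear_sum[OF lin2] linear_cmul[OF lin2] o_def)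
  finally have "dir_deriv z (dir_deriv w E) y
      = (\<Sum>i\<in>UNIV. w $ i * (\<Sum>j\<in>UNIV. z $ j * dir_deriv (axis j 1) (dir_deriv (axis i 1) E) y))"
    by (simp only: 1)
  then have "(\<Sum>i\<in>UNIV. w $ i * (\<Sum>j\<in>UNIV. z $ j * (dir_deriv (axis j 1) (dir_deriv (axis i 1) E) y / 2)))
      = dir_deriv z (dir_deriv w E) y / 2"
    by (simp add: sum_divide_distrib[symmetric])
  moreover have "dir_deriv (axis j 1) (dir_deriv (axis i 1) E) y / 2 = half_hessian_sq (f x) y $ i $ j" for i j
    by (simp add: half_hessian_sq_def partial_def[abs_def] dir_deriv_def[abs_def] E_def[abs_def])
  ultimately have "(\<Sum>i\<in>UNIV. w $ i * (\<Sum>j\<in>UNIV. z $ j * half_hessian_sq (f x) y $ i $ j))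
      = dir_deriv z (dir_deriv w E) y / 2"
    by (simp only:)
  then show ?thesis
    by (simp add: inner_vec_def matrix_vector_mult_def mult.commute)
qed

sublocale N: alpha12_norm E "\<lambda>y z. y \<bullet> (A x *v z)" "\<lambda>y z. y \<bullet> (B x *v z)" "\<lambda>y. P *v y"
proof (rule alpha12_norm.intro)
  show "smooth_on (- {0}) E" by (rule E_smooth)
  show "E y > 0" if "y \<noteq> 0" for y using f_norm that by (simp add: E_def minkowski_norm_def)
  show "E (r *\<^sub>R y) = r\<^sup>2 * E y" if "r > 0" for r y
    using f_norm that by (simp add: E_def minkowski_norm_def power_mult_distrib)
  show "dir_deriv w (dir_deriv w E) y > 0" if "y \<noteq> 0" "w \<noteq> 0" for y w
  proof -
    have "w \<bullet> (half_hessian_sq (f x) y *v w) > 0" using f_norm that unfolding minkowski_norm_def by blast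
    then show ?thesis by (simp add: half_hessian_inner[OF that(1)])
  qed
  show "E y = E z" if "y \<bullet> (A x *v y) = z \<bullet> (A x *v z)" "y \<bullet> (B x *v y) = z \<bullet> (B x *v z)" for y z
    using f_dep[OF x x that] by (simp add: E_def)
  show "bilinear (\<lambda>y z. y \<bullet> (A x *v z))" "bilinear (\<lambda>y z. y \<bullet> (B x *v z))"
    by (auto simp: bilinear_def inner_left_distrib inner_right_distrib matrix_vector_right_distrib
        matrix_vector_mult_scaleR intro!: linearI)
  show "(P *v y) \<bullet> (A x *v z) = y \<bullet> (A x *v z)" for y z
    using A_sym[OF x, of "P *v y" z] A_sym[OF x, of y z] by (simp add: A_P)
  show "(P *v y) \<bullet> (B x *v z) = 0" for y z
    using B_sym[OF x, of "P *v y" z] by (simp add: B_P)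
  show "linear (\<lambda>y. P *v y)" by (rule matrix_vector_mul_linear)
qed (fact A_sym[OF x] B_sym[OF x] P_idem A_pos B_pos P_nontriv)+

end

lemma bounded_linear_matrix_form: "bounded_linear (\<lambda>N :: real^'n^'m. y \<bullet> (N *v z))"
  by (simp add: linear_conv_bounded_linear[symmetric] linear_iff matrix_vector_mult_add_rdistrib
      inner_right_distrib scaleR_matrix_vector_assoc[symmetric])

lemma line_preimage_ball:
  fixes x e :: "'a::real_normed_vector"
  assumes "open S" "x \<in> S"
  obtains d where "d > 0" "\<And>t. \<bar>t\<bar> < d \<Longrightarrow> x + t *\<^sub>R e \<in> S"
proof -
  have "open ((\<lambda>t. x + t *\<^sub>R e) -` S)" by (intro open_vimage assms(1) continuous_intros)
  moreover have "0 \<in> (\<lambda>t. x + t *\<^sub>R e) -` S" using assms(2) by simp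
  ultimately obtain d where "d > 0" "ball 0 d \<subseteq> (\<lambda>t. x + t *\<^sub>R e) -` S" by (rule openE)
  then show thesis using that[of d] by (auto simp: subset_iff dist_real_def)
qed

lemma matrix_form_line:
  fixes N :: "real^'n::finite \<Rightarrow> real^'n^'n"
  assumes "N differentiable (at x)"
  shows "((\<lambda>t. y \<bullet> (N (x + t *\<^sub>R e) *v z)) has_real_derivative y \<bullet> (dir_deriv e N x *v z)) (at 0)"
  using bounded_linear.has_vector_derivative[OF bounded_linear_matrix_form dir_deriv_line[of N x 0 e]] assms
  by (simp add: has_real_derivative_iff_has_vector_derivative)

text \<open>In the second part \<open>v\<close> lies in the kernel of \<open>N x\<close>, so along
  the line through \<open>x\<close> the nonnegative function with values
  \<open>v \<bullet> (N x' *v v)\<close> has a minimum at \<open>x\<close>.\<close>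

lemma dir_deriv_psd_family:
  fixes N :: "real^'n::finite \<Rightarrow> real^'n^'n"
  assumes S: "open S" "x \<in> S" and N: "N differentiable (at x)"
  shows "(\<And>x' y z. x' \<in> S \<Longrightarrow> y \<bullet> (N x' *v z) = z \<bullet> (N x' *v y)) \<Longrightarrow>
      y \<bullet> (dir_deriv e N x *v z) = z \<bullet> (dir_deriv e N x *v y)"
    and "(\<And>x' y. x' \<in> S \<Longrightarrow> y \<bullet> (N x' *v y) \<ge> 0) \<Longrightarrow> N x *v v = 0 \<Longrightarrow> v \<bullet> (dir_deriv e N x *v v) = 0"
proof -
  obtain d where d: "d > 0" "\<And>t. \<bar>t\<bar> < d \<Longrightarrow> x + t *\<^sub>R e \<in> S"
    using line_preimage_ball[OF S] by blast
  show "y \<bullet> (dir_deriv e N x *v z) = z \<bullet> (dir_deriv e N x *v y)"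
    if sym: "\<And>x' y z. x' \<in> S \<Longrightarrow> y \<bullet> (N x' *v z) = z \<bullet> (N x' *v y)"
  proof (rule DERIV_unique[OF matrix_form_line[OF N]])
    show "((\<lambda>t. y \<bullet> (N (x + t *\<^sub>R e) *v z)) has_real_derivative z \<bullet> (dir_deriv e N x *v y)) (at 0)"
    proof (rule has_field_derivative_transform_within_open[OF matrix_form_line[OF N]])
      show "open (ball 0 d)" "0 \<in> ball 0 d" using d(1) by auto
      show "z \<bullet> (N (x + t *\<^sub>R e) *v y) = y \<bullet> (N (x + t *\<^sub>R e) *v z)" if "t \<in> ball 0 d" for t
        by (rule sym, rule d(2)) (use that in \<open>simp add: dist_real_def\<close>)
    qed
  qed
  show "v \<bullet> (dir_deriv e N x *v v) = 0"
    if psd: "\<And>x' y. x' \<in> S \<Longrightarrow> y \<bullet> (N x' *v y) \<ge> 0" and ker: "N x *v v = 0"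
  proof (rule DERIV_local_min[OF matrix_form_line[OF N] d(1)], intro allI impI)
    fix t assume "\<bar>0 - t\<bar> < d"
    then show "v \<bullet> (N (x + 0 *\<^sub>R e) *v v) \<le> v \<bullet> (N (x + t *\<^sub>R e) *v v)"
      using psd[OF d(2)[of t], of v] ker by simp
  qed
qed

lemma posdef_det_nz:
  fixes M :: "real^'n::finite^'n"
  assumes "\<And>y. y \<noteq> 0 \<Longrightarrow> y \<bullet> (M *v y) > 0"
  shows "det M \<noteq> 0"
proof -
  have "y = 0" if "M *v y = 0" for y using assms[of y] that by force
  then have "\<exists>N. N ** M = mat 1" by (simp add: matrix_left_invertible_ker)
  then show ?thesis using invertible_left_inverse invertible_det_nz by blast
qed

lemma matrix_inv_vector:
  fixes M :: "real^'n::finite^'n"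
  assumes "det M \<noteq> 0"
  shows "M *v (matrix_inv M *v y) = y"
  by (simp add: matrix_vector_mul_assoc matrix_inv_mult_eq_1[OF assms])

section \<open>A connection that preserves both partial metrics\<close>

context alpha12_local
begin

text \<open>The connection \<open>Gam\<close> preserves both partial metrics at \<open>x\<close>; this determines its \<open>\<V>\<^sub>1\<close> component
  up to a skew part, and the derivative of \<open>A\<close> vanishes on the kernel of \<open>A\<close>, where \<open>A\<close> is minimal.\<close>

definition dA :: "real^'n \<Rightarrow> real^'n^'n" where "dA e = dir_deriv e A x"
definition dB :: "real^'n \<Rightarrow> real^'n^'n" where "dB e = dir_deriv e B x"

text \<open>The Gram matrix of the whole metric at \<open>x\<close>. Unlike its two degenerate
  summands it is invertible, so it can convert a linear form into a vector.\<close>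

definition M :: "real^'n^'n" where "M = A x + B x"

definition Gam :: "real^'n \<Rightarrow> real^'n \<Rightarrow> real^'n"
  where "Gam e y = P *v (matrix_inv M *v (dA e *v (y - (1/2) *\<^sub>R (P *v y))))
    + (matrix_inv M *v (dB e *v ((1/2) *\<^sub>R (y + P *v y)))
      - P *v (matrix_inv M *v (dB e *v ((1/2) *\<^sub>R (y + P *v y)))))"

lemma det_M: "det M \<noteq> 0"
proof (rule posdef_det_nz)
  fix y :: "real^'n"
  assume "y \<noteq> 0"
  then have "y \<bullet> (A x *v y) > 0 \<or> y \<bullet> (B x *v y) > 0"
    using A_pos[of y] B_pos[of y] by metis
  then show "y \<bullet> (M *v y) > 0"
    using A_psd[OF x, of y] B_psd[OF x, of y]
    by (auto simp: M_def matrix_vector_mult_add_rdistrib inner_right_distrib)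
qed

lemma A_P_form: "y \<bullet> (A x *v w) = (P *v y) \<bullet> (M *v w)"
  using A_sym[OF x, of "P *v y" w] B_sym[OF x, of "P *v y" w] A_sym[OF x, of y w]
  by (simp add: M_def matrix_vector_mult_add_rdistrib inner_right_distrib A_P B_P)

lemma B_P_form: "y \<bullet> (B x *v w) = (y - P *v y) \<bullet> (M *v w)"
proof -
  have "y \<bullet> (M *v w) = y \<bullet> (A x *v w) + y \<bullet> (B x *v w)"
    by (simp add: M_def matrix_vector_mult_add_rdistrib inner_right_distrib)
  then show ?thesis by (simp add: inner_diff_left A_P_form[symmetric])
qed

lemma dA_sym: "y \<bullet> (dA e *v z) = z \<bullet> (dA e *v y)"
  unfolding dA_def using dir_deriv_psd_family(1)[OF open_S x A_diff] A_sym by blast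

lemma dB_sym: "y \<bullet> (dB e *v z) = z \<bullet> (dB e *v y)"
  unfolding dB_def using dir_deriv_psd_family(1)[OF open_S x B_diff] B_sym by blast

lemma dA_kernel: assumes "P *v v = 0" shows "v \<bullet> (dA e *v v) = 0"
  unfolding dA_def using dir_deriv_psd_family(2)[OF open_S x A_diff] A_psd A_P[of v] assms
  by (metis matrix_vector_mult_0_right)

lemma dB_range: assumes "P *v u = u" shows "u \<bullet> (dB e *v u) = 0"
  unfolding dB_def using dir_deriv_psd_family(2)[OF open_S x B_diff] B_psd B_P[of u] assms by metis

lemma P_linear:
  "P *v (y - P *v y) = 0" "P *v (P *v y) = P *v y"
  by (simp_all add: matrix_vector_mult_diff_distrib P_idem)

text \<open>For \<open>y = u + v\<close> the term \<open>v \<bullet> (dA e *v v)\<close> vanishes,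
  so half of the quadratic form of \<open>dA e\<close> at \<open>y\<close> is \<open>dA e\<close>
  paired with \<open>u\<close> and \<open>u / 2 + v\<close>. This is the origin of the factor 1/2 in
  front of \<open>P *v y\<close> alone; in \<open>B_Gam\<close> the roles of \<open>u\<close> and
  \<open>v\<close> are exchanged.\<close>

lemma A_Gam: "y \<bullet> (A x *v Gam e y) = y \<bullet> (dA e *v y) / 2"
proof -
  define u v where "u = P *v y" and "v = y - P *v y"
  have y: "y = u + v" by (simp add: u_def v_def)
  have Pv: "P *v v = 0" by (simp add: v_def P_linear)
  have "y \<bullet> (A x *v Gam e y) = y \<bullet> (A x *v (matrix_inv M *v (dA e *v (y - (1/2) *\<^sub>R u))))"
    by (simp add: Gam_def matrix_vector_right_distrib matrix_vector_mult_diff_distrib A_P u_def)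
  also have "\<dots> = u \<bullet> (dA e *v (y - (1/2) *\<^sub>R u))"
    by (simp add: A_P_form matrix_inv_vector[OF det_M] u_def)
  also have "y - (1/2) *\<^sub>R u = (1/2) *\<^sub>R u + v" by (simp add: y vec_eq_iff field_simps)
  also have "u \<bullet> (dA e *v ((1/2) *\<^sub>R u + v)) = u \<bullet> (dA e *v u) / 2 + u \<bullet> (dA e *v v)"
    by (simp add: matrix_vector_right_distrib matrix_vector_mult_scaleR inner_right_distrib)
  also have "\<dots> = y \<bullet> (dA e *v y) / 2"
    using dA_kernel[OF Pv, of e] dA_sym[of v e u]
    by (simp add: y matrix_vector_right_distrib inner_right_distrib inner_left_distrib)
  finally show ?thesis .
qed

lemma B_Gam: "y \<bullet> (B x *v Gam e y) = y \<bullet> (dB e *v y) / 2"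
proof -
  define u v where "u = P *v y" and "v = y - P *v y"
  have y: "y = u + v" by (simp add: u_def v_def)
  have Pu: "P *v u = u" by (simp add: u_def P_linear)
  have "y \<bullet> (B x *v Gam e y) = y \<bullet> (B x *v (matrix_inv M *v (dB e *v ((1/2) *\<^sub>R (y + u)))))"
    by (simp add: Gam_def matrix_vector_right_distrib matrix_vector_mult_diff_distrib B_P u_def)
  also have "\<dots> = v \<bullet> (dB e *v ((1/2) *\<^sub>R (y + u)))"
    by (simp add: B_P_form matrix_inv_vector[OF det_M] v_def)
  also have "(1/2) *\<^sub>R (y + u) = (1/2) *\<^sub>R v + u" by (simp add: y vec_eq_iff field_simps)
  also have "v \<bullet> (dB e *v ((1/2) *\<^sub>R v + u)) = v \<bullet> (dB e *v v) / 2 + v \<bullet> (dB e *v u)"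
    by (simp add: matrix_vector_right_distrib matrix_vector_mult_scaleR inner_right_distrib)
  also have "\<dots> = y \<bullet> (dB e *v y) / 2"
    using dB_range[OF Pu, of e] dB_sym[of v e u]
    by (simp add: y matrix_vector_right_distrib inner_right_distrib inner_left_distrib)
  finally show ?thesis .
qed

lemma Gam_bilinear: "bilinear Gam"
proof -
  have "linear dA" "linear dB"
    unfolding dA_def[abs_def] dB_def[abs_def] by (rule linear_dir_deriv A_diff B_diff)+
  then have 1: "dA (e + e') = dA e + dA e'" "dB (e + e') = dB e + dB e'"
      "dA (c *\<^sub>R e) = c *\<^sub>R dA e" "dB (c *\<^sub>R e) = c *\<^sub>R dB e" for e e' c
    by (simp_all add: linear_add linear_cmul)
  show ?thesis
    unfolding bilinear_def Gam_def
    by (intro conjI allI linearI)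
      (simp_all add: 1 matrix_vector_mult_add_rdistrib matrix_vector_right_distrib matrix_vector_mult_scaleR
        matrix_vector_mult_diff_distrib scaleR_matrix_vector_assoc[symmetric] algebra_simps)
qed

section \<open>The derivative in x expressed by the connection\<close>

lemma f_sq_smooth: "smooth_on (S \<times> (- {0})) (\<lambda>(x, y). (f x y)\<^sup>2)"
proof -
  have "open (S \<times> (- {0 :: real^'n}))" by (intro open_Times open_S) auto
  from smooth_on_power2[OF this f_smooth] show ?thesis by (simp add: case_prod_unfold)
qed

text \<open>As a derivative of a jointly smooth function, the derivative in x is continuous in
  \<open>y\<close>, which the limit argument in \<open>dE_Gam\<close> requires.\<close>

lemma f_sq_slice:
  assumes "y \<noteq> 0"
  shows "(\<lambda>x'. (f x' y)\<^sup>2) differentiable (at x)"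
    and "dir_deriv e (\<lambda>x'. (f x' y)\<^sup>2) x = dir_deriv (e, 0) (\<lambda>(x, y). (f x y)\<^sup>2) (x, y)"
proof -
  have 1: "((\<lambda>x'. (x', y)) has_derivative (\<lambda>h. (h, 0))) (at x)"
    by (auto intro!: derivative_eq_intros)
  have "(\<lambda>(x, y). (f x y)\<^sup>2) differentiable (at (x, y))"
    using smooth_on_imp_differentiable[OF f_sq_smooth] x assms by simp
  from has_derivative_compose[OF 1 has_derivative_dir_deriv[OF this]]
  have 2: "((\<lambda>x'. (f x' y)\<^sup>2) has_derivative (\<lambda>h. dir_deriv (h, 0) (\<lambda>(x, y). (f x y)\<^sup>2) (x, y))) (at x)"
    by simp
  show "(\<lambda>x'. (f x' y)\<^sup>2) differentiable (at x)" using 2 by (rule differentiableI)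
  show "dir_deriv e (\<lambda>x'. (f x' y)\<^sup>2) x = dir_deriv (e, 0) (\<lambda>(x, y). (f x y)\<^sup>2) (x, y)"
    by (rule dir_deriv_eq[OF 2])
qed

text \<open>A change of the base point alters F only through the two partial lengths of
  \<open>y\<close>, and the same change of lengths is produced at \<open>x\<close> by rescaling the
  two components of \<open>y\<close>. The velocity of this rescaling and \<open>Gam e y\<close>
  agree in their two radial components, the only ones seen by the differential of E.\<close>

lemma dE_Gam_generic:
  assumes y: "P *v y \<noteq> 0" "P *v y \<noteq> y"
  shows "dir_deriv e (\<lambda>x'. (f x' y)\<^sup>2) x = dir_deriv (Gam e y) E y"
proof -
  define u v where "u = P *v y" and "v = y - P *v y"
  have y0: "y \<noteq> 0" using y by (metis matrix_vector_mult_0_right)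
  define s where "s t = y \<bullet> (A (x + t *\<^sub>R e) *v y)" for t
  define s' where "s' t = y \<bullet> (B (x + t *\<^sub>R e) *v y)" for t
  have s0: "s 0 > 0" "s' 0 > 0" using A_pos B_pos y by (simp_all add: s_def s'_def)
  have ds: "(s has_real_derivative y \<bullet> (dA e *v y)) (at 0)" "(s' has_real_derivative y \<bullet> (dB e *v y)) (at 0)"
    unfolding s_def[abs_def] s'_def[abs_def] dA_def dB_def by (rule matrix_form_line A_diff B_diff)+
  define a where "a = y \<bullet> (dA e *v y) / (2 * s 0)"
  define b where "b = y \<bullet> (dB e *v y) / (2 * s' 0)"
  have dsq: "((\<lambda>t. sqrt (s t / s 0)) has_real_derivative a) (at 0)"
      "((\<lambda>t. sqrt (s' t / s' 0)) has_real_derivative b) (at 0)"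
    using s0 by (auto intro!: derivative_eq_intros ds simp: a_def b_def field_simps)
  \<comment> \<open>At \<open>x\<close> the vector \<open>W t\<close> has the partial lengths that
    \<open>y\<close> has at \<open>x + t *\<^sub>R e\<close>.\<close>
  define W where "W t = sqrt (s t / s 0) *\<^sub>R u + sqrt (s' t / s' 0) *\<^sub>R v" for t
  have W0: "W 0 = y" using s0 by (simp add: W_def u_def v_def)
  have "(W has_vector_derivative a *\<^sub>R u + b *\<^sub>R v) (at 0)"
    unfolding W_def[abs_def]
    using has_vector_derivative_add[OF has_vector_derivative_scaleR[OF dsq(1) has_vector_derivative_const]
        has_vector_derivative_scaleR[OF dsq(2) has_vector_derivative_const]] by simp
  then have dW: "(W has_derivative (\<lambda>h. h *\<^sub>R (a *\<^sub>R u + b *\<^sub>R v))) (at 0)"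
    by (simp add: has_vector_derivative_def)
  have "((\<lambda>t. E (W t)) has_derivative (\<lambda>h. dir_deriv (h *\<^sub>R (a *\<^sub>R u + b *\<^sub>R v)) E y)) (at 0)"
    using has_derivative_compose[OF dW, of E "\<lambda>\<xi>. dir_deriv \<xi> E y"] has_derivative_dir_deriv[OF N.E_diff[OF y0]]
    by (simp add: W0)
  then have dEW: "((\<lambda>t. E (W t)) has_real_derivative dir_deriv (a *\<^sub>R u + b *\<^sub>R v) E y) (at 0)"
    using N.dE_lin(3)[OF y0] by (simp add: has_field_derivative_def mult_commute_abs)
  obtain d where d: "d > 0" "\<And>t. \<bar>t\<bar> < d \<Longrightarrow> x + t *\<^sub>R e \<in> S"
    using line_preimage_ball[OF open_S x] by blast
  have "((\<lambda>t. (f (x + t *\<^sub>R e) y)\<^sup>2) has_real_derivative dir_deriv (a *\<^sub>R u + b *\<^sub>R v) E y) (at 0)"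
  proof (rule has_field_derivative_transform_within_open[OF dEW])
    show "open (ball 0 d)" "0 \<in> ball 0 d" using d(1) by auto
    show "E (W t) = (f (x + t *\<^sub>R e) y)\<^sup>2" if "t \<in> ball 0 d" for t
    proof -
      have S: "x + t *\<^sub>R e \<in> S" using d(2) that by (simp add: dist_real_def)
      have nn: "s t \<ge> 0" "s' t \<ge> 0" using A_psd[OF S] B_psd[OF S] by (simp_all add: s_def s'_def)
      have Pu: "P *v u = u" "P *v v = 0" by (simp_all add: u_def v_def P_linear)
      have uu: "u \<bullet> (A x *v u) = s 0" "v \<bullet> (B x *v v) = s' 0"
        using N.A_P[of y "P *v y"] N.A_P'[of y y] N.B_P[of y] N.B_P'[of y y]
        by (simp_all add: s_def s'_def u_def v_def matrix_vector_mult_diff_distrib inner_diff_left inner_diff_right A_P B_P)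
      have "(p *\<^sub>R u + q *\<^sub>R v) \<bullet> (A x *v (p *\<^sub>R u + q *\<^sub>R v)) = p\<^sup>2 * (u \<bullet> (A x *v u))" for p q
        using N.A_kernel[OF Pu(2)]
        by (simp add: matrix_vector_right_distrib matrix_vector_mult_scaleR inner_left_distrib
            inner_right_distrib power2_eq_square)
      then have 1: "W t \<bullet> (A x *v W t) = y \<bullet> (A (x + t *\<^sub>R e) *v y)"
        using nn s0 uu unfolding W_def s_def[symmetric] by simp
      have "(p *\<^sub>R u + q *\<^sub>R v) \<bullet> (B x *v (p *\<^sub>R u + q *\<^sub>R v)) = q\<^sup>2 * (v \<bullet> (B x *v v))" for p q
        using N.B_range[OF Pu(1)]
        by (simp add: matrix_vector_right_distrib matrix_vector_mult_scaleR inner_left_distrib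
            inner_right_distrib power2_eq_square)
      then have 2: "W t \<bullet> (B x *v W t) = y \<bullet> (B (x + t *\<^sub>R e) *v y)"
        using nn s0 uu unfolding W_def s'_def[symmetric] by simp
      show ?thesis using f_dep[OF x S 1 2] by (simp add: E_def)
    qed
  qed
  moreover have "((\<lambda>t. (f (x + t *\<^sub>R e) y)\<^sup>2) has_real_derivative dir_deriv e (\<lambda>x'. (f x' y)\<^sup>2) x) (at 0)"
    using dir_deriv_line[of "\<lambda>x'. (f x' y)\<^sup>2" x 0 e] f_sq_slice(1)[OF y0]
    by (simp add: has_real_derivative_iff_has_vector_derivative)
  ultimately have "dir_deriv e (\<lambda>x'. (f x' y)\<^sup>2) x = dir_deriv (a *\<^sub>R u + b *\<^sub>R v) E y"
    using DERIV_unique by blast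
  also have "\<dots> = a * dir_deriv u E y + b * dir_deriv v E y" by (simp add: N.dE_lin[OF y0])
  also have "\<dots> = N.kA y * (y \<bullet> (dA e *v y) / 2) + N.kB y * (y \<bullet> (dB e *v y) / 2)"
    using s0 by (simp add: N.kA_def N.kB_def a_def b_def s_def s'_def u_def v_def mult.commute)
  also have "\<dots> = dir_deriv (Gam e y) E y"
    by (simp add: N.dE_eq[OF y] A_Gam B_Gam)
  finally show ?thesis .
qed

lemma dE_Gam:
  assumes y: "y \<noteq> 0"
  shows "dir_deriv e (\<lambda>x'. (f x' y)\<^sup>2) x = dir_deriv (Gam e y) E y"
proof -
  obtain w where w: "\<And>t. t > 0 \<Longrightarrow> P *v (y + t *\<^sub>R w) \<noteq> 0" "\<And>t. t > 0 \<Longrightarrow> P *v (y + t *\<^sub>R w) \<noteq> y + t *\<^sub>R w"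
    using N.generic_direction by blast
  have lin: "linear (Gam e)" using Gam_bilinear by (simp add: bilinear_def)
  let ?F = "dir_deriv (e, 0) (\<lambda>(x, y). (f x y)\<^sup>2)"
  have "?F (x, y + 0 *\<^sub>R w) = dir_deriv (Gam e (y + 0 *\<^sub>R w)) E (y + 0 *\<^sub>R w)"
  proof (rule line_ext_eq[of "\<lambda>t. ?F (x, y + t *\<^sub>R w)" "\<lambda>t. dir_deriv (Gam e (y + t *\<^sub>R w)) E (y + t *\<^sub>R w)"])
    have "?F differentiable (at (x, y + 0 *\<^sub>R w))"
      using smooth_on_imp_differentiable[OF smooth_on_dir_deriv[OF f_sq_smooth]] x y by simp
    then have "isCont ?F (x, y + 0 *\<^sub>R w)" by (rule differentiable_imp_continuous_within)
    then show "isCont (\<lambda>t. ?F (x, y + t *\<^sub>R w)) 0"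
      by (rule isCont_o2[rotated]) (intro continuous_intros)
    have "(\<lambda>y. dir_deriv (Gam e y) E y) differentiable (at y)"
      using smooth_on_imp_differentiable[OF N.smooth_on_dE_linear[OF lin]] y by simp
    then have "isCont (\<lambda>y. dir_deriv (Gam e y) E y) (y + 0 *\<^sub>R w)"
      by (simp add: differentiable_imp_continuous_within)
    then show "isCont (\<lambda>t. dir_deriv (Gam e (y + t *\<^sub>R w)) E (y + t *\<^sub>R w)) 0"
      by (rule isCont_o2[rotated]) (intro continuous_intros)
    show "?F (x, y + t *\<^sub>R w) = dir_deriv (Gam e (y + t *\<^sub>R w)) E (y + t *\<^sub>R w)" if "t > 0" for t
    proof -
      have "y + t *\<^sub>R w \<noteq> 0" using w(1)[OF that] by (metis matrix_vector_mult_0_right)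
      from f_sq_slice(2)[OF this] dE_Gam_generic[OF w(1)[OF that] w(2)[OF that]] show ?thesis by simp
    qed
  qed
  then show ?thesis using f_sq_slice(2)[OF y] by simp
qed

section \<open>The spray coefficients and their difference Z to the connection\<close>

definition rhs :: "real^'n \<Rightarrow> real^'n"
  where "rhs y = (\<chi> l. (\<Sum>k\<in>UNIV. partial_y l (partial_x k (\<lambda>x y. (f x y)\<^sup>2)) x y * y $ k)
        - partial_x l (\<lambda>x y. (f x y)\<^sup>2) x y)"

definition G :: "real^'n \<Rightarrow> real^'n"
  where "G y = (\<chi> i. spray_coeff f i x y)"

lemma partial_x_eq: "y \<noteq> 0 \<Longrightarrow> partial_x k (\<lambda>x y. (f x y)\<^sup>2) x y = dir_deriv (Gam (axis k 1) y) E y"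
  using dE_Gam by (simp add: partial_x_def partial_def dir_deriv_def)

lemma linear_Gam: "linear (Gam e)" "linear (\<lambda>e. Gam e y)"
  using Gam_bilinear by (simp_all add: bilinear_def)

lemma partial_y_x_eq:
  assumes y: "y \<noteq> 0"
  shows "partial_y l (partial_x k (\<lambda>x y. (f x y)\<^sup>2)) x y
    = dir_deriv (axis l 1) (\<lambda>y. dir_deriv (Gam (axis k 1) y) E y) y"
proof -
  have "partial_y l (partial_x k (\<lambda>x y. (f x y)\<^sup>2)) x y
      = dir_deriv (axis l 1) (partial_x k (\<lambda>x y. (f x y)\<^sup>2) x) y"
    by (simp add: partial_y_def partial_def dir_deriv_def)
  also have "\<dots> = dir_deriv (axis l 1) (\<lambda>y. dir_deriv (Gam (axis k 1) y) E y) y"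
    by (rule dir_deriv_cong[OF N.open_dom]) (use y partial_x_eq in auto)
  finally show ?thesis .
qed

text \<open>Insert \<open>dE_Gam\<close> into both terms of the spray formula. Differentiating it in
  \<open>y\<close> gives a Hessian term and a first-order term with swapped arguments of
  \<open>Gam\<close>, so the two first-order terms combine to the torsion.\<close>

lemma rhs_eq:
  assumes y: "y \<noteq> 0"
  shows "rhs y $ l = dir_deriv (Gam y y) (dir_deriv (axis l 1) E) y
    + dir_deriv (Gam y (axis l 1)) E y - dir_deriv (Gam (axis l 1) y) E y"
proof -
  have lin1: "linear (\<lambda>e. dir_deriv (Gam e y) (dir_deriv (axis l 1) E) y)"
    using linear_compose[OF linear_Gam(2) linear_dir_deriv[OF N.dE_diff[OF y]]] by (simp add: o_def)
  have lin2: "linear (\<lambda>e. dir_deriv (Gam e z) E y)" for z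
    using linear_compose[OF linear_Gam(2) linear_dir_deriv[OF N.E_diff[OF y]]] by (simp add: o_def)
  have y_sum: "h y = (\<Sum>k\<in>UNIV. h (axis k 1) * y $ k)" if "linear h" for h :: "real^'n \<Rightarrow> real"
  proof -
    have "h y = h (\<Sum>k\<in>UNIV. y $ k *\<^sub>R axis k 1)"
      by (simp add: basis_expansion[of y, unfolded scalar_mult_eq_scaleR])
    then show ?thesis by (simp add: linear_sum[OF that] linear_cmul[OF that] mult.commute)
  qed
  have "(\<Sum>k\<in>UNIV. partial_y l (partial_x k (\<lambda>x y. (f x y)\<^sup>2)) x y * y $ k)
      = (\<Sum>k\<in>UNIV. dir_deriv (Gam (axis k 1) y) (dir_deriv (axis l 1) E) y * y $ k
        + dir_deriv (Gam (axis k 1) (axis l 1)) E y * y $ k)"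
    by (simp add: partial_y_x_eq[OF y] N.dir_deriv_dE_linear[OF linear_Gam(1) y]
        N.ddE_commute[OF y, of "axis l 1"] distrib_right)
  also have "\<dots> = dir_deriv (Gam y y) (dir_deriv (axis l 1) E) y + dir_deriv (Gam y (axis l 1)) E y"
    by (simp add: sum.distrib y_sum[OF lin1] y_sum[OF lin2])
  finally show ?thesis by (simp add: rhs_def partial_x_eq[OF y])
qed

lemma det_hessian: "y \<noteq> 0 \<Longrightarrow> det (half_hessian_sq (f x) y) \<noteq> 0"
  using f_norm by (intro posdef_det_nz) (simp add: minkowski_norm_def)

lemma G_eq: "G y = matrix_inv (half_hessian_sq (f x) y) *v ((1/4) *\<^sub>R rhs y)"
  by (simp add: G_def spray_coeff_def rhs_def matrix_vector_mult_def vec_eq_iff fundamental_tensor_def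
      sum_distrib_left mult.assoc mult.left_commute)

lemma smooth_G: "smooth_on (- {0}) G"
proof -
  have hess: "smooth_on (- {0}) (\<lambda>y. half_hessian_sq (f x) y $ i $ j)" for i j
  proof -
    have eq: "(\<lambda>y. half_hessian_sq (f x) y $ i $ j) = (\<lambda>y. 1/2 * dir_deriv (axis j 1) (dir_deriv (axis i 1) E) y)"
      by (simp add: half_hessian_sq_def partial_def[abs_def] dir_deriv_def[abs_def] E_def[abs_def])
    show ?thesis unfolding eq
      by (intro smooth_on_mult N.open_dom smooth_on_const smooth_on_dir_deriv E_smooth)
  qed
  have inv: "smooth_on (- {0}) (\<lambda>y. matrix_inv (half_hessian_sq (f x) y) $ i $ j)" for i j
    by (rule smooth_on_matrix_inv[OF N.open_dom hess]) (use det_hessian in auto)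
  have rhs: "smooth_on (- {0}) (\<lambda>y. rhs y $ l)" for l
  proof -
    have "smooth_on (- {0}) (\<lambda>y. (\<Sum>k\<in>UNIV. dir_deriv (axis l 1) (\<lambda>y. dir_deriv (Gam (axis k 1) y) E y) y * y $ k)
        - dir_deriv (Gam (axis l 1) y) E y)"
      by (intro smooth_on_diff smooth_on_sum smooth_on_mult smooth_on_dir_deriv N.smooth_on_dE_linear
          linear_Gam N.open_dom smooth_on_bounded_linear bounded_linear_vec_nth)
    then show ?thesis
      by (rule smooth_on_cong[OF N.open_dom, THEN iffD2, rotated])
        (simp add: rhs_def partial_y_x_eq partial_x_eq)
  qed
  have "smooth_on (- {0}) (\<lambda>y. \<chi> i. \<Sum>l\<in>UNIV. matrix_inv (half_hessian_sq (f x) y) $ i $ l * (1/4 * rhs y $ l))"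
    by (intro smooth_on_vec_lambda smooth_on_sum smooth_on_mult inv rhs smooth_on_const N.open_dom)
  moreover have "G = (\<lambda>y. \<chi> i. \<Sum>l\<in>UNIV. matrix_inv (half_hessian_sq (f x) y) $ i $ l * (1/4 * rhs y $ l))"
    by (simp add: G_eq matrix_vector_mult_def fun_eq_iff vec_eq_iff)
  ultimately show ?thesis by simp
qed

lemma dir_deriv_G:
  assumes y: "y \<noteq> 0"
  shows "dir_deriv (G y) (dir_deriv (axis l 1) E) y = rhs y $ l / 2"
proof -
  have "dir_deriv (G y) (dir_deriv (axis l 1) E) y = 2 * (axis l 1 \<bullet> (half_hessian_sq (f x) y *v G y))"
    by (simp add: half_hessian_inner[OF y])
  also have "half_hessian_sq (f x) y *v G y = (1/4) *\<^sub>R rhs y"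
    unfolding G_eq by (rule matrix_inv_vector[OF det_hessian[OF y]])
  finally show ?thesis by (simp add: inner_axis')
qed

definition Z :: "real^'n \<Rightarrow> real^'n"
  where "Z y = G y - (1/2) *\<^sub>R Gam y y"

definition T :: "real^'n \<Rightarrow> real^'n \<Rightarrow> real^'n"
  where "T \<xi> y = (1/2) *\<^sub>R (Gam \<xi> y - Gam y \<xi>)"

lemma half_Gam_bilinear: "bilinear (\<lambda>y z. (1/2) *\<^sub>R Gam y z)"
  using Gam_bilinear unfolding bilinear_def
  by (auto intro!: linear_compose_scale_right)

text \<open>Subtracting half of \<open>Gam y y\<close> cancels the Hessian term of
  \<open>rhs_eq\<close> and leaves the torsion. Both sides are linear in \<xi>, so coordinate
  directions suffice.\<close>

lemma dir_deriv_Z: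
  assumes y: "y \<noteq> 0"
  shows "dir_deriv (Z y) (dir_deriv \<xi> E) y = - dir_deriv (T \<xi> y) E y"
proof -
  have linT: "linear (\<lambda>\<xi>. T \<xi> y)"
    unfolding T_def by (intro linear_compose_scale_right linear_compose_sub linear_Gam)
  have "linear (\<lambda>\<xi>. dir_deriv (Z y) (dir_deriv \<xi> E) y + dir_deriv (T \<xi> y) E y)"
    using linear_compose[OF linT linear_dir_deriv[OF N.E_diff[OF y]]]
      linear_second_dir_deriv[OF N.open_dom _ E_smooth] y
    by (intro linear_compose_add) (auto simp: o_def)
  moreover have "dir_deriv (Z y) (dir_deriv b E) y + dir_deriv (T b y) E y = 0" if b: "b \<in> Basis" for b
  proof -
    obtain l where l: "b = axis l 1" using b by (auto simp: Basis_vec_def)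
    show ?thesis
      unfolding l using dir_deriv_G[OF y, of l]
      by (simp add: Z_def T_def N.ddE_lin[OF y] N.dE_lin[OF y] rhs_eq[OF y] field_simps)
  qed
  ultimately have "dir_deriv (Z y) (dir_deriv \<xi> E) y + dir_deriv (T \<xi> y) E y = 0"
    by (rule linear_eq_0_stdbasis)
  then show ?thesis by simp
qed

lemma third_dir_deriv_Z_eq:
  assumes "y \<noteq> 0"
  shows "dir_deriv r (dir_deriv q (dir_deriv p Z)) y = dir_deriv r (dir_deriv q (dir_deriv p G)) y"
  unfolding Z_def[abs_def] by (rule third_dir_deriv_diff_quadratic[OF smooth_G half_Gam_bilinear assms])

lemma third_partial_spray:
  assumes y: "y \<noteq> 0"
  shows "partial_y r (partial_y q (partial_y p (spray_coeff f i))) x y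
    = dir_deriv (axis r 1) (dir_deriv (axis q 1) (dir_deriv (axis p 1) G)) y $ i"
proof -
  have comp: "dir_deriv v (\<lambda>y. W y $ i) z = dir_deriv v W z $ i" if "smooth_on (- {0}) W" "z \<noteq> 0"
    for v z and W :: "real^'n \<Rightarrow> real^'n"
    using dir_deriv_bounded_linear[OF bounded_linear_vec_nth, of W z v i]
      smooth_on_imp_differentiable[OF that(1)] that(2) by simp
  have cong: "dir_deriv v h z = dir_deriv v h' z" if "z \<noteq> 0" "\<And>z. z \<noteq> 0 \<Longrightarrow> h z = h' z"
    for v z and h h' :: "real^'n \<Rightarrow> real"
    using dir_deriv_cong[OF N.open_dom, of z h h' v] that by simp
  have p: "partial_y p g x z = dir_deriv (axis p 1) (g x) z" for p g z
    by (simp add: partial_y_def partial_def dir_deriv_def)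
  have "spray_coeff f i x = (\<lambda>y. G y $ i)" by (simp add: G_def fun_eq_iff)
  then have 1: "partial_y p (spray_coeff f i) x z = dir_deriv (axis p 1) G z $ i" if "z \<noteq> 0" for z
    using comp[OF smooth_G that] by (simp add: p)
  have 2: "partial_y q (partial_y p (spray_coeff f i)) x z = dir_deriv (axis q 1) (dir_deriv (axis p 1) G) z $ i"
    if "z \<noteq> 0" for z
    unfolding p[of q] using cong[OF that 1] comp[OF smooth_on_dir_deriv[OF smooth_G] that] by simp
  show ?thesis
    unfolding p[of r] using cong[OF y 2] comp[OF smooth_on_dir_deriv[OF smooth_on_dir_deriv[OF smooth_G]] y] by simp
qed

lemma y_fundamental_tensor:
  assumes y: "y \<noteq> 0"
  shows "(\<Sum>j\<in>UNIV. y $ j * fundamental_tensor f x y $ i $ j) = dir_deriv (axis i 1) E y / 2"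
proof -
  have "(\<Sum>j\<in>UNIV. y $ j * fundamental_tensor f x y $ i $ j) = axis i 1 \<bullet> (half_hessian_sq (f x) y *v y)"
    by (simp add: inner_axis' fundamental_tensor_def matrix_vector_mult_def mult.commute)
  then show ?thesis by (simp add: half_hessian_inner[OF y] N.euler_dE[OF y])
qed

text \<open>The Landsberg condition in coordinates concerns three basis directions. The form \<phi>
  is linear in each of its three directions, so the condition extends to \<open>w\<close>,
  \<open>w\<close>, \<open>w\<close>, as the tangent space argument uses it.\<close>

theorem landsberg_imp_berwald_at:
  assumes landsberg: "\<And>y p q r. y \<noteq> 0 \<Longrightarrow>
      (\<Sum>i\<in>UNIV. \<Sum>j\<in>UNIV. y $ j * fundamental_tensor f x y $ i $ j *
        partial_y r (partial_y q (partial_y p (spray_coeff f i))) x y) = 0"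
    and y: "y \<noteq> 0"
  shows "partial_y r (partial_y q (partial_y p (spray_coeff f i))) x y = 0"
proof -
  have Basis_axis: "\<exists>l. b = axis l 1" if "b \<in> Basis" for b :: "real^'n"
    using that by (auto simp: Basis_vec_def)
  have axis: "dir_deriv (dir_deriv (axis r 1) (dir_deriv (axis q 1) (dir_deriv (axis p 1) G)) y) E y = 0"
    if y: "y \<noteq> 0" for p q r y
  proof -
    let ?D = "dir_deriv (axis r 1) (dir_deriv (axis q 1) (dir_deriv (axis p 1) G)) y"
    have "(\<Sum>i\<in>UNIV. (\<Sum>j\<in>UNIV. y $ j * fundamental_tensor f x y $ i $ j) * ?D $ i) = 0"
      using landsberg[OF y, of r q p] by (simp add: third_partial_spray[OF y] sum_distrib_right)
    then have "(\<Sum>i\<in>UNIV. ?D $ i * dir_deriv (axis i 1) E y) = 0"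
      by (simp add: y_fundamental_tensor[OF y] sum_divide_distrib[symmetric] mult.commute)
    moreover have "dir_deriv (\<Sum>i\<in>UNIV. ?D $ i *\<^sub>R axis i 1) E y = (\<Sum>i\<in>UNIV. ?D $ i * dir_deriv (axis i 1) E y)"
      by (simp add: linear_sum[OF linear_dir_deriv[OF N.E_diff[OF y]]] N.dE_lin[OF y])
    ultimately show ?thesis by (simp add: basis_expansion[of ?D, unfolded scalar_mult_eq_scaleR])
  qed
  define \<phi> where "\<phi> p q r y = dir_deriv (dir_deriv r (dir_deriv q (dir_deriv p G)) y) E y" for p q r y
  have lin: "linear (\<lambda>p. \<phi> p q r y)" "linear (\<lambda>q. \<phi> p q r y)" "linear (\<lambda>r. \<phi> p q r y)" if y: "y \<noteq> 0" for p q r y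
  proof -
    have y': "y \<in> - {0}" using y by simp
    note lE = linear_dir_deriv[OF N.E_diff[OF y]]
    note s1 = smooth_on_dir_deriv[OF smooth_G] and s2 = smooth_on_dir_deriv[OF smooth_on_dir_deriv[OF smooth_G]]
    show "linear (\<lambda>p. \<phi> p q r y)"
      using linear_compose[OF linear_third_dir_deriv[OF N.open_dom y' smooth_G] lE] by (simp add: \<phi>_def o_def)
    show "linear (\<lambda>q. \<phi> p q r y)"
      using linear_compose[OF linear_second_dir_deriv[OF N.open_dom y' s1] lE] by (simp add: \<phi>_def o_def)
    show "linear (\<lambda>r. \<phi> p q r y)"
      using linear_compose[OF linear_dir_deriv[OF smooth_on_imp_differentiable[OF s2 y']] lE] by (simp add: \<phi>_def o_def)
  qed
  have "\<phi> p q r y = 0" if y: "y \<noteq> 0" for p q r y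
  proof (rule linear_eq_0_stdbasis[OF lin(1)[OF y]], rule linear_eq_0_stdbasis[OF lin(2)[OF y]],
      rule linear_eq_0_stdbasis[OF lin(3)[OF y]])
    fix p q r :: "real^'n"
    assume "p \<in> Basis" "q \<in> Basis" "r \<in> Basis"
    then show "\<phi> p q r y = 0" using axis[OF y] Basis_axis unfolding \<phi>_def by metis
  qed
  then have land: "dir_deriv (dir_deriv w (dir_deriv w (dir_deriv w Z)) y) E y = 0" if "y \<noteq> 0" for w y
    using that by (simp add: third_dir_deriv_Z_eq[OF that] \<phi>_def)
  have T: "bilinear T"
    unfolding bilinear_def T_def[abs_def]
    by (intro conjI allI linear_compose_scale_right linear_compose_sub linear_Gam)
  have "smooth_on (- {0}) (\<lambda>y. (1/2) *\<^sub>R Gam y y)"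
  proof -
    have "smooth_on (- {0}) (\<lambda>y. \<chi> i. \<Sum>k\<in>UNIV. y $ k * (1/2 * Gam (axis k 1) y $ i))"
      using linear_Gam(1)
      by (intro smooth_on_vec_lambda smooth_on_sum smooth_on_mult smooth_on_const N.open_dom smooth_on_bounded_linear
          bounded_linear_vec_nth bounded_linear_compose[OF bounded_linear_vec_nth])
        (simp add: linear_conv_bounded_linear)
    moreover have "(1/2) *\<^sub>R Gam y y = (\<chi> i. \<Sum>k\<in>UNIV. y $ k * (1/2 * Gam (axis k 1) y $ i))" for y
    proof -
      have "Gam y y = Gam (\<Sum>k\<in>UNIV. y $ k *\<^sub>R axis k 1) y"
        by (simp add: basis_expansion[of y, unfolded scalar_mult_eq_scaleR])
      also have "\<dots> = (\<Sum>k\<in>UNIV. y $ k *\<^sub>R Gam (axis k 1) y)"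
        by (simp add: linear_sum[OF linear_Gam(2)] linear_cmul[OF linear_Gam(2)])
      finally show ?thesis by (simp add: vec_eq_iff sum_divide_distrib)
    qed
    ultimately show ?thesis by simp
  qed
  then have Z: "smooth_on (- {0}) Z"
    unfolding Z_def[abs_def] by (intro smooth_on_diff N.open_dom smooth_G)
  interpret R: alpha12_fiber E "\<lambda>y z. y \<bullet> (A x *v z)" "\<lambda>y z. y \<bullet> (B x *v z)" "\<lambda>y. P *v y" T Z
    by (unfold_locales) (use T Z land dir_deriv_Z in \<open>auto simp: T_def\<close>)
  show ?thesis
    using R.third_dir_deriv_Z[OF y] by (simp add: third_partial_spray[OF y] third_dir_deriv_Z_eq[OF y])
qed

end

subsection \<open>Charts and tangent vectors\<close>

lemma smooth_on_matrix:
  fixes N :: "'a::euclidean_space \<Rightarrow> real^'n^'m"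
  assumes S: "open S" and N: "\<And>i j. smooth_on S (\<lambda>x. N x $ i $ j)"
  shows "smooth_on S N"
proof -
  have rows: "smooth_on S (\<lambda>x. N x $ i)" for i
    using smooth_on_vec_lambda[OF S, of "\<lambda>j x. N x $ i $ j"] N by simp
  have bl: "bounded_linear (axis i :: real^'n \<Rightarrow> real^'n^'m)" for i
    unfolding linear_conv_bounded_linear[symmetric] by (rule linearI) (simp_all add: vec_eq_iff axis_def)
  have "(\<Sum>i\<in>UNIV. axis i (N x $ i)) $ k = N x $ k" for x k
  proof -
    have "(\<Sum>i\<in>UNIV. axis i (N x $ i)) $ k = (\<Sum>i\<in>UNIV. if i = k then N x $ i else 0)"
      unfolding sum_component by (rule sum.cong) (simp_all add: axis_def)
    then show ?thesis by simp
  qed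
  then have "N = (\<lambda>x. \<Sum>i\<in>UNIV. axis i (N x $ i))"
    unfolding fun_eq_iff vec_eq_iff[where 'a = "real^'n"] by simp
  moreover have "smooth_on S (\<lambda>x. \<Sum>i\<in>UNIV. axis i (N x $ i))"
    by (intro smooth_on_sum S smooth_on_bounded_linear_comp[OF S bl] rows)
  ultimately show ?thesis by simp
qed

lemma smooth_on_matrix_mult:
  assumes "open S" "\<And>i j. smooth_on S (\<lambda>x. M x $ i $ j)" "\<And>i j. smooth_on S (\<lambda>x. N x $ i $ j)"
  shows "smooth_on S (\<lambda>x. (M x ** N x) $ i $ j :: real)"
  unfolding matrix_matrix_mult_def by (simp add: smooth_on_sum smooth_on_mult assms)

lemma inner_transpose:
  fixes M :: "real^'n^'m"
  shows "y \<bullet> (transpose M *v w) = (M *v y) \<bullet> w"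
  unfolding transpose_matrix_vector inner_commute[of y] dot_lmul_matrix by (rule inner_commute)

lemma dim_pos_nontrivial:
  fixes V :: "'a::real_vector set"
  assumes "dim V = n" "n \<ge> 1" "subspace V"
  shows "\<exists>v\<in>V. v \<noteq> 0"
proof (rule ccontr)
  assume "\<not> ?thesis"
  then have "V = {0}" using subspace_0[OF assms(3)] by auto
  moreover have "span V = V" using assms(3) by (simp add: span_eq_iff)
  ultimately have "dim V = 0" using dim_eq_card[of "{}" V] by (simp add: independent_empty)
  with assms show False by simp
qed

locale smooth_atlas =
  fixes X :: "'m topology" and AT :: "('m, 'n::finite) chart set"
  assumes manifold: "smooth_manifold X AT"
begin

lemma chart: "c \<in> AT \<Longrightarrow> is_chart X c"
  using manifold by (simp add: smooth_manifold_def)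

lemma chart_subset: "c \<in> AT \<Longrightarrow> fst c \<subseteq> topspace X"
  using openin_subset[of X "fst c"] chart[of c] by (simp add: is_chart_def)

lemma chart_inj: assumes "c \<in> AT" shows "inj_on (snd c) (fst c)"
proof -
  have "topspace (subtopology X (fst c)) = fst c" using chart_subset[OF assms] by auto
  then show ?thesis
    using chart[OF assms] homeomorphic_imp_injective_map unfolding is_chart_def by metis
qed

lemma chart_inv_chart: "c \<in> AT \<Longrightarrow> p \<in> fst c \<Longrightarrow> chart_inv c (snd c p) = p"
  using chart_inj by (simp add: chart_inv_def)

lemma chart_inv_in: "x \<in> chart_image c \<Longrightarrow> chart_inv c x \<in> fst c"
  by (auto simp: chart_inv_def chart_image_def inv_into_into)

lemma chart_chart_inv: "x \<in> chart_image c \<Longrightarrow> snd c (chart_inv c x) = x"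
  by (auto simp: chart_inv_def chart_image_def f_inv_into_f)

lemma open_chart_image: "c \<in> AT \<Longrightarrow> open (chart_image c)"
  using chart by (simp add: is_chart_def chart_image_def)

lemma open_chart_part:
  assumes c: "c \<in> AT" and U: "openin X U"
  shows "open (snd c ` (fst c \<inter> U))"
proof -
  have top: "topspace (subtopology X (fst c)) = fst c" using chart_subset[OF c] by auto
  have hom: "homeomorphic_map (subtopology X (fst c)) (top_of_set (snd c ` fst c)) (snd c)"
    and op: "open (snd c ` fst c)" using chart[OF c] by (auto simp: is_chart_def)
  have "openin (subtopology X (fst c)) (fst c \<inter> U)"
    using U by (metis openin_subtopology_Int2)
  then have "openin (top_of_set (snd c ` fst c)) (snd c ` (fst c \<inter> U))"
    using homeomorphic_map_openness[OF hom, of "fst c \<inter> U", unfolded top] by blast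
  then show ?thesis using op openin_open_trans by blast
qed

lemma openin_chart: "c \<in> AT \<Longrightarrow> openin X (fst c)"
  using chart by (simp add: is_chart_def)

lemma transition_chart:
  "c \<in> AT \<Longrightarrow> p \<in> fst c \<Longrightarrow> transition c d (snd c p) = snd d p"
  by (simp add: transition_def chart_inv_chart)

lemma transition_differentiable:
  assumes "c \<in> AT" "d \<in> AT" "p \<in> fst c" "p \<in> fst d"
  shows "transition c d differentiable (at (snd c p))"
proof -
  have "smooth_on (snd c ` (fst c \<inter> fst d)) (transition c d)"
    using manifold assms by (auto simp: smooth_manifold_def compatible_def)
  then show ?thesis using smooth_on_imp_differentiable assms by blast
qed

lemma transition_comp:
  assumes c: "c \<in> AT" "p \<in> fst c" and d: "d \<in> AT" "p \<in> fst d" and e: "e \<in> AT" "p \<in> fst e"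
  shows "dir_deriv y (transition c e) (snd c p)
    = dir_deriv (dir_deriv y (transition c d) (snd c p)) (transition d e) (snd d p)"
proof -
  have "transition d e differentiable (at (transition c d (snd c p)))"
    using transition_differentiable[OF d(1) e(1) d(2) e(2)] transition_chart[OF c] by simp
  from has_derivative_compose[OF has_derivative_dir_deriv[OF transition_differentiable[OF c(1) d(1) c(2) d(2)]]
      has_derivative_dir_deriv[OF this]]
  have "((\<lambda>z. transition d e (transition c d z)) has_derivative
      (\<lambda>y. dir_deriv (dir_deriv y (transition c d) (snd c p)) (transition d e) (snd d p))) (at (snd c p))"
    by (simp add: transition_chart[OF c])
  then have "(transition c e has_derivative
      (\<lambda>y. dir_deriv (dir_deriv y (transition c d) (snd c p)) (transition d e) (snd d p))) (at (snd c p))"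
  proof (rule has_derivative_transform_within_open)
    show "open (snd c ` (fst c \<inter> (fst d \<inter> fst e)))"
      by (intro open_chart_part c openin_Int openin_chart d e)
    show "snd c p \<in> snd c ` (fst c \<inter> (fst d \<inter> fst e))" using c d e by blast
    show "transition d e (transition c d z) = transition c e z" if "z \<in> snd c ` (fst c \<inter> (fst d \<inter> fst e))" for z
    proof -
      obtain q where q: "z = snd c q" "q \<in> fst c" "q \<in> fst d" using \<open>z \<in> _\<close> by blast
      show ?thesis by (simp add: q transition_chart[OF c(1)] transition_chart[OF d(1)])
    qed
  qed
  then show ?thesis by (rule dir_deriv_eq)
qed

lemma transition_self:
  assumes "c \<in> AT" "p \<in> fst c"
  shows "dir_deriv y (transition c c) (snd c p) = y"
proof -
  have "((\<lambda>z. z) has_derivative (\<lambda>y. y)) (at (snd c p))" by (rule has_derivative_ident)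
  then have "(transition c c has_derivative (\<lambda>y. y)) (at (snd c p))"
  proof (rule has_derivative_transform_within_open)
    show "open (chart_image c)" by (rule open_chart_image[OF assms(1)])
    show "snd c p \<in> chart_image c" using assms by (simp add: chart_image_def)
    show "z = transition c c z" if "z \<in> chart_image c" for z
    proof -
      obtain q where q: "z = snd c q" "q \<in> fst c" using \<open>z \<in> _\<close> unfolding chart_image_def by blast
      show ?thesis by (simp add: q transition_chart[OF assms(1)])
    qed
  qed
  then show ?thesis by (rule dir_deriv_eq)
qed

section \<open>Tangent vectors and their components in one chart\<close>

lemma tangent_space_iff:
  "v \<in> tangent_space AT p \<longleftrightarrow>
    (\<forall>c\<in>AT. \<forall>d\<in>AT. p \<in> fst c \<and> p \<in> fst d \<longrightarrow> v d = dir_deriv (v c) (transition c d) (snd c p)) \<and>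
    (\<forall>c. \<not> (c \<in> AT \<and> p \<in> fst c) \<longrightarrow> v c = 0)"
  by (simp add: tangent_space_def dir_deriv_def)

lemma tangent_space_subspace: "subspace (tangent_space AT p)"
proof -
  have lin: "linear (\<lambda>y. dir_deriv y (transition c d) (snd c p))"
    if "c \<in> AT" "d \<in> AT" "p \<in> fst c" "p \<in> fst d" for c d
    by (rule linear_dir_deriv[OF transition_differentiable[OF that]])
  show ?thesis
  proof (rule subspaceI)
    show "0 \<in> tangent_space AT p"
      using linear_0[OF lin] by (simp add: tangent_space_iff zero_fun_def)
    show "v + w \<in> tangent_space AT p" if "v \<in> tangent_space AT p" "w \<in> tangent_space AT p" for v w
      using that linear_add[OF lin] unfolding tangent_space_iff plus_fun_def
      by (metis (no_types, lifting) add_0)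
    show "r *\<^sub>R v \<in> tangent_space AT p" if "v \<in> tangent_space AT p" for r v
      using that linear_cmul[OF lin] unfolding tangent_space_iff scaleR_fun_def
      by (metis (no_types, lifting) scaleR_zero_right)
  qed
qed

lemma tangent_space_eqI:
  assumes "v \<in> tangent_space AT p" "w \<in> tangent_space AT p" "c \<in> AT" "p \<in> fst c" "v c = w c"
  shows "v = w"
proof
  fix d
  have "u d = (if d \<in> AT \<and> p \<in> fst d then dir_deriv (u c) (transition c d) (snd c p) else 0)"
    if "u \<in> tangent_space AT p" for u
  proof (cases "d \<in> AT \<and> p \<in> fst d")
    case True
    show ?thesis unfolding if_P[OF True] using that True assms(3,4) unfolding tangent_space_iff by blast
  next
    case False
    show ?thesis unfolding if_not_P[OF False] using that False unfolding tangent_space_iff by blast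
  qed
  from this[OF assms(1)] this[OF assms(2)] show "v d = w d" by (simp only: assms(5))
qed

text \<open>Any components in \<open>c\<close> are transported to the other charts by derivatives of
  transition maps; the chain rule \<open>transition_comp\<close> says that the resulting family is
  consistent. So taking components in \<open>c\<close> is onto, and the inverse in
  \<open>coord_vec\<close> is not a default value.\<close>

lemma coord_vec:
  assumes c: "c \<in> AT" "p \<in> fst c"
  shows "coord_vec AT c p y \<in> tangent_space AT p" "coord_vec AT c p y c = y"
proof -
  define v where "v d = (if d \<in> AT \<and> p \<in> fst d then dir_deriv y (transition c d) (snd c p) else 0)" for d
  have "v \<in> tangent_space AT p"
    unfolding tangent_space_iff
  proof (intro conjI ballI allI impI)
    fix d e assume "d \<in> AT" "e \<in> AT" "p \<in> fst d \<and> p \<in> fst e"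
    then show "v e = dir_deriv (v d) (transition d e) (snd d p)"
      using transition_comp[OF c, of d e y] by (simp only: v_def simp_thms if_True)
  next
    fix d assume "\<not> (d \<in> AT \<and> p \<in> fst d)"
    then show "v d = 0" by (simp only: v_def if_False)
  qed
  moreover have "v c = y" using transition_self[OF c] c by (simp add: v_def)
  ultimately have y: "y \<in> (\<lambda>v. v c) ` tangent_space AT p" by blast
  show "coord_vec AT c p y \<in> tangent_space AT p" "coord_vec AT c p y c = y"
    using inv_into_into[OF y] f_inv_into_f[OF y] by (simp_all add: coord_vec_def)
qed

lemma coord_vec_eq:
  assumes "c \<in> AT" "p \<in> fst c" "v \<in> tangent_space AT p"
  shows "coord_vec AT c p (v c) = v"
  using tangent_space_eqI[OF coord_vec(1)[OF assms(1,2)] assms(3,1,2)] coord_vec(2)[OF assms(1,2)] by simp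

lemma coord_vec_linear:
  assumes c: "c \<in> AT" "p \<in> fst c"
  shows "linear (coord_vec AT c p)"
proof (rule linearI)
  note cv = coord_vec[OF c] and sub = tangent_space_subspace[of p]
  show "coord_vec AT c p (y + z) = coord_vec AT c p y + coord_vec AT c p z" for y z
    by (rule tangent_space_eqI[OF cv(1) subspace_add[OF sub cv(1) cv(1)] c]) (simp add: cv)
  show "coord_vec AT c p (r *\<^sub>R y) = r *\<^sub>R coord_vec AT c p y" for r y
    by (rule tangent_space_eqI[OF cv(1) subspace_scale[OF sub cv(1)] c]) (simp add: cv scaleR_fun_def)
qed

end

subsection \<open>The two partial metrics in a chart\<close>

locale alpha12_manifold = smooth_atlas X AT
  for X :: "'m topology" and AT :: "('m, 'n::finite) chart set" +
  fixes a :: "'m \<Rightarrow> ('m, 'n) tvec \<Rightarrow> ('m, 'n) tvec \<Rightarrow> real" and n1 n2 :: nat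
    and V1 V2 :: "'m \<Rightarrow> ('m, 'n) tvec set" and L :: "real \<Rightarrow> real \<Rightarrow> real"
    and F :: "'m \<Rightarrow> ('m, 'n) tvec \<Rightarrow> real"
    and c :: "('m, 'n) chart"
  assumes metric: "alpha12_metric X AT a n1 n2 V1 V2 L F" and c: "c \<in> AT"
begin

definition pt :: "real^'n \<Rightarrow> 'm" where "pt x = chart_inv c x"
definition cv :: "real^'n \<Rightarrow> real^'n \<Rightarrow> ('m, 'n) tvec" where "cv x = coord_vec AT c (pt x)"
definition gram :: "real^'n \<Rightarrow> real^'n^'n" where "gram x = (\<chi> i j. a (pt x) (cv x (axis i 1)) (cv x (axis j 1)))"

context
  fixes x :: "real^'n"
  assumes x: "x \<in> chart_image c"
begin

lemma pt: "pt x \<in> fst c" "pt x \<in> topspace X"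
  using chart_inv_in[OF x] chart_subset[OF c] by (auto simp: pt_def)

lemma cv_tangent: "cv x y \<in> tangent_space AT (pt x)" and cv_c: "cv x y c = y"
  using coord_vec[OF c pt(1)] by (simp_all add: cv_def)

lemma cv_eq: "v \<in> tangent_space AT (pt x) \<Longrightarrow> cv x (v c) = v"
  using coord_vec_eq[OF c pt(1)] by (simp add: cv_def)

lemma cv_linear: "linear (cv x)"
  using coord_vec_linear[OF c pt(1)] by (simp add: cv_def)

lemma a_linear:
  assumes "u \<in> tangent_space AT (pt x)" "v \<in> tangent_space AT (pt x)" "w \<in> tangent_space AT (pt x)"
  shows "a (pt x) (u + v) w = a (pt x) u w + a (pt x) v w" "a (pt x) (r *\<^sub>R u) w = r * a (pt x) u w"
    "a (pt x) w (u + v) = a (pt x) w u + a (pt x) w v" "a (pt x) u v = a (pt x) v u"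
    "u \<noteq> 0 \<Longrightarrow> a (pt x) u u > 0"
proof -
  have R: "riemannian_metric X AT a" using metric by (simp add: alpha12_metric_def)
  have lin: "a (pt x) (r *\<^sub>R u + s *\<^sub>R v) w = r * a (pt x) u w + s * a (pt x) v w"
    if "u \<in> tangent_space AT (pt x)" "v \<in> tangent_space AT (pt x)" "w \<in> tangent_space AT (pt x)" for u v w r s
    by (rule R[unfolded riemannian_metric_def, THEN conjunct1, rule_format, OF pt(2) that])
  have sym: "a (pt x) u v = a (pt x) v u" if "u \<in> tangent_space AT (pt x)" "v \<in> tangent_space AT (pt x)" for u v
    by (rule R[unfolded riemannian_metric_def, THEN conjunct2, THEN conjunct1, rule_format, OF pt(2) that])
  show 1: "a (pt x) (u + v) w = a (pt x) u w + a (pt x) v w" using lin[OF assms, of 1 1] by simp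
  show "a (pt x) (r *\<^sub>R u) w = r * a (pt x) u w" using lin[OF assms, of r 0] by simp
  show "a (pt x) u v = a (pt x) v u" using sym assms by blast
  show "a (pt x) w (u + v) = a (pt x) w u + a (pt x) w v"
    using 1 sym assms subspace_add[OF tangent_space_subspace] by metis
  show "u \<noteq> 0 \<Longrightarrow> a (pt x) u u > 0" 
    by (rule R[unfolded riemannian_metric_def, THEN conjunct2, THEN conjunct2, THEN conjunct1, rule_format,
        OF pt(2) assms(1)])
qed

lemma gram_eq: "y \<bullet> (gram x *v z) = a (pt x) (cv x y) (cv x z)"
proof -
  have lin1: "linear (\<lambda>y. a (pt x) (cv x y) w)" if "w \<in> tangent_space AT (pt x)" for w
    by (rule linearI)
      (simp_all add: linear_add[OF cv_linear] linear_cmul[OF cv_linear] a_linear[OF cv_tangent cv_tangent that])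
  have sym: "a (pt x) (cv x y) (cv x z) = a (pt x) (cv x z) (cv x y)" for y z
    by (rule a_linear(4)[OF cv_tangent cv_tangent cv_tangent])
  have expand: "a (pt x) (cv x y) (cv x z) = (\<Sum>i\<in>UNIV. y $ i * a (pt x) (cv x (axis i 1)) (cv x z))" for y z
  proof -
    note l = lin1[OF cv_tangent[of z]]
    have "a (pt x) (cv x y) (cv x z) = a (pt x) (cv x (\<Sum>i\<in>UNIV. y $ i *\<^sub>R axis i 1)) (cv x z)"
      by (simp add: basis_expansion[of y, unfolded scalar_mult_eq_scaleR])
    then show ?thesis by (simp add: linear_sum[OF l] linear_cmul[OF l])
  qed
  have "a (pt x) (cv x (axis i 1)) (cv x z) = (gram x *v z) $ i" for i
    using expand[of z "axis i 1"] sym[of "axis i 1"]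
    by (simp add: gram_def matrix_vector_mult_def mult.commute)
  then show ?thesis by (simp add: expand[of y] inner_vec_def)
qed

lemma gram_sym: "y \<bullet> (gram x *v z) = z \<bullet> (gram x *v y)"
  unfolding gram_eq by (rule a_linear(4)[OF cv_tangent cv_tangent cv_tangent])

lemma cv_eq_0: "cv x y = 0 \<longleftrightarrow> y = 0"
  using cv_c[of y] linear_0[OF cv_linear] by (auto simp: zero_fun_def)

lemma gram_pos: "y \<noteq> 0 \<Longrightarrow> y \<bullet> (gram x *v y) > 0"
  unfolding gram_eq using a_linear(5)[OF cv_tangent cv_tangent cv_tangent] cv_eq_0 by blast

lemma V_facts:
  shows "subspace (V1 (pt x))" "subspace (V2 (pt x))"
    "V1 (pt x) \<subseteq> tangent_space AT (pt x)" "V2 (pt x) \<subseteq> tangent_space AT (pt x)"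
    "dim (V1 (pt x)) = n1" "dim (V2 (pt x)) = n2"
    "tangent_space AT (pt x) = {u + v |u v. u \<in> V1 (pt x) \<and> v \<in> V2 (pt x)}"
    "V1 (pt x) \<inter> V2 (pt x) = {0}"
    "\<And>u v. u \<in> V1 (pt x) \<Longrightarrow> v \<in> V2 (pt x) \<Longrightarrow> a (pt x) u v = 0"
proof -
  have "smooth_subbundle X AT n1 V1" "smooth_subbundle X AT n2 V2" "orthogonal_decomposition X AT a V1 V2"
    using metric by (simp_all add: alpha12_metric_def)
  note * = this[unfolded smooth_subbundle_def orthogonal_decomposition_def, rule_format, OF pt(2)]
  show "subspace (V1 (pt x))" "subspace (V2 (pt x))"
    "V1 (pt x) \<subseteq> tangent_space AT (pt x)" "V2 (pt x) \<subseteq> tangent_space AT (pt x)"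
    "dim (V1 (pt x)) = n1" "dim (V2 (pt x)) = n2"
    "tangent_space AT (pt x) = {u + v |u v. u \<in> V1 (pt x) \<and> v \<in> V2 (pt x)}"
    "V1 (pt x) \<inter> V2 (pt x) = {0}"
    using * by simp_all
  show "a (pt x) u v = 0" if "u \<in> V1 (pt x)" "v \<in> V2 (pt x)" for u v
    using *(3) that by simp
qed

lemma ex1_decomp:
  "\<exists>!u. u \<in> V1 (pt x) \<and> cv x y - u \<in> V2 (pt x)"
proof -
  obtain u v where uv: "cv x y = u + v" "u \<in> V1 (pt x)" "v \<in> V2 (pt x)"
    using cv_tangent[of y] V_facts(7) by auto
  show ?thesis
  proof (rule ex1I[of _ u])
    show "u \<in> V1 (pt x) \<and> cv x y - u \<in> V2 (pt x)" using uv by simp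
    fix u' assume u': "u' \<in> V1 (pt x) \<and> cv x y - u' \<in> V2 (pt x)"
    have "u' - u \<in> V1 (pt x)" using u' uv subspace_diff[OF V_facts(1)] by blast
    moreover have "u' - u \<in> V2 (pt x)"
      using subspace_diff[OF V_facts(2), of "cv x y - u" "cv x y - u'"] u' uv by simp
    ultimately have "u' - u \<in> V1 (pt x) \<inter> V2 (pt x)" by blast
    then have "u' - u = 0" unfolding V_facts(8) by (rule singletonD)
    then show "u' = u" by (rule iffD1[OF right_minus_eq])
  qed
qed

end

section \<open>The projection matrix and the two partial Gram matrices\<close>

definition proj1 :: "real^'n \<Rightarrow> real^'n \<Rightarrow> ('m, 'n) tvec"
  where "proj1 x y = (THE u. u \<in> V1 (pt x) \<and> cv x y - u \<in> V2 (pt x))"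

definition Pm :: "real^'n \<Rightarrow> real^'n^'n" where "Pm x = matrix (\<lambda>y. proj1 x y c)"

text \<open>Pulling the metric back along a projection defines the form on the whole tangent space,
  so both squared partial lengths become quadratic forms in the same coordinates.\<close>

definition Am :: "real^'n \<Rightarrow> real^'n^'n" where "Am x = transpose (Pm x) ** gram x ** Pm x"
definition Bm :: "real^'n \<Rightarrow> real^'n^'n"
  where "Bm x = transpose (mat 1 - Pm x) ** gram x ** (mat 1 - Pm x)"

context
  fixes x :: "real^'n"
  assumes x: "x \<in> chart_image c"
begin

lemma proj1: "proj1 x y \<in> V1 (pt x)" "cv x y - proj1 x y \<in> V2 (pt x)"
  using theI'[OF ex1_decomp[OF x]] unfolding proj1_def by blast+

lemma proj1_eqI: "u \<in> V1 (pt x) \<Longrightarrow> cv x y - u \<in> V2 (pt x) \<Longrightarrow> proj1 x y = u"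
  unfolding proj1_def by (rule the1_equality[OF ex1_decomp[OF x]]) blast

lemma linear_proj1: "linear (proj1 x)"
proof (rule linearI)
  note cvl = linear_add[OF cv_linear[OF x]] linear_cmul[OF cv_linear[OF x]]
  show "proj1 x (y + z) = proj1 x y + proj1 x z" for y z
    using subspace_add[OF V_facts(1)[OF x] proj1(1)[of y] proj1(1)[of z]]
      subspace_add[OF V_facts(2)[OF x] proj1(2)[of y] proj1(2)[of z]]
    by (intro proj1_eqI) (simp_all add: cvl algebra_simps)
  show "proj1 x (r *\<^sub>R y) = r *\<^sub>R proj1 x y" for r y
    using subspace_scale[OF V_facts(1)[OF x] proj1(1)[of y], of r]
      subspace_scale[OF V_facts(2)[OF x] proj1(2)[of y], of r]
    by (intro proj1_eqI) (simp_all add: cvl algebra_simps)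
qed

lemma Pm: "Pm x *v y = proj1 x y c"
proof -
  have "linear (\<lambda>y. proj1 x y c)"
    using linear_add[OF linear_proj1] linear_cmul[OF linear_proj1]
    by (intro linearI) (simp_all add: scaleR_fun_def)
  then show ?thesis unfolding Pm_def by (simp add: matrix_works linear_def scalar_mult_eq_scaleR)
qed

lemma cv_Pm: "cv x (Pm x *v y) = proj1 x y" and cv_Qm: "cv x (y - Pm x *v y) = cv x y - proj1 x y"
proof -
  have "proj1 x y \<in> tangent_space AT (pt x)" using proj1(1) V_facts(3)[OF x] by blast
  then show 1: "cv x (Pm x *v y) = proj1 x y" using cv_eq[OF x] by (simp add: Pm)
  show "cv x (y - Pm x *v y) = cv x y - proj1 x y" by (simp add: linear_diff[OF cv_linear[OF x]] 1)
qed

lemma Pm_range_iff: "Pm x *v y = y \<longleftrightarrow> cv x y \<in> V1 (pt x)"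
proof
  show "Pm x *v y = y \<Longrightarrow> cv x y \<in> V1 (pt x)" using cv_Pm proj1(1) by metis
  assume "cv x y \<in> V1 (pt x)"
  then have "proj1 x y = cv x y" using subspace_0[OF V_facts(2)[OF x]] by (intro proj1_eqI) auto
  then show "Pm x *v y = y" by (simp add: Pm cv_c[OF x])
qed

lemma Pm_kernel_iff: "Pm x *v y = 0 \<longleftrightarrow> cv x y \<in> V2 (pt x)"
proof
  assume "Pm x *v y = 0"
  then show "cv x y \<in> V2 (pt x)" using proj1(2)[of y] cv_Qm[of y] by simp
next
  assume "cv x y \<in> V2 (pt x)"
  then have "proj1 x y = 0" using subspace_0[OF V_facts(1)[OF x]] by (intro proj1_eqI) auto
  then show "Pm x *v y = 0" by (simp add: Pm)
qed

lemma Pm_idem: "Pm x *v (Pm x *v y) = Pm x *v y"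
  unfolding Pm_range_iff using cv_Pm proj1(1) by simp

lemma Am_form: "y \<bullet> (Am x *v z) = (Pm x *v y) \<bullet> (gram x *v (Pm x *v z))"
  unfolding Am_def matrix_vector_mul_assoc[symmetric] inner_transpose ..

lemma Bm_form: "y \<bullet> (Bm x *v z) = (y - Pm x *v y) \<bullet> (gram x *v (z - Pm x *v z))"
  unfolding Bm_def matrix_vector_mul_assoc[symmetric] inner_transpose
  by (simp add: matrix_vector_mult_diff_rdistrib)

text \<open>Orthogonality of the subbundles identifies the metric projection with the one along the
  other summand; uniqueness follows from definiteness, applied to the difference of two
  candidates.\<close>

lemma orth_proj1: "orth_proj a V1 (pt x) (cv x y) = proj1 x y"
  unfolding orth_proj_def
proof (rule the_equality)
  note al = a_linear[OF x]
  have sub: "V1 (pt x) \<subseteq> tangent_space AT (pt x)" "V2 (pt x) \<subseteq> tangent_space AT (pt x)" by (rule V_facts[OF x])+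
  show *: "proj1 x y \<in> V1 (pt x) \<and> (\<forall>u\<in>V1 (pt x). a (pt x) (cv x y - proj1 x y) u = 0)"
  proof (intro conjI ballI proj1)
    fix u assume u: "u \<in> V1 (pt x)"
    show "a (pt x) (cv x y - proj1 x y) u = 0"
      using V_facts(9)[OF x u proj1(2)[of y]] al(4)[of u "cv x y - proj1 x y" u] u proj1(2)[of y] sub by auto
  qed
  fix w assume w: "w \<in> V1 (pt x) \<and> (\<forall>u\<in>V1 (pt x). a (pt x) (cv x y - w) u = 0)"
  let ?d = "w - proj1 x y"
  have d: "?d \<in> V1 (pt x)" using subspace_diff[OF V_facts(1)[OF x]] w proj1(1) by blast
  have T: "?d \<in> tangent_space AT (pt x)" "cv x y - w \<in> tangent_space AT (pt x)"
    using d w sub cv_tangent[OF x] subspace_diff[OF tangent_space_subspace] by blast+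
  have "a (pt x) ((cv x y - w) + ?d) ?d = a (pt x) (cv x y - w) ?d + a (pt x) ?d ?d"
    by (rule al(1)[OF T(2) T(1) T(1)])
  then have "a (pt x) ?d ?d = 0" using * w d by simp
  then show "w = proj1 x y" using al(5)[OF T(1) T(1) T(1)] by force
qed

lemma orth_proj2: "orth_proj a V2 (pt x) (cv x y) = cv x y - proj1 x y"
  unfolding orth_proj_def
proof (rule the_equality)
  note al = a_linear[OF x]
  have sub: "V1 (pt x) \<subseteq> tangent_space AT (pt x)" "V2 (pt x) \<subseteq> tangent_space AT (pt x)" by (rule V_facts[OF x])+
  let ?v = "cv x y - proj1 x y"
  show *: "?v \<in> V2 (pt x) \<and> (\<forall>u\<in>V2 (pt x). a (pt x) (cv x y - ?v) u = 0)"
    using proj1 V_facts(9)[OF x] by simp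
  fix w assume w: "w \<in> V2 (pt x) \<and> (\<forall>u\<in>V2 (pt x). a (pt x) (cv x y - w) u = 0)"
  let ?d = "w - ?v"
  have d: "?d \<in> V2 (pt x)" using subspace_diff[OF V_facts(2)[OF x]] w proj1(2) by blast
  have T: "?d \<in> tangent_space AT (pt x)" "cv x y - w \<in> tangent_space AT (pt x)"
    using d w sub cv_tangent[OF x] subspace_diff[OF tangent_space_subspace] by blast+
  have "a (pt x) ((cv x y - w) + ?d) ?d = a (pt x) (cv x y - w) ?d + a (pt x) ?d ?d"
    by (rule al(1)[OF T(2) T(1) T(1)])
  then have "a (pt x) ?d ?d = 0" using * w d by simp
  then show "w = ?v" using al(5)[OF T(1) T(1) T(1)] by force
qed

lemma a_nonneg: "a (pt x) (cv x y) (cv x y) \<ge> 0"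
  using gram_pos[OF x, of y] gram_eq[OF x, of y y] by (cases "y = 0") (force, simp)

lemma alpha_restr_sq:
  "(alpha_restr a V1 (pt x) (cv x y))\<^sup>2 = y \<bullet> (Am x *v y)"
  "(alpha_restr a V2 (pt x) (cv x y))\<^sup>2 = y \<bullet> (Bm x *v y)"
  using a_nonneg[of "Pm x *v y"] a_nonneg[of "y - Pm x *v y"]
  by (simp_all add: alpha_restr_def orth_proj1 orth_proj2 Am_form Bm_form gram_eq[OF x] cv_Pm cv_Qm)

lemma local_fun_eq: "local_fun AT c F x y = sqrt (L (y \<bullet> (Am x *v y)) (y \<bullet> (Bm x *v y)))"
proof -
  have "F (pt x) (cv x y) = sqrt (L ((alpha_restr a V1 (pt x) (cv x y))\<^sup>2) ((alpha_restr a V2 (pt x) (cv x y))\<^sup>2))"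
    using metric pt(2)[OF x] cv_tangent[OF x] unfolding alpha12_metric_def by blast
  then show ?thesis by (simp add: alpha_restr_sq) (simp add: local_fun_def pt_def cv_def)
qed

lemma Pm_nontriv: "\<exists>y. Pm x *v y \<noteq> 0" "\<exists>y. Pm x *v y \<noteq> y"
proof -
  have n: "n1 \<ge> 1" "n2 \<ge> 1" using metric by (auto simp: alpha12_metric_def)
  obtain u v where u: "u \<in> V1 (pt x)" "u \<noteq> 0" and v: "v \<in> V2 (pt x)" "v \<noteq> 0"
    using dim_pos_nontrivial[OF V_facts(5)[OF x] n(1) V_facts(1)[OF x]]
      dim_pos_nontrivial[OF V_facts(6)[OF x] n(2) V_facts(2)[OF x]] by blast
  have cu: "cv x (u c) = u" "cv x (v c) = v" using cv_eq[OF x] u v V_facts(3,4)[OF x] by blast+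
  have "Pm x *v u c = u c" "u c \<noteq> 0" using Pm_range_iff[of "u c"] cu u cv_eq_0[OF x, of "u c"] by auto
  then show "\<exists>y. Pm x *v y \<noteq> 0" by metis
  have "Pm x *v v c = 0" "v c \<noteq> 0" using Pm_kernel_iff[of "v c"] cu v cv_eq_0[OF x, of "v c"] by auto
  then show "\<exists>y. Pm x *v y \<noteq> y" by metis
qed

end

end

section \<open>Smoothness of the projection\<close>

lemma inner_sum_scaleR_form:
  fixes z :: "real^'n"
  shows "(G *v z) \<bullet> (\<Sum>j<k. (y j \<bullet> (G *v z)) *\<^sub>R y j) = (\<Sum>j<k. (y j \<bullet> (G *v z))\<^sup>2)"
  by (simp add: inner_sum_right power2_eq_square inner_commute)

context alpha12_manifold
begin

text \<open>The matrix of the frame operator of the fields \<open>Y\<close> for the metric. Its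
  range lies in the span of the fields, and it is smooth when they are.\<close>

definition frame_op :: "nat \<Rightarrow> (nat \<Rightarrow> 'm \<Rightarrow> ('m, 'n) tvec) \<Rightarrow> real^'n \<Rightarrow> real^'n^'n"
  where "frame_op k Y x = (\<chi> i l. \<Sum>j<k. Y j (pt x) c $ i * (\<Sum>m\<in>UNIV. Y j (pt x) c $ m * gram x $ m $ l))"

lemma frame_op_eq: "frame_op k Y x *v z = (\<Sum>j<k. (Y j (pt x) c \<bullet> (gram x *v z)) *\<^sub>R Y j (pt x) c)"
proof -
  have "(frame_op k Y x *v z) $ i = (\<Sum>j<k. (Y j (pt x) c \<bullet> (gram x *v z)) * Y j (pt x) c $ i)" for i
  proof -
    have "(frame_op k Y x *v z) $ i
        = (\<Sum>l\<in>UNIV. \<Sum>j<k. \<Sum>m\<in>UNIV. Y j (pt x) c $ i * (Y j (pt x) c $ m * (gram x $ m $ l * z $ l)))"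
      by (simp add: frame_op_def matrix_vector_mult_def sum_distrib_right sum_distrib_left mult.assoc)
    also have "\<dots> = (\<Sum>j<k. \<Sum>l\<in>UNIV. \<Sum>m\<in>UNIV. Y j (pt x) c $ i * (Y j (pt x) c $ m * (gram x $ m $ l * z $ l)))"
      by (rule sum.swap)
    also have "\<dots> = (\<Sum>j<k. \<Sum>m\<in>UNIV. \<Sum>l\<in>UNIV. Y j (pt x) c $ i * (Y j (pt x) c $ m * (gram x $ m $ l * z $ l)))"
      by (rule sum.cong[OF refl], rule sum.swap)
    also have "\<dots> = (\<Sum>j<k. (Y j (pt x) c \<bullet> (gram x *v z)) * Y j (pt x) c $ i)"
      by (simp add: inner_vec_def matrix_vector_mult_def sum_distrib_right sum_distrib_left mult_ac)
    finally show ?thesis .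
  qed
  then show ?thesis by (simp add: vec_eq_iff)
qed

lemma gram_smooth: "smooth_on (chart_image c) (\<lambda>x. gram x $ i $ j)"
proof -
  have "riemannian_metric X AT a" using metric by (simp add: alpha12_metric_def)
  then show ?thesis using c by (simp add: riemannian_metric_def gram_def cv_def pt_def)
qed

lemma frame_op_smooth:
  assumes S: "open S" "S \<subseteq> chart_image c" and Y: "\<And>j. j < k \<Longrightarrow> smooth_on S (\<lambda>x. Y j (pt x) c)"
  shows "smooth_on S (\<lambda>x. frame_op k Y x $ i $ l)"
proof -
  have g: "smooth_on S (\<lambda>x. gram x $ i $ j)" for i j by (rule smooth_on_subset[OF gram_smooth S(2)])
  have y: "smooth_on S (\<lambda>x. Y j (pt x) c $ i)" if "j < k" for i j by (rule smooth_on_vec_nth[OF S(1) Y[OF that]])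
  have "smooth_on S (\<lambda>x. \<Sum>j<k. Y j (pt x) c $ i * (\<Sum>m\<in>UNIV. Y j (pt x) c $ m * gram x $ m $ l))"
    by (intro smooth_on_sum smooth_on_mult S(1) y g) auto
  then show ?thesis by (simp add: frame_op_def)
qed

text \<open>The projection fixes the range of the frame operator \<open>K1\<close> of the first
  subbundle and annihilates that of the second, so its product with their sum \<open>K\<close> is
  \<open>K1\<close>. As \<open>K\<close> is invertible, the projection is \<open>K1\<close> times
  the inverse of \<open>K\<close>, which is smooth.\<close>

lemma Pm_smooth:
  assumes x: "x \<in> chart_image c"
  obtains S where "open S" "x \<in> S" "S \<subseteq> chart_image c" "\<And>i j. smooth_on S (\<lambda>x. Pm x $ i $ j)"
proof -
  have "smooth_subbundle X AT n1 V1" "smooth_subbundle X AT n2 V2"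
    using metric by (simp_all add: alpha12_metric_def)
  note sb = this[unfolded smooth_subbundle_def, rule_format, OF pt(2)[OF x], THEN conjunct2, THEN conjunct2, THEN conjunct2]
  obtain W1 Y1 where W1: "openin X W1" "pt x \<in> W1" and Y1: "\<And>j. j < n1 \<Longrightarrow> smooth_vector_field_on AT W1 (Y1 j)"
    and V1: "\<And>q. q \<in> W1 \<Longrightarrow> V1 q = span ((\<lambda>j. Y1 j q) ` {..<n1})" using sb(1) by blast
  obtain W2 Y2 where W2: "openin X W2" "pt x \<in> W2" and Y2: "\<And>j. j < n2 \<Longrightarrow> smooth_vector_field_on AT W2 (Y2 j)"
    and V2: "\<And>q. q \<in> W2 \<Longrightarrow> V2 q = span ((\<lambda>j. Y2 j q) ` {..<n2})" using sb(2) by blast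
  define S where "S = snd c ` (fst c \<inter> (W1 \<inter> W2))"
  have S: "open S" unfolding S_def by (intro open_chart_part c openin_Int W1 W2)
  have xS: "x \<in> S"
    unfolding S_def using chart_chart_inv[OF x] pt(1)[OF x] W1(2) W2(2) unfolding pt_def by (metis IntI imageI)
  have SS: "S \<subseteq> chart_image c" by (auto simp: S_def chart_image_def)
  have ptS: "pt z \<in> W1" "pt z \<in> W2" if z: "z \<in> S" for z
    using z chart_inv_chart[OF c] by (auto simp: S_def pt_def)
  have "smooth_on (snd c ` (W \<inter> fst c)) (\<lambda>x. Y (pt x) c)" if "smooth_vector_field_on AT W Y" for W Y
    using that c by (simp add: smooth_vector_field_on_def pt_def)
  note sY = smooth_on_subset[OF this]
  have sub: "S \<subseteq> snd c ` (W1 \<inter> fst c)" "S \<subseteq> snd c ` (W2 \<inter> fst c)" by (auto simp: S_def)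
  have sY1: "smooth_on S (\<lambda>x. Y1 j (pt x) c)" if "j < n1" for j by (rule sY[OF Y1[OF that] sub(1)])
  have sY2: "smooth_on S (\<lambda>x. Y2 j (pt x) c)" if "j < n2" for j by (rule sY[OF Y2[OF that] sub(2)])
  define K1 where "K1 = frame_op n1 Y1"
  define K where "K z = K1 z + frame_op n2 Y2 z" for z
  have in1: "Y1 j (pt z) \<in> V1 (pt z)" if "z \<in> S" "j < n1" for z j
    using V1[OF ptS(1)[OF that(1)]] that(2) by (simp add: span_base)
  have in2: "Y2 j (pt z) \<in> V2 (pt z)" if "z \<in> S" "j < n2" for z j
    using V2[OF ptS(2)[OF that(1)]] that(2) by (simp add: span_base)
  have detK: "det (K z) \<noteq> 0" if z: "z \<in> S" for z
  proof -
    have zc: "z \<in> chart_image c" using SS z by blast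
    note Tan = V_facts(3,4)[OF zc]
    have "y = 0" if "K z *v y = 0" for y
    proof -
      have "0 = (gram z *v y) \<bullet> (K z *v y)" using that by simp
      also have "\<dots> = (\<Sum>j<n1. (Y1 j (pt z) c \<bullet> (gram z *v y))\<^sup>2) + (\<Sum>j<n2. (Y2 j (pt z) c \<bullet> (gram z *v y))\<^sup>2)"
        by (simp add: K_def K1_def matrix_vector_mult_add_rdistrib inner_right_distrib frame_op_eq inner_sum_scaleR_form)
      finally have "(\<Sum>j<n1. (Y1 j (pt z) c \<bullet> (gram z *v y))\<^sup>2) = 0" "(\<Sum>j<n2. (Y2 j (pt z) c \<bullet> (gram z *v y))\<^sup>2) = 0"
        using sum_nonneg[of "{..<n1}" "\<lambda>j. (Y1 j (pt z) c \<bullet> (gram z *v y))\<^sup>2"]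
          sum_nonneg[of "{..<n2}" "\<lambda>j. (Y2 j (pt z) c \<bullet> (gram z *v y))\<^sup>2"] by auto
      then have o1: "\<And>j. j < n1 \<Longrightarrow> Y1 j (pt z) c \<bullet> (gram z *v y) = 0"
        and o2: "\<And>j. j < n2 \<Longrightarrow> Y2 j (pt z) c \<bullet> (gram z *v y) = 0"
        by (simp_all add: sum_nonneg_eq_0_iff)
      \<comment> \<open>The paired value with \<open>K z *v y\<close> was a sum of squares, so both
        frames lie in this orthogonal complement. It is a subspace and therefore contains both
        subbundles, and finally \<open>cv z y\<close> itself.\<close>
      let ?O = "{v \<in> tangent_space AT (pt z). a (pt z) v (cv z y) = 0}"
      have subO: "subspace ?O"
        using subspace_add[OF tangent_space_subspace] subspace_scale[OF tangent_space_subspace]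
          subspace_0[OF tangent_space_subspace] a_linear[OF zc _ _ cv_tangent[OF zc]]
          a_linear(2)[OF zc cv_tangent[OF zc] cv_tangent[OF zc] cv_tangent[OF zc], of 0]
        by (auto intro!: subspaceI)
      have "Y1 j (pt z) \<in> ?O" if "j < n1" for j
        using o1[OF that] in1[OF z that] Tan(1) cv_eq[OF zc] gram_eq[OF zc, of "Y1 j (pt z) c" y] by auto
      then have "V1 (pt z) \<subseteq> ?O" unfolding V1[OF ptS(1)[OF z]] by (intro span_minimal subO) blast
      have "Y2 j (pt z) \<in> ?O" if "j < n2" for j
        using o2[OF that] in2[OF z that] Tan(2) cv_eq[OF zc] gram_eq[OF zc, of "Y2 j (pt z) c" y] by auto
      then have "V2 (pt z) \<subseteq> ?O" unfolding V2[OF ptS(2)[OF z]] by (intro span_minimal subO) blast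
      with \<open>V1 (pt z) \<subseteq> ?O\<close> have "proj1 z y + (cv z y - proj1 z y) \<in> ?O"
        using proj1[OF zc, of y] subspace_add[OF subO] by blast
      then have "y \<bullet> (gram z *v y) = 0" by (simp add: gram_eq[OF zc])
      then show "y = 0" using gram_pos[OF zc, of y] by force
    qed
    then have "\<exists>N. N ** K z = mat 1" by (simp add: matrix_left_invertible_ker)
    then show ?thesis using invertible_left_inverse invertible_det_nz by blast
  qed
  have PK: "Pm z = K1 z ** matrix_inv (K z)" if z: "z \<in> S" for z
  proof -
    have zc: "z \<in> chart_image c" using SS z by blast
    note Tan = V_facts(3,4)[OF zc] and cvl = linear_sum[OF cv_linear[OF zc]] linear_cmul[OF cv_linear[OF zc]]
    have "Pm z *v (K z *v y) = K1 z *v y" for y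
    proof -
      have "cv z (Y1 j (pt z) c) = Y1 j (pt z)" if "j < n1" for j using in1[OF z that] Tan(1) cv_eq[OF zc] by blast
      then have "cv z (K1 z *v y) = (\<Sum>j<n1. (Y1 j (pt z) c \<bullet> (gram z *v y)) *\<^sub>R Y1 j (pt z))"
        by (simp add: K1_def frame_op_eq cvl)
      then have "cv z (K1 z *v y) \<in> V1 (pt z)"
        using in1[OF z] V_facts(1)[OF zc] by (auto intro!: subspace_sum subspace_scale)
      then have 1: "Pm z *v (K1 z *v y) = K1 z *v y" by (simp add: Pm_range_iff[OF zc])
      have "cv z (Y2 j (pt z) c) = Y2 j (pt z)" if "j < n2" for j using in2[OF z that] Tan(2) cv_eq[OF zc] by blast
      then have "cv z (frame_op n2 Y2 z *v y) = (\<Sum>j<n2. (Y2 j (pt z) c \<bullet> (gram z *v y)) *\<^sub>R Y2 j (pt z))"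
        by (simp add: frame_op_eq cvl)
      then have "cv z (frame_op n2 Y2 z *v y) \<in> V2 (pt z)"
        using in2[OF z] V_facts(2)[OF zc] by (auto intro!: subspace_sum subspace_scale)
      then have "Pm z *v (frame_op n2 Y2 z *v y) = 0" by (simp add: Pm_kernel_iff[OF zc])
      with 1 show ?thesis by (simp add: K_def matrix_vector_mult_add_rdistrib matrix_vector_right_distrib)
    qed
    then have "Pm z ** K z = K1 z" by (simp add: matrix_eq matrix_vector_mul_assoc)
    then have "K1 z ** matrix_inv (K z) = Pm z ** (K z ** matrix_inv (K z))" by (simp add: matrix_mul_assoc)
    then show ?thesis by (simp add: matrix_inv_mult_eq_1[OF detK[OF z]])
  qed
  have sK1: "smooth_on S (\<lambda>x. K1 x $ i $ j)" for i j
    unfolding K1_def by (rule frame_op_smooth[OF S SS]) (rule sY1)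
  have sK: "smooth_on S (\<lambda>x. K x $ i $ j)" for i j
  proof -
    have "smooth_on S (\<lambda>x. frame_op n2 Y2 x $ i $ j)" by (rule frame_op_smooth[OF S SS]) (rule sY2)
    from smooth_on_add[OF S sK1 this] show ?thesis by (simp add: K_def)
  qed
  have "smooth_on S (\<lambda>x. (K1 x ** matrix_inv (K x)) $ i $ j)" for i j
    by (intro smooth_on_matrix_mult S sK1 smooth_on_matrix_inv sK detK)
  then have "smooth_on S (\<lambda>x. Pm x $ i $ j)" for i j
    by (rule smooth_on_cong[OF S, THEN iffD2, rotated]) (simp add: PK)
  then show thesis using that S xS SS by blast
qed

section \<open>Reduction to local coordinates\<close>

lemma Am_Bm_differentiable:
  assumes x: "x \<in> chart_image c"
  shows "Am differentiable (at x)" "Bm differentiable (at x)"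
proof -
  obtain S where S: "open S" "x \<in> S" "S \<subseteq> chart_image c" and P: "\<And>i j. smooth_on S (\<lambda>x. Pm x $ i $ j)"
    using Pm_smooth[OF x] by blast
  have g: "smooth_on S (\<lambda>x. gram x $ i $ j)" for i j by (rule smooth_on_subset[OF gram_smooth S(3)])
  have Q: "smooth_on S (\<lambda>x. (mat 1 - Pm x) $ i $ j)" for i j
    using smooth_on_diff[OF S(1) smooth_on_const P] by simp
  have tr: "smooth_on S (\<lambda>x. transpose (N x) $ i $ j)" if "\<And>i j. smooth_on S (\<lambda>x. N x $ i $ j)"
    for N :: "real^'n \<Rightarrow> real^'n^'n" and i j
    using that by (simp add: transpose_def)
  have "smooth_on S Am" "smooth_on S Bm"
    unfolding Am_def[abs_def] Bm_def[abs_def]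
    by (intro smooth_on_matrix smooth_on_matrix_mult tr P Q g S(1))+
  then show "Am differentiable (at x)" "Bm differentiable (at x)"
    using smooth_on_imp_differentiable S(2) by blast+
qed

lemma alpha12_local:
  assumes x: "x \<in> chart_image c"
  shows "alpha12_local (local_fun AT c F) (chart_image c) x Am Bm (Pm x)"
proof (rule alpha12_local.intro)
  have fin: "finsler_metric AT F" using metric by (simp add: alpha12_metric_def)
  show "open (chart_image c)" by (rule open_chart_image[OF c])
  show "x \<in> chart_image c" by (rule x)
  show "smooth_on (chart_image c \<times> (- {0})) (\<lambda>(x, y). local_fun AT c F x y)"
    "minkowski_norm (local_fun AT c F x)"
    using fin c x by (simp_all add: finsler_metric_def Compl_eq_Diff_UNIV)
  show "local_fun AT c F x' y = local_fun AT c F x'' z"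
    if "x' \<in> chart_image c" "x'' \<in> chart_image c" "y \<bullet> (Am x' *v y) = z \<bullet> (Am x'' *v z)"
      "y \<bullet> (Bm x' *v y) = z \<bullet> (Bm x'' *v z)" for x' x'' y z
    by (simp add: local_fun_eq that)
  show "y \<bullet> (Am x' *v z) = z \<bullet> (Am x' *v y)" "y \<bullet> (Bm x' *v z) = z \<bullet> (Bm x' *v y)"
    "y \<bullet> (Am x' *v y) \<ge> 0" "y \<bullet> (Bm x' *v y) \<ge> 0"
    if "x' \<in> chart_image c" for x' y z
    using gram_sym[OF that] a_nonneg[OF that] by (simp_all add: Am_form Bm_form that gram_eq)
  show "Am differentiable (at x)" "Bm differentiable (at x)" by (rule Am_Bm_differentiable[OF x])+
  show "Pm x *v (Pm x *v y) = Pm x *v y" for y by (rule Pm_idem[OF x])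
  show "Am x *v (Pm x *v y) = Am x *v y" for y
    by (simp add: Am_def matrix_vector_mul_assoc[symmetric] Pm_idem[OF x])
  show "Bm x *v (Pm x *v y) = 0" for y
    by (simp add: Bm_def matrix_vector_mul_assoc[symmetric] Pm_idem[OF x] matrix_vector_mult_diff_rdistrib)
  show "y \<bullet> (Am x *v y) > 0" if "Pm x *v y \<noteq> 0" for y
    using gram_pos[OF x that] by (simp add: Am_form[OF x])
  show "y \<bullet> (Bm x *v y) > 0" if "Pm x *v y \<noteq> y" for y
    using gram_pos[OF x, of "y - Pm x *v y"] that by (simp add: Bm_form[OF x])
  show "\<exists>y. Pm x *v y \<noteq> 0" "\<exists>y. Pm x *v y \<noteq> y" by (rule Pm_nontriv[OF x])+
qed

end

theorem theorem1p2:
  fixes X :: "'m topology"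
    and A :: "('m, 'n::finite) chart set"
    and a :: "'m \<Rightarrow> ('m, 'n) tvec \<Rightarrow> ('m, 'n) tvec \<Rightarrow> real"
    and n1 n2 :: nat
    and V1 V2 :: "'m \<Rightarrow> ('m, 'n) tvec set"
    and L :: "real \<Rightarrow> real \<Rightarrow> real"
    and F :: "'m \<Rightarrow> ('m, 'n) tvec \<Rightarrow> real"
  assumes "smooth_manifold X A"
    and "alpha12_metric X A a n1 n2 V1 V2 L F"
    and "landsberg_metric A F"
  shows "berwald_metric A F"
  unfolding berwald_metric_def
proof (intro conjI ballI allI impI)
  show "finsler_metric A F" using assms(3) by (simp add: landsberg_metric_def)
  fix c x and y :: "real^'n" and i p q r
  assume c: "c \<in> A" and x: "x \<in> chart_image c" and y: "y \<noteq> 0"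
  interpret alpha12_manifold X A a n1 n2 V1 V2 L F c
    by unfold_locales (rule assms c)+
  show "partial_y r (partial_y q (partial_y p (spray_coeff (local_fun A c F) i))) x y = 0"
    by (rule alpha12_local.landsberg_imp_berwald_at[OF alpha12_local[OF x] _ y])
      (use assms(3) c x in \<open>simp add: landsberg_metric_def\<close>)
qed

end
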